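(* Let $H$ be a bialgebra with a family $\mathbf R=\{R^{(c)}\}_{c\in C}$ of (universal) R-matrices for its comultiplication. Then for any $n\ge1$ and any transitive $n$-array $\mathbf c=(c_{i,j})_{1\le i<j\le n}$ with entries in $C$, $$J_{\mathbf c}=J_{\mathbf c}(\mathbf R):=R_{2,n+1}^{(c_{1,2})}\big(R_{3,n+2}^{(c_{2,3})}R_{3,n+1}^{(c_{1,3})}\big)\cdots\big(R_{n,2n-1}^{(c_{n-1,n})}\cdots R_{n,n+1}^{(c_{1,n})}\big)\in H^{\widehat\otimes 2n}$$ is a Drinfeld twist for $H^{\otimes n}$ with its standard comultiplication $\Delta_{H^{\otimes n}}$. In particular, for any $\boldsymbol d=(d_1,\dots,d_n)\in C^n$, $$\mathbf R(\mathbf c,\boldsymbol d):=(J_{\mathbf c}^{op})^{-1}R_{1,n+1}^{(d_1)}\cdots R_{n,2n}^{(d_n)}\,J_{\mathbf c}$$ is an R-matrix for $H^{\otimes n}$ with the comultiplication twisted by $J_{\mathbf c}$, that is $h\mapsto J_{\mathbf c}^{-1}\Delta_{H^{\otimes n}}(h)J_{\mathbf c}$, and thus $\mathbf R(\mathbf c,\boldsymbol d)$ solves the quantum Yang-Baxter equation.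
   Context: Algebras are unital associative over a field $\Bbbk$ of characteristic zero. For $X\in H^{\otimes k}$ and distinct positions $i_1,\dots,i_k$, $X_{i_1,\dots,i_k}\in H^{\otimes N}$ has the $s$-th factor of $X$ in position $i_s$ and $1$ elsewhere. $H^{\widehat\otimes m}$ denotes $H^{\otimes m}$ or a suitable completion: an algebra containing $H^{\otimes m}$ such that leg embeddings, permutations of factors, and comultiplication or counit applied to a factor extend to these algebras as algebra homomorphisms, with the usual identities among them (coassociativity, counit axioms, commutation of elements placed in disjoint legs) preserved. Let $(B,\Delta,\varepsilon)$ be a (topological) bialgebra, $\Delta:B\to B\widehat\otimes B$. An R-matrix for $B$ is an invertible $R\in B\widehat\otimes B$ with $\tau(\Delta(b))=R\Delta(b)R^{-1}$ for all $b\in B$ ($\tau$ the flip), $(\Delta\otimes\mathrm{id})(R)=R_{1,3}R_{2,3}$ and $(\mathrm{id}\otimes\Delta)(R)=R_{1,3}R_{1,2}$. The quantum Yang-Baxter equation (QYBE) is $R_{1,2}R_{1,3}R_{2,3}=R_{2,3}R_{1,3}R_{1,2}$ in $B^{\widehat\otimes3}$. A Drinfeld twist for $(B,\Delta)$ is an invertible $J\in B\widehat\otimes B$ such that $\Delta_J(b)=J^{-1}\Delta(b)J$ is a (topological) comultiplication on $B$ (coassociative, with counit $\varepsilon$) and $(\Delta\otimes\mathrm{id})(J)\cdot(J\otimes1)=(\mathrm{id}\otimes\Delta)(J)\cdot(1\otimes J)$. Standard comultiplication: $\Delta_{H^{\otimes n}}(h^1\otimes\cdots\otimes h^n)=h^1_{(1)}\otimes\cdots\otimes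 h^n_{(1)}\otimes h^1_{(2)}\otimes\cdots\otimes h^n_{(2)}$; $H^{\widehat\otimes2n}$ is regarded as $H^{\otimes n}\widehat\otimes H^{\otimes n}$. For $X=X_1\otimes\cdots\otimes X_{2n}$, $X^{op}=X_{n+1}\otimes\cdots\otimes X_{2n}\otimes X_1\otimes\cdots\otimes X_n$ (extended linearly). $\mathbf c$ is transitive if $c_{i,k}\in\{c_{i,j},c_{j,k}\}$ for all $1\le i<j<k\le n$.
   Formalization: A suitable completion is also required to satisfy: any identity u·f(x)=g(x)·v between composites f, g of leg embeddings, permutations, comultiplications and counits, u, v fixed, that holds on the uncompleted tensor power holds on the completion (automatic by density and continuity). *)

theory Defs
  imports "HOL-Algebra.Module"
begin

section \<open>Algebras and tensor powers over a field\<close>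

text \<open>The library locale \<open>algebra\<close> assumes commutativity, so unital associative algebras are
  introduced here.\<close>

definition k_algebra :: "'k ring \<Rightarrow> ('k, 'a) module \<Rightarrow> bool" where
  "k_algebra K A \<longleftrightarrow> module K A \<and> ring A \<and>
     (\<forall>a\<in>carrier K. \<forall>x\<in>carrier A. \<forall>y\<in>carrier A.
        (a \<odot>\<^bsub>A\<^esub> x) \<otimes>\<^bsub>A\<^esub> y = a \<odot>\<^bsub>A\<^esub> (x \<otimes>\<^bsub>A\<^esub> y) \<and>
        x \<otimes>\<^bsub>A\<^esub> (a \<odot>\<^bsub>A\<^esub> y) = a \<odot>\<^bsub>A\<^esub> (x \<otimes>\<^bsub>A\<^esub> y))"

definition linear_map :: "'k ring \<Rightarrow> ('k, 'a) module \<Rightarrow> ('k, 'b) module \<Rightarrow> ('a \<Rightarrow> 'b) \<Rightarrow> bool" where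
  "linear_map K M N f \<longleftrightarrow> f \<in> carrier M \<rightarrow> carrier N \<and>
     (\<forall>x\<in>carrier M. \<forall>y\<in>carrier M. f (x \<oplus>\<^bsub>M\<^esub> y) = f x \<oplus>\<^bsub>N\<^esub> f y) \<and>
     (\<forall>a\<in>carrier K. \<forall>x\<in>carrier M. f (a \<odot>\<^bsub>M\<^esub> x) = a \<odot>\<^bsub>N\<^esub> f x)"

definition alg_hom :: "'k ring \<Rightarrow> ('k, 'a) module \<Rightarrow> ('k, 'b) module \<Rightarrow> ('a \<Rightarrow> 'b) \<Rightarrow> bool" where
  "alg_hom K A B f \<longleftrightarrow> linear_map K A B f \<and> f \<in> ring_hom A B"

definition self_module :: "'k ring \<Rightarrow> ('k, 'k) module" where
  "self_module K = \<lparr>carrier = carrier K, mult = mult K, one = one K, zero = zero K, add = add K,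
                    smult = mult K\<rparr>"

definition tuples :: "('k, 'h) module \<Rightarrow> nat \<Rightarrow> 'h list set" where
  "tuples H m = {xs. length xs = m \<and> set xs \<subseteq> carrier H}"

definition multilinear ::
  "'k ring \<Rightarrow> ('k, 'h) module \<Rightarrow> nat \<Rightarrow> ('k, 'a) module \<Rightarrow> ('h list \<Rightarrow> 'a) \<Rightarrow> bool" where
  "multilinear K H m M f \<longleftrightarrow>
     f \<in> tuples H m \<rightarrow> carrier M \<and>
     (\<forall>xs\<in>tuples H m. \<forall>i<m. linear_map K H M (\<lambda>x. f (xs[i := x])))"

text \<open>The following says that the multilinear map \<open>t\<close> induces an \<^emph>\<open>injective\<close> linear map
  from the \<open>m\<close>-th tensor power of \<open>H\<close> to \<open>M\<close>; since \<open>K\<close> is a field, multilinear forms separate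
  the points of the tensor power, and linear forms extend from subspaces. Thus the
  span of the values of \<open>t\<close> is a copy of the tensor power inside \<open>M\<close>.\<close>

definition embeds_tensor_power ::
  "'k ring \<Rightarrow> ('k, 'h) module \<Rightarrow> nat \<Rightarrow> ('k, 'a) module \<Rightarrow> ('h list \<Rightarrow> 'a) \<Rightarrow> bool" where
  "embeds_tensor_power K H m M t \<longleftrightarrow>
     multilinear K H m M t \<and>
     (\<forall>\<phi>. multilinear K H m (self_module K) \<phi> \<longrightarrow>
        (\<exists>l. linear_map K M (self_module K) l \<and> (\<forall>xs\<in>tuples H m. l (t xs) = \<phi> xs)))"

definition lin_span :: "'k ring \<Rightarrow> ('k, 'a) module \<Rightarrow> 'a set \<Rightarrow> 'a set" where
  "lin_span K M E = \<Inter>{U. submodule U K M \<and> E \<subseteq> U}"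


section \<open>Systems of (completed) tensor powers\<close>

text \<open>Data of a (topological) bialgebra \<open>B\<close> together with its completed tensor powers:
  \<^item> \<open>tpow S m\<close> is the completed \<open>m\<close>-th tensor power,
  \<^item> \<open>tensors S m\<close> is the uncompleted \<open>m\<close>-th tensor power inside it, so that
    \<open>B\<close> is \<open>tensors S 1\<close>,
  \<^item> \<open>leg S N [i1, ..., ik]\<close> is \<open>X \<mapsto> X\<close> with its \<open>s\<close>-th factor in position \<open>is\<close> and \<open>1\<close> in the
    other positions among \<open>1, ..., N\<close>; for \<open>k = N\<close> these are the permutations of factors,
  \<^item> \<open>delta S m i\<close> and \<open>eps S m i\<close> apply the comultiplication resp. the counit to the \<open>i\<close>-th of
    \<open>m\<close> factors (positions are counted from \<open>1\<close>).\<close>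

record ('k, 'a) tensor_system =
  tpow :: "nat \<Rightarrow> ('k, 'a) module"
  tensors :: "nat \<Rightarrow> 'a set"
  leg :: "nat \<Rightarrow> nat list \<Rightarrow> 'a \<Rightarrow> 'a"
  delta :: "nat \<Rightarrow> nat \<Rightarrow> 'a \<Rightarrow> 'a"
  eps :: "nat \<Rightarrow> nat \<Rightarrow> 'a \<Rightarrow> 'a"

definition legs_ok :: "nat \<Rightarrow> nat list \<Rightarrow> bool" where
  "legs_ok N ps \<longleftrightarrow> distinct ps \<and> set ps \<subseteq> {1..N}"

abbreviation comul :: "('k, 'a) tensor_system \<Rightarrow> 'a \<Rightarrow> 'a" where
  "comul S \<equiv> delta S 1 1"

abbreviation flip :: "('k, 'a) tensor_system \<Rightarrow> 'a \<Rightarrow> 'a" where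
  "flip S \<equiv> leg S 2 [2, 1]"

text \<open>\<open>comul S\<close> is a comultiplication on \<open>B\<close>: an algebra homomorphism from \<open>B\<close> to the completed
  square, coassociative, and with counit as given by \<open>eps\<close>.\<close>

definition comultiplication :: "'k ring \<Rightarrow> ('k, 'a) tensor_system \<Rightarrow> bool" where
  "comultiplication K S \<longleftrightarrow>
     alg_hom K (tpow S 1\<lparr>carrier := tensors S 1\<rparr>) (tpow S 2) (comul S) \<and>
     (\<forall>b\<in>tensors S 1. delta S 2 1 (comul S b) = delta S 2 2 (comul S b)) \<and>
     (\<forall>b\<in>tensors S 1. eps S 2 1 (comul S b) = b \<and> eps S 2 2 (comul S b) = b)"

definition R_matrix :: "('k, 'a) tensor_system \<Rightarrow> 'a \<Rightarrow> bool" where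
  "R_matrix S R \<longleftrightarrow>
     R \<in> Units (tpow S 2) \<and>
     (\<forall>b\<in>tensors S 1.
        flip S (comul S b) = R \<otimes>\<^bsub>tpow S 2\<^esub> comul S b \<otimes>\<^bsub>tpow S 2\<^esub> inv\<^bsub>tpow S 2\<^esub> R) \<and>
     delta S 2 1 R = leg S 3 [1, 3] R \<otimes>\<^bsub>tpow S 3\<^esub> leg S 3 [2, 3] R \<and>
     delta S 2 2 R = leg S 3 [1, 3] R \<otimes>\<^bsub>tpow S 3\<^esub> leg S 3 [1, 2] R"

definition QYBE :: "('k, 'a) tensor_system \<Rightarrow> 'a \<Rightarrow> bool" where
  "QYBE S R \<longleftrightarrow>
     leg S 3 [1, 2] R \<otimes>\<^bsub>tpow S 3\<^esub> leg S 3 [1, 3] R \<otimes>\<^bsub>tpow S 3\<^esub> leg S 3 [2, 3] R =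
     leg S 3 [2, 3] R \<otimes>\<^bsub>tpow S 3\<^esub> leg S 3 [1, 3] R \<otimes>\<^bsub>tpow S 3\<^esub> leg S 3 [1, 2] R"

text \<open>The comultiplication \<open>b \<mapsto> J\<^sup>-\<^sup>1 \<Delta>(b) J\<close>, together with its
  extension \<open>X \<mapsto> J\<^sup>-\<^sup>1 (id \<otimes> \<Delta> \<otimes> id)(X) J\<close> to the factors of a tensor power, with \<open>J\<close> placed
  in the two positions produced by \<open>\<Delta>\<close>.\<close>

definition twisted :: "('k, 'a) tensor_system \<Rightarrow> 'a \<Rightarrow> ('k, 'a) tensor_system" where
  "twisted S J = S\<lparr>delta := \<lambda>m i X.
     inv\<^bsub>tpow S (m + 1)\<^esub> (leg S (m + 1) [i, i + 1] J) \<otimes>\<^bsub>tpow S (m + 1)\<^esub> delta S m i X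
       \<otimes>\<^bsub>tpow S (m + 1)\<^esub> leg S (m + 1) [i, i + 1] J\<rparr>"

definition drinfeld_twist :: "'k ring \<Rightarrow> ('k, 'a) tensor_system \<Rightarrow> 'a \<Rightarrow> bool" where
  "drinfeld_twist K S J \<longleftrightarrow>
     J \<in> Units (tpow S 2) \<and>
     comultiplication K (twisted S J) \<and>
     delta S 2 1 J \<otimes>\<^bsub>tpow S 3\<^esub> leg S 3 [1, 2] J = delta S 2 2 J \<otimes>\<^bsub>tpow S 3\<^esub> leg S 3 [2, 3] J"


section \<open>Completed tensor powers of a bialgebra\<close>

text \<open>Maps composed of leg embeddings, permutations, comultiplications and counits.\<close>

inductive structural :: "('k, 'a) tensor_system \<Rightarrow> nat \<Rightarrow> nat \<Rightarrow> ('a \<Rightarrow> 'a) \<Rightarrow> bool"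
  for S :: "('k, 'a) tensor_system" where
  ident: "structural S m m (\<lambda>x. x)"
| leg: "legs_ok N ps \<Longrightarrow> structural S (length ps) N (leg S N ps)"
| delta: "1 \<le> i \<Longrightarrow> i \<le> m \<Longrightarrow> structural S m (m + 1) (delta S m i)"
| eps: "1 \<le> i \<Longrightarrow> i \<le> m \<Longrightarrow> structural S m (m - 1) (eps S m i)"
| comp: "structural S m n f \<Longrightarrow> structural S n p g \<Longrightarrow> structural S m p (\<lambda>x. g (f x))"

text \<open>The list of \<open>N\<close> elements of \<open>H\<close> with the entries of \<open>xs\<close> in positions \<open>ps\<close> and \<open>1\<close>
  elsewhere.\<close>

definition place :: "('k, 'h) module \<Rightarrow> nat \<Rightarrow> nat list \<Rightarrow> 'h list \<Rightarrow> 'h list" where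
  "place H N ps xs =
     map (\<lambda>p. case map_of (zip ps xs) p of None \<Rightarrow> \<one>\<^bsub>H\<^esub> | Some x \<Rightarrow> x) [1..<N + 1]"

text \<open>A bialgebra \<open>H\<close> over a field \<open>K\<close> of characteristic zero, with counit \<open>\<epsilon>\<close>,
  and a system \<open>S\<close> of completed tensor powers of \<open>H\<close>. Here \<open>tens m [x1, ..., xm]\<close> is the pure
  tensor with factors \<open>x1, ..., xm\<close>; \<open>H\<close> is identified with the image of \<open>x \<mapsto> tens 1 [x]\<close>, and
  the comultiplication of \<open>x\<close> is \<open>comul S (tens 1 [x])\<close>, which may lie in the
  completion. The case of no completion is \<open>carrier (tpow S m) = tensors S m\<close> for all \<open>m\<close>.

  The last axiom makes precise that identities valid on the uncompleted tensor powers are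
  preserved in the completions; the elements \<open>u\<close>, \<open>v\<close> allow for identities such as
  \<open>R\<^sub>1\<^sub>2 (\<Delta> \<otimes> id)(x) = (\<Delta>\<^sup>o\<^sup>p \<otimes> id)(x) R\<^sub>1\<^sub>2\<close>. Coassociativity and the counit axioms in any
  factor, functoriality of leg embeddings, and commutation of elements placed in disjoint legs
  are all of this form. The axiom is void if there is no completion, and it follows by continuity
  whenever the uncompleted tensor powers are dense for Hausdorff topologies in which
  multiplication is separately continuous and the extended maps are continuous.\<close>

locale completed_bialgebra =
  fixes K :: "'k ring"
    and H :: "('k, 'h) module"
    and counit :: "'h \<Rightarrow> 'k"
    and tens :: "nat \<Rightarrow> 'h list \<Rightarrow> 'a"
    and S :: "('k, 'a) tensor_system"
  assumes field: "field K"
    and char_zero: "\<And>m :: nat. m > 0 \<Longrightarrow> [m] \<cdot>\<^bsub>K\<^esub> \<one>\<^bsub>K\<^esub> \<noteq> \<zero>\<^bsub>K\<^esub>"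
    and H_algebra: "k_algebra K H"
    and counit_hom: "alg_hom K H (self_module K) counit"
    and comult: "comultiplication K S"
    and tpow_algebra: "k_algebra K (tpow S m)"
    and tens_embeds: "embeds_tensor_power K H m (tpow S m) (tens m)"
    and tens_one: "tens m (replicate m \<one>\<^bsub>H\<^esub>) = \<one>\<^bsub>tpow S m\<^esub>"
    and tens_mult: "\<lbrakk>xs \<in> tuples H m; ys \<in> tuples H m\<rbrakk> \<Longrightarrow>
          tens m xs \<otimes>\<^bsub>tpow S m\<^esub> tens m ys = tens m (map2 (mult H) xs ys)"
    and tensors_eq: "tensors S m = lin_span K (tpow S m) (tens m ` tuples H m)"
    and leg_hom: "legs_ok N ps \<Longrightarrow> alg_hom K (tpow S (length ps)) (tpow S N) (leg S N ps)"
    and leg_tens: "\<lbrakk>legs_ok N ps; xs \<in> tuples H (length ps)\<rbrakk> \<Longrightarrow>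
          leg S N ps (tens (length ps) xs) = tens N (place H N ps xs)"
    and delta_hom: "\<lbrakk>1 \<le> i; i \<le> m\<rbrakk> \<Longrightarrow> alg_hom K (tpow S m) (tpow S (m + 1)) (delta S m i)"
    and delta_tens: "\<lbrakk>1 \<le> i; i \<le> m; xs \<in> tuples H m\<rbrakk> \<Longrightarrow>
          delta S m i (tens m xs) =
            leg S (m + 1) [i, i + 1] (comul S (tens 1 [xs ! (i - 1)])) \<otimes>\<^bsub>tpow S (m + 1)\<^esub>
            tens (m + 1) (take (i - 1) xs @ [\<one>\<^bsub>H\<^esub>, \<one>\<^bsub>H\<^esub>] @ drop i xs)"
    and eps_hom: "\<lbrakk>1 \<le> i; i \<le> m\<rbrakk> \<Longrightarrow> alg_hom K (tpow S m) (tpow S (m - 1)) (eps S m i)"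
    and eps_tens: "\<lbrakk>1 \<le> i; i \<le> m; xs \<in> tuples H m\<rbrakk> \<Longrightarrow>
          eps S m i (tens m xs) =
            counit (xs ! (i - 1)) \<odot>\<^bsub>tpow S (m - 1)\<^esub> tens (m - 1) (take (i - 1) xs @ drop i xs)"
    and extension: "\<lbrakk>structural S m n f; structural S m n g;
          u \<in> carrier (tpow S n); v \<in> carrier (tpow S n);
          \<And>x. x \<in> tensors S m \<Longrightarrow> u \<otimes>\<^bsub>tpow S n\<^esub> f x = g x \<otimes>\<^bsub>tpow S n\<^esub> v;
          x \<in> carrier (tpow S m)\<rbrakk> \<Longrightarrow> u \<otimes>\<^bsub>tpow S n\<^esub> f x = g x \<otimes>\<^bsub>tpow S n\<^esub> v"


section \<open>The tensor power of a bialgebra as a bialgebra\<close>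

text \<open>The bialgebra given by the \<open>n\<close>-th tensor power of \<open>B\<close>: its factors are blocks
  of \<open>n\<close> consecutive factors of the original system. Its comultiplication, applied to the \<open>i\<close>-th
  block \<open>s + 1, ..., s + n\<close> where \<open>s = (i - 1) n\<close>, first applies \<open>\<Delta>\<close> to every factor of the block
  (from right to left, so that the positions of the remaining factors do not change), and then
  moves the first components to \<open>s + 1, ..., s + n\<close> and the second ones to
  \<open>s + n + 1, ..., s + 2n\<close>. In particular \<open>\<Delta>(h)\<close> goes to positions \<open>j\<close>, \<open>n + j\<close> for \<open>h\<close> in
  position \<open>j\<close>.\<close>

definition block :: "nat \<Rightarrow> nat \<Rightarrow> nat list" where
  "block n i = [(i - 1) * n + 1 ..< i * n + 1]"

definition unshuffle :: "nat \<Rightarrow> nat \<Rightarrow> nat \<Rightarrow> nat list" where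
  "unshuffle n m i = (let s = (i - 1) * n in
     [1 ..< s + 1] @ concat (map (\<lambda>j. [s + j, s + n + j]) [1 ..< n + 1]) @
     [s + 2 * n + 1 ..< (m + 1) * n + 1])"

definition tensor_power ::
  "nat \<Rightarrow> ('k, 'a) tensor_system \<Rightarrow> ('k, 'a) tensor_system" where
  "tensor_power n S = \<lparr>
     tpow = (\<lambda>m. tpow S (m * n)),
     tensors = (\<lambda>m. tensors S (m * n)),
     leg = (\<lambda>N ps. leg S (N * n) (concat (map (block n) ps))),
     delta = (\<lambda>m i X. leg S ((m + 1) * n) (unshuffle n m i)
                (fold (\<lambda>r. delta S (m * n + r) (i * n - r)) [0 ..< n] X)),
     eps = (\<lambda>m i. fold (\<lambda>r. eps S (m * n - r) (i * n - r)) [0 ..< n])\<rparr>"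


section \<open>The twists and R-matrices attached to a transitive array\<close>

definition transitive_array :: "nat \<Rightarrow> (nat \<Rightarrow> nat \<Rightarrow> 'c) \<Rightarrow> bool" where
  "transitive_array n c \<longleftrightarrow>
     (\<forall>i j k. 1 \<le> i \<and> i < j \<and> j < k \<and> k \<le> n \<longrightarrow> c i k \<in> {c i j, c j k})"

definition ordered_prod :: "('a, 'm) monoid_scheme \<Rightarrow> 'a list \<Rightarrow> 'a" where
  "ordered_prod A xs = foldr (mult A) xs \<one>\<^bsub>A\<^esub>"

definition J_twist ::
  "('k, 'a) tensor_system \<Rightarrow> ('c \<Rightarrow> 'a) \<Rightarrow> nat \<Rightarrow> (nat \<Rightarrow> nat \<Rightarrow> 'c) \<Rightarrow> 'a" where
  "J_twist S R n c = ordered_prod (tpow S (2 * n))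
     (concat (map (\<lambda>k. map (\<lambda>j. leg S (2 * n) [k, n + j] (R (c j k))) (rev [1 ..< k]))
                  [2 ..< n + 1]))"

definition op :: "('k, 'a) tensor_system \<Rightarrow> nat \<Rightarrow> 'a \<Rightarrow> 'a" where
  "op S n = leg S (2 * n) ([n + 1 ..< 2 * n + 1] @ [1 ..< n + 1])"

definition R_cd ::
  "('k, 'a) tensor_system \<Rightarrow> ('c \<Rightarrow> 'a) \<Rightarrow> nat \<Rightarrow> (nat \<Rightarrow> nat \<Rightarrow> 'c) \<Rightarrow> (nat \<Rightarrow> 'c) \<Rightarrow> 'a" where
  "R_cd S R n c d =
     inv\<^bsub>tpow S (2 * n)\<^esub> (op S n (J_twist S R n c)) \<otimes>\<^bsub>tpow S (2 * n)\<^esub>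
     ordered_prod (tpow S (2 * n)) (map (\<lambda>i. leg S (2 * n) [i, n + i] (R (d i))) [1 ..< n + 1])
       \<otimes>\<^bsub>tpow S (2 * n)\<^esub> J_twist S R n c"

end

theory Submission
  imports Defs
begin

text \<open>A map composed of leg embeddings, comultiplications and counits is determined by the lists of
  positions over which it distributes the iterated coproducts of the factors: by the extension
  axiom it suffices to compare two such maps on tensors with one nontrivial factor, where
  coassociativity and the counit axioms apply. The structural maps of \<open>H\<^sup>\<otimes>\<^sup>n\<close> treat blocks of \<open>n\<close>
  positions in parallel, so they are determined by such lists as well, and every identity between
  structural maps of \<open>H\<close> or \<open>H\<^sup>\<otimes>\<^sup>n\<close> becomes a comparison of lists.

  Any two R-matrices \<open>P\<close>, \<open>Q\<close> of the family satisfy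
  \<open>P\<^sub>1\<^sub>2 T\<^sub>1\<^sub>3 Q\<^sub>2\<^sub>3 = Q\<^sub>2\<^sub>3 T\<^sub>1\<^sub>3 P\<^sub>1\<^sub>2\<close> for \<open>T \<in> {P, Q}\<close>, and transitivity of the array says that
  this applies to the triples of indices \<open>i < j < k\<close>. Together with the commutation of factors
  without common legs, this yields the cocycle identity for \<open>J\<close> by induction on \<open>n\<close>, moving the
  factors of the last row past those of the previous ones. The commuting product of the
  \<open>R\<^sub>i\<^sub>,\<^sub>n\<^sub>+\<^sub>i\<close> is an R-matrix for \<open>H\<^sup>\<otimes>\<^sup>n\<close>, and twisting it by a counital cocycle gives an R-matrix
  for the twisted comultiplication.\<close>

section \<open>Ordered products\<close>

text \<open>Tensors with one nontrivial factor suffice because pure tensors are products of them and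
  relations of the form \<open>u f(x) = g(x) u\<close> are multiplicative in \<open>x\<close>. The
  defining relation of an R-matrix has this form too, which carries it from \<open>H\<close> to
  every completed tensor power. This is essential, since the axioms for the twisted R-matrix and the
  Yang-Baxter equations apply it to coproducts of \<open>J\<close> and of R-matrices, not of
  elements of \<open>H\<close>.

  Twisting is carried out for any system of algebras with coherent structural maps, an interface met
  by \<open>H\<close> and by its tensor powers alike. The counit axiom for the twisted
  comultiplication asks that either counit send \<open>J\<close> to \<open>1\<close>; this is
  derived from the invertibility of the R-matrices and their coproduct formulas.\<close>

context monoid
begin

lemma ordered_prod_closed [simp]:
  "set xs \<subseteq> carrier G \<Longrightarrow> ordered_prod G xs \<in> carrier G"
  by (induction xs) (auto simp: ordered_prod_def)

lemma ordered_prod_Nil [simp]: "ordered_prod G [] = \<one>"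
  by (simp add: ordered_prod_def)

lemma ordered_prod_Cons [simp]: "ordered_prod G (x # xs) = x \<otimes> ordered_prod G xs"
  by (simp add: ordered_prod_def)

lemma ordered_prod_append:
  "\<lbrakk>set xs \<subseteq> carrier G; set ys \<subseteq> carrier G\<rbrakk>
    \<Longrightarrow> ordered_prod G (xs @ ys) = ordered_prod G xs \<otimes> ordered_prod G ys"
  by (induction xs) (auto simp: m_assoc)

lemma ordered_prod_Units: "set xs \<subseteq> Units G \<Longrightarrow> ordered_prod G xs \<in> Units G"
  by (induction xs) auto

lemma ordered_prod_intertwine:
  assumes "w \<in> carrier G"
    and "\<And>i. i \<in> set xs \<Longrightarrow> f i \<in> carrier G" "\<And>i. i \<in> set xs \<Longrightarrow> g i \<in> carrier G"
    and "\<And>i. i \<in> set xs \<Longrightarrow> f i \<otimes> w = w \<otimes> g i"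
  shows "ordered_prod G (map f xs) \<otimes> w = w \<otimes> ordered_prod G (map g xs)"
  using assms(2-)
proof (induction xs)
  case Nil
  then show ?case using assms(1) by simp
next
  case (Cons i xs)
  have F: "ordered_prod G (map f xs) \<in> carrier G" "ordered_prod G (map g xs) \<in> carrier G"
    using Cons.prems by (auto intro!: ordered_prod_closed)
  have i: "f i \<in> carrier G" "g i \<in> carrier G" "f i \<otimes> w = w \<otimes> g i"
    using Cons.prems by auto
  have IH: "ordered_prod G (map f xs) \<otimes> w = w \<otimes> ordered_prod G (map g xs)"
    using Cons.prems by (intro Cons.IH) auto
  have "f i \<otimes> ordered_prod G (map f xs) \<otimes> w = f i \<otimes> w \<otimes> ordered_prod G (map g xs)"
    using i(1,2) IH F assms(1) by (simp add: m_assoc)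
  also have "\<dots> = w \<otimes> g i \<otimes> ordered_prod G (map g xs)"
    by (simp only: i(3))
  finally show ?case
    using i(1,2) F assms(1) by (simp add: m_assoc)
qed

lemma ordered_prod_commute:
  assumes "w \<in> carrier G" "\<And>i. i \<in> set xs \<Longrightarrow> f i \<in> carrier G"
    and "\<And>i. i \<in> set xs \<Longrightarrow> f i \<otimes> w = w \<otimes> f i"
  shows "ordered_prod G (map f xs) \<otimes> w = w \<otimes> ordered_prod G (map f xs)"
  using assms by (intro ordered_prod_intertwine)

text \<open>To collect all \<open>f\<close> in front, each \<open>g i\<close> has to cross only the
  \<open>f j\<close> that come later in the list; \<open>sorted_wrt\<close> expresses exactly these
  pairs. In particular \<open>g i\<close> and \<open>f i\<close> may fail to commute, as they do for
  R-matrices that share a leg.\<close>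

lemma ordered_prod_mult:
  assumes "\<And>i. i \<in> set xs \<Longrightarrow> f i \<in> carrier G" "\<And>i. i \<in> set xs \<Longrightarrow> g i \<in> carrier G"
    and "sorted_wrt (\<lambda>i j. g i \<otimes> f j = f j \<otimes> g i) xs"
  shows "ordered_prod G (map (\<lambda>i. f i \<otimes> g i) xs) =
    ordered_prod G (map f xs) \<otimes> ordered_prod G (map g xs)"
  using assms
proof (induction xs)
  case Nil
  then show ?case by simp
next
  case (Cons i xs)
  let ?F = "ordered_prod G (map f xs)" and ?G = "ordered_prod G (map g xs)"
  have F: "?F \<in> carrier G" "?G \<in> carrier G"
    using Cons.prems by (auto intro!: ordered_prod_closed)
  have i: "f i \<in> carrier G" "g i \<in> carrier G"
    using Cons.prems by auto
  have "?F \<otimes> g i = g i \<otimes> ?F"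
    using Cons.prems by (intro ordered_prod_commute) auto
  then have "f i \<otimes> (g i \<otimes> (?F \<otimes> ?G)) = f i \<otimes> (?F \<otimes> (g i \<otimes> ?G))"
    using F i by (simp flip: m_assoc)
  then show ?case
    using Cons F i by (simp add: m_assoc)
qed

end

section \<open>Products over rows and over triangles of indices\<close>

definition row_prod :: "('a, 'm) monoid_scheme \<Rightarrow> (nat \<Rightarrow> 'a) \<Rightarrow> nat \<Rightarrow> 'a" where
  "row_prod G f k = ordered_prod G (map f (rev [1..<Suc k]))"

text \<open>The shape of \<open>J\<close>: rows \<open>k\<close> increase from left to right and
  each row is read downwards. The empty row \<open>k = 1\<close> is included so that the recursion
  can start at \<open>n = 0\<close>.\<close>

definition tri_prod :: "('a, 'm) monoid_scheme \<Rightarrow> (nat \<Rightarrow> nat \<Rightarrow> 'a) \<Rightarrow> nat \<Rightarrow> 'a" where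
  "tri_prod G f n =
     ordered_prod G (concat (map (\<lambda>k. map (f k) (rev [1..<k])) [1..<Suc n]))"

context monoid
begin

lemma row_prod_0 [simp]: "row_prod G f 0 = \<one>"
  by (simp add: row_prod_def)

lemma row_prod_Suc [simp]: "row_prod G f (Suc k) = f (Suc k) \<otimes> row_prod G f k"
  by (simp add: row_prod_def)

lemma row_prod_closed [simp]:
  "(\<And>i. 1 \<le> i \<Longrightarrow> i \<le> k \<Longrightarrow> f i \<in> carrier G) \<Longrightarrow> row_prod G f k \<in> carrier G"
  unfolding row_prod_def by (rule ordered_prod_closed) auto

lemma row_prod_intertwine:
  assumes "w \<in> carrier G"
    and "\<And>i. 1 \<le> i \<Longrightarrow> i \<le> k \<Longrightarrow> f i \<in> carrier G" "\<And>i. 1 \<le> i \<Longrightarrow> i \<le> k \<Longrightarrow> g i \<in> carrier G"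
    and "\<And>i. 1 \<le> i \<Longrightarrow> i \<le> k \<Longrightarrow> f i \<otimes> w = w \<otimes> g i"
  shows "row_prod G f k \<otimes> w = w \<otimes> row_prod G g k"
  unfolding row_prod_def using assms by (intro ordered_prod_intertwine) auto

lemma row_prod_mult:
  assumes "\<And>i. 1 \<le> i \<Longrightarrow> i \<le> k \<Longrightarrow> f i \<in> carrier G" "\<And>i. 1 \<le> i \<Longrightarrow> i \<le> k \<Longrightarrow> g i \<in> carrier G"
    and "\<And>i j. \<lbrakk>1 \<le> j; j < i; i \<le> k\<rbrakk> \<Longrightarrow> g i \<otimes> f j = f j \<otimes> g i"
  shows "row_prod G (\<lambda>i. f i \<otimes> g i) k = row_prod G f k \<otimes> row_prod G g k"
proof -
  \<comment> \<open>A row runs downwards, so the relation is verified on the increasing list with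
    its arguments exchanged, and then reversed.\<close>
  have "sorted_wrt (\<lambda>j i. g i \<otimes> f j = f j \<otimes> g i) [1..<Suc k]"
    by (rule sorted_wrt_mono_rel[OF _ sorted_wrt_upt]) (use assms(3) in auto)
  then show ?thesis
    unfolding row_prod_def using assms(1,2)
    by (intro ordered_prod_mult) (auto simp: sorted_wrt_rev simp del: upt_Suc)
qed

lemma row_prod_commute_row_prod:
  assumes "\<And>i. 1 \<le> i \<Longrightarrow> i \<le> k \<Longrightarrow> f i \<in> carrier G" "\<And>i. 1 \<le> i \<Longrightarrow> i \<le> l \<Longrightarrow> g i \<in> carrier G"
    and "\<And>i j. \<lbrakk>1 \<le> i; i \<le> k; 1 \<le> j; j \<le> l\<rbrakk> \<Longrightarrow> f i \<otimes> g j = g j \<otimes> f i"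
  shows "row_prod G f k \<otimes> row_prod G g l = row_prod G g l \<otimes> row_prod G f k"
  using assms by (intro row_prod_intertwine row_prod_intertwine[symmetric]) auto

lemma tri_prod_0 [simp]: "tri_prod G f 0 = \<one>"
  by (simp add: tri_prod_def)

lemma tri_prod_closed [simp]:
  "(\<And>i k. \<lbrakk>1 \<le> i; i < k; k \<le> n\<rbrakk> \<Longrightarrow> f k i \<in> carrier G) \<Longrightarrow> tri_prod G f n \<in> carrier G"
  unfolding tri_prod_def by (rule ordered_prod_closed) (auto simp del: upt_Suc)

lemma tri_prod_Units:
  "(\<And>i k. \<lbrakk>1 \<le> i; i < k; k \<le> n\<rbrakk> \<Longrightarrow> f k i \<in> Units G) \<Longrightarrow> tri_prod G f n \<in> Units G"
  unfolding tri_prod_def by (rule ordered_prod_Units) (auto simp del: upt_Suc)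

lemma tri_prod_Suc:
  assumes "\<And>i k. \<lbrakk>1 \<le> i; i < k; k \<le> Suc n\<rbrakk> \<Longrightarrow> f k i \<in> carrier G"
  shows "tri_prod G f (Suc n) = tri_prod G f n \<otimes> row_prod G (f (Suc n)) n"
proof -
  have "[1..<Suc (Suc n)] = [1..<Suc n] @ [Suc n]" by simp
  then show ?thesis
    unfolding tri_prod_def row_prod_def using assms
    by (simp del: upt_Suc) (subst ordered_prod_append; auto simp del: upt_Suc)
qed

lemma tri_prod_commute:
  assumes w: "w \<in> carrier G"
    and f: "\<And>i k. \<lbrakk>1 \<le> i; i < k; k \<le> n\<rbrakk> \<Longrightarrow> f k i \<in> carrier G"
    and c: "\<And>i k. \<lbrakk>1 \<le> i; i < k; k \<le> n\<rbrakk> \<Longrightarrow> f k i \<otimes> w = w \<otimes> f k i"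
  shows "tri_prod G f n \<otimes> w = w \<otimes> tri_prod G f n"
proof -
  let ?xs = "concat (map (\<lambda>k. map (f k) (rev [1..<k])) [1..<Suc n])"
  have "set ?xs \<subseteq> carrier G" "\<forall>x\<in>set ?xs. x \<otimes> w = w \<otimes> x"
    using f c by (auto simp del: upt_Suc)
  then have "ordered_prod G (map (\<lambda>x. x) ?xs) \<otimes> w = w \<otimes> ordered_prod G (map (\<lambda>x. x) ?xs)"
    using w by (intro ordered_prod_commute) blast+
  then show ?thesis by (simp only: tri_prod_def list.map_ident)
qed

end

lemma tri_prod_cong:
  "(\<And>i k. \<lbrakk>1 \<le> i; i < k; k \<le> n\<rbrakk> \<Longrightarrow> f k i = g k i) \<Longrightarrow> tri_prod G f n = tri_prod G g n"
  unfolding tri_prod_def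
  by (intro arg_cong[where f = "ordered_prod G"] arg_cong[where f = concat] map_cong) auto

section \<open>Reordering triangular products by Yang-Baxter equations\<close>

context monoid
begin

text \<open>Grouped as pairs \<open>Y i\<close>, \<open>X i\<close>, the factors let
  \<open>w\<close> pass by one Yang-Baxter equation per pair, which reverses that pair. Pulling the
  pairs apart into two rows exchanges only factors with different indices.\<close>

lemma row_prod_reverse:
  assumes w: "w \<in> carrier G"
    and X: "\<And>i. \<lbrakk>1 \<le> i; i \<le> k\<rbrakk> \<Longrightarrow> X i \<in> carrier G"
    and Y: "\<And>i. \<lbrakk>1 \<le> i; i \<le> k\<rbrakk> \<Longrightarrow> Y i \<in> carrier G"
    and YB: "\<And>i. \<lbrakk>1 \<le> i; i \<le> k\<rbrakk> \<Longrightarrow> w \<otimes> X i \<otimes> Y i = Y i \<otimes> X i \<otimes> w"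
    and XY: "\<And>i j. \<lbrakk>1 \<le> i; i \<le> k; 1 \<le> j; j \<le> k; i \<noteq> j\<rbrakk> \<Longrightarrow> Y i \<otimes> X j = X j \<otimes> Y i"
  shows "row_prod G Y k \<otimes> row_prod G X k \<otimes> w = w \<otimes> row_prod G X k \<otimes> row_prod G Y k"
proof -
  have "row_prod G (\<lambda>i. Y i \<otimes> X i) k \<otimes> w = w \<otimes> row_prod G (\<lambda>i. X i \<otimes> Y i) k"
    using w X Y YB by (intro row_prod_intertwine) (auto simp: m_assoc)
  moreover have "row_prod G (\<lambda>i. Y i \<otimes> X i) k = row_prod G Y k \<otimes> row_prod G X k"
    using X Y XY by (intro row_prod_mult) (auto)
  moreover have "row_prod G (\<lambda>i. X i \<otimes> Y i) k = row_prod G X k \<otimes> row_prod G Y k"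
    using X Y XY by (intro row_prod_mult) (auto)
  ultimately show ?thesis using w X Y by (simp add: m_assoc)
qed

text \<open>All Yang-Baxter triples here share one leg \<open>x\<close>: \<open>X i\<close> is in
  legs \<open>(x, z i)\<close>, \<open>W j\<close> in \<open>(x, y j)\<close> and
  \<open>Y j i\<close> in \<open>(y j, z i)\<close>. In the cocycle identity \<open>x\<close>
  belongs to the new row, and the lemma moves this row through the triangle of the older
  \<open>Y\<close>.\<close>

lemma tri_prod_row_prod:
  assumes X: "\<And>i. \<lbrakk>1 \<le> i; i \<le> m\<rbrakk> \<Longrightarrow> X i \<in> carrier G"
    and W: "\<And>i. \<lbrakk>1 \<le> i; i \<le> m\<rbrakk> \<Longrightarrow> W i \<in> carrier G"
    and Y: "\<And>i j. \<lbrakk>1 \<le> i; i < j; j \<le> m\<rbrakk> \<Longrightarrow> Y j i \<in> carrier G"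
    and YB: "\<And>i j. \<lbrakk>1 \<le> i; i < j; j \<le> m\<rbrakk> \<Longrightarrow> W j \<otimes> X i \<otimes> Y j i = Y j i \<otimes> X i \<otimes> W j"
    and YX: "\<And>i j k. \<lbrakk>1 \<le> i; i < j; j \<le> m; 1 \<le> k; k \<le> m; k \<noteq> i\<rbrakk> \<Longrightarrow> Y j i \<otimes> X k = X k \<otimes> Y j i"
    and YW: "\<And>i j k. \<lbrakk>1 \<le> i; i < j; j \<le> m; 1 \<le> k; k \<le> m; k \<noteq> j\<rbrakk> \<Longrightarrow> Y j i \<otimes> W k = W k \<otimes> Y j i"
  shows "tri_prod G Y m \<otimes> row_prod G X m \<otimes> row_prod G W m =
    row_prod G (\<lambda>i. X i \<otimes> W i) m \<otimes> tri_prod G Y m"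
  using assms
proof (induction m)
  case 0
  then show ?case by simp
next
  case (Suc m)
  let ?T = "tri_prod G Y m" and ?X = "row_prod G X m" and ?W = "row_prod G W m"
    and ?Y = "row_prod G (Y (Suc m)) m" and ?XW = "row_prod G (\<lambda>i. X i \<otimes> W i) m"
  let ?x = "X (Suc m)" and ?w = "W (Suc m)"
  note X = Suc.prems(1) and W = Suc.prems(2) and Y = Suc.prems(3)
  have cl: "?T \<in> carrier G" "?X \<in> carrier G" "?W \<in> carrier G" "?Y \<in> carrier G"
    "?x \<in> carrier G" "?w \<in> carrier G" "?XW \<in> carrier G"
    using X W Y by (auto intro!: tri_prod_closed row_prod_closed)
  have Yx: "?Y \<otimes> ?x = ?x \<otimes> ?Y"
    using X Y Suc.prems(5) by (intro row_prod_intertwine) auto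
  have Tx: "?T \<otimes> ?x = ?x \<otimes> ?T"
    using X Y Suc.prems(5) by (intro tri_prod_commute) auto
  have Tw: "?T \<otimes> ?w = ?w \<otimes> ?T"
    using W Y Suc.prems(6) by (intro tri_prod_commute) auto
  have YWr: "?Y \<otimes> ?W = ?W \<otimes> ?Y"
    using W Y Suc.prems(6) by (intro row_prod_commute_row_prod) auto
  have YXw: "?Y \<otimes> ?X \<otimes> ?w = ?w \<otimes> ?X \<otimes> ?Y"
    using X W Y Suc.prems(4,5) by (intro row_prod_reverse) auto
  have IH: "?T \<otimes> ?X \<otimes> ?W = ?XW \<otimes> ?T"
    using Suc.prems by (intro Suc.IH) auto
  have TS: "tri_prod G Y (Suc m) = ?T \<otimes> ?Y"
    using Y by (intro tri_prod_Suc) auto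
  have "tri_prod G Y (Suc m) \<otimes> row_prod G X (Suc m) \<otimes> row_prod G W (Suc m)
      = ?T \<otimes> (?Y \<otimes> ?x) \<otimes> ?X \<otimes> ?w \<otimes> ?W"
    using cl by (simp add: TS m_assoc)
  also have "\<dots> = (?T \<otimes> ?x) \<otimes> (?Y \<otimes> ?X \<otimes> ?w) \<otimes> ?W"
    using cl by (simp add: Yx m_assoc)
  \<comment> \<open>Besides the induction hypothesis, the Yang-Baxter equation enters only through
    \<open>YXw\<close>: the last row of \<open>Y\<close> and the row of \<open>X\<close> meet the
    top factor of \<open>W\<close>. Every other exchange is of factors without a common leg.\<close>
  also have "\<dots> = ?x \<otimes> (?T \<otimes> ?w) \<otimes> ?X \<otimes> (?Y \<otimes> ?W)"
    using cl by (simp add: Tx YXw m_assoc)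
  also have "\<dots> = ?x \<otimes> ?w \<otimes> (?T \<otimes> ?X \<otimes> ?W) \<otimes> ?Y"
    using cl by (simp add: Tw YWr m_assoc)
  also have "\<dots> = ?x \<otimes> ?w \<otimes> (?XW \<otimes> ?T) \<otimes> ?Y"
    by (simp add: IH)
  also have "\<dots> = row_prod G (\<lambda>i. X i \<otimes> W i) (Suc m) \<otimes> tri_prod G Y (Suc m)"
    using cl by (simp add: TS m_assoc)
  finally show ?case .
qed

text \<open>Think of \<open>X k i\<close>, \<open>Y k i\<close>, \<open>W k i\<close> as the R-matrices in legs \<open>(x k, z i)\<close>,
  \<open>(y k, z i)\<close>, \<open>(x k, y i)\<close>: factors without common leg commute, and the Yang-Baxter equation
  holds for the triples \<open>(x k, y j, z i)\<close> with \<open>i < j < k\<close>.\<close>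

lemma tri_prod_cocycle:
  assumes X: "\<And>i k. \<lbrakk>1 \<le> i; i < k; k \<le> n\<rbrakk> \<Longrightarrow> X k i \<in> carrier G"
    and Y: "\<And>i k. \<lbrakk>1 \<le> i; i < k; k \<le> n\<rbrakk> \<Longrightarrow> Y k i \<in> carrier G"
    and W: "\<And>i k. \<lbrakk>1 \<le> i; i < k; k \<le> n\<rbrakk> \<Longrightarrow> W k i \<in> carrier G"
    and YB: "\<And>i j k. \<lbrakk>1 \<le> i; i < j; j < k; k \<le> n\<rbrakk> \<Longrightarrow>
      W k j \<otimes> X k i \<otimes> Y j i = Y j i \<otimes> X k i \<otimes> W k j"
    and YX: "\<And>i j k l. \<lbrakk>1 \<le> i; i < j; j \<le> n; 1 \<le> k; k < l; l \<le> n; k \<noteq> i\<rbrakk> \<Longrightarrow>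
      Y j i \<otimes> X l k = X l k \<otimes> Y j i"
    and YW: "\<And>i j k l. \<lbrakk>1 \<le> i; i < j; j \<le> n; 1 \<le> k; k < l; l \<le> n; k \<noteq> j\<rbrakk> \<Longrightarrow>
      Y j i \<otimes> W l k = W l k \<otimes> Y j i"
    and XW: "\<And>i j k l. \<lbrakk>1 \<le> i; i < j; j \<le> n; 1 \<le> k; k < l; l \<le> n; j \<noteq> l\<rbrakk> \<Longrightarrow>
      X j i \<otimes> W l k = W l k \<otimes> X j i"
  shows "tri_prod G (\<lambda>k i. X k i \<otimes> Y k i) n \<otimes> tri_prod G W n =
    tri_prod G (\<lambda>k i. X k i \<otimes> W k i) n \<otimes> tri_prod G Y n"
  using assms
proof (induction n)
  case 0
  then show ?case by simp
next
  case (Suc n)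
  note X = Suc.prems(1) and Y = Suc.prems(2) and W = Suc.prems(3)
    and YB = Suc.prems(4) and YX = Suc.prems(5) and YW = Suc.prems(6) and XW = Suc.prems(7)
  let ?XY = "tri_prod G (\<lambda>k i. X k i \<otimes> Y k i)" and ?XW = "tri_prod G (\<lambda>k i. X k i \<otimes> W k i)"
    and ?Y = "tri_prod G Y" and ?W = "tri_prod G W"
  let ?x = "row_prod G (X (Suc n)) n" and ?y = "row_prod G (Y (Suc n)) n"
    and ?w = "row_prod G (W (Suc n)) n"
    and ?xy = "row_prod G (\<lambda>i. X (Suc n) i \<otimes> Y (Suc n) i) n"
    and ?xw = "row_prod G (\<lambda>i. X (Suc n) i \<otimes> W (Suc n) i) n"
  have cl: "?XY n \<in> carrier G" "?XW n \<in> carrier G" "?Y n \<in> carrier G" "?W n \<in> carrier G"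
    "?x \<in> carrier G" "?y \<in> carrier G" "?w \<in> carrier G" "?xy \<in> carrier G" "?xw \<in> carrier G"
    using X Y W by (auto intro!: tri_prod_closed row_prod_closed)
  have S: "?XY (Suc n) = ?XY n \<otimes> ?xy" "?XW (Suc n) = ?XW n \<otimes> ?xw"
    "?Y (Suc n) = ?Y n \<otimes> ?y" "?W (Suc n) = ?W n \<otimes> ?w"
    using X Y W by (auto intro!: tri_prod_Suc)
  have xy: "?xy = ?x \<otimes> ?y"
    using X Y YX by (intro row_prod_mult) auto
  have xW: "?W n \<otimes> ?x = ?x \<otimes> ?W n"
    using X W XW
    by (intro tri_prod_commute row_prod_intertwine[symmetric]) auto
  have yW: "?W n \<otimes> ?y = ?y \<otimes> ?W n"
    using Y W YW
    by (intro tri_prod_commute row_prod_intertwine[symmetric]) auto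
  have yw: "?y \<otimes> ?w = ?w \<otimes> ?y"
    using Y W YW by (intro row_prod_commute_row_prod) auto
  \<comment> \<open>The rows \<open>?x\<close> and \<open>?w\<close> have the first leg
    \<open>x (Suc n)\<close> in common, so crossing \<open>?Y n\<close> merges them into the single
    row \<open>?xw\<close>.\<close>
  have key: "?Y n \<otimes> ?x \<otimes> ?w = ?xw \<otimes> ?Y n"
    using X Y W YB YX YW by (intro tri_prod_row_prod) auto
  have IH: "?XY n \<otimes> ?W n = ?XW n \<otimes> ?Y n"
    using Suc.prems by (intro Suc.IH) auto
  have "?XY (Suc n) \<otimes> ?W (Suc n) = ?XY n \<otimes> ?x \<otimes> (?y \<otimes> ?W n) \<otimes> ?w"
    using cl by (simp add: S xy m_assoc)
  also have "\<dots> = ?XY n \<otimes> (?x \<otimes> ?W n) \<otimes> (?y \<otimes> ?w)"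
    using cl by (simp add: m_assoc flip: yW)
  also have "\<dots> = (?XY n \<otimes> ?W n) \<otimes> ?x \<otimes> ?w \<otimes> ?y"
    using cl by (simp add: m_assoc yw flip: xW)
  also have "\<dots> = ?XW n \<otimes> (?Y n \<otimes> ?x \<otimes> ?w) \<otimes> ?y"
    using cl by (simp add: m_assoc IH)
  also have "\<dots> = ?XW (Suc n) \<otimes> ?Y (Suc n)"
    using cl by (simp add: m_assoc S key)
  finally show ?case .
qed

end

section \<open>Homomorphisms of algebras\<close>

lemma k_algebraD:
  assumes "k_algebra K A"
  shows "module K A" "ring A" "monoid A"
  using assms ring.is_monoid by (auto simp: k_algebra_def)

lemma alg_homD:
  assumes "alg_hom K A B f"
  shows "f \<in> ring_hom A B" "x \<in> carrier A \<Longrightarrow> f x \<in> carrier B" "f \<one>\<^bsub>A\<^esub> = \<one>\<^bsub>B\<^esub>"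
    "\<lbrakk>x \<in> carrier A; y \<in> carrier A\<rbrakk> \<Longrightarrow> f (x \<otimes>\<^bsub>A\<^esub> y) = f x \<otimes>\<^bsub>B\<^esub> f y"
    "\<lbrakk>x \<in> carrier A; y \<in> carrier A\<rbrakk> \<Longrightarrow> f (x \<oplus>\<^bsub>A\<^esub> y) = f x \<oplus>\<^bsub>B\<^esub> f y"
    "\<lbrakk>a \<in> carrier K; x \<in> carrier A\<rbrakk> \<Longrightarrow> f (a \<odot>\<^bsub>A\<^esub> x) = a \<odot>\<^bsub>B\<^esub> f x"
  using assms by (auto simp: alg_hom_def linear_map_def ring_hom_def)

lemma alg_hom_ident: "alg_hom K A A (\<lambda>x. x)"
  by (auto simp: alg_hom_def linear_map_def ring_hom_def)

lemma alg_hom_comp: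
  assumes "alg_hom K A B f" "alg_hom K B C g"
  shows "alg_hom K A C (\<lambda>x. g (f x))"
  using assms by (auto simp: alg_hom_def linear_map_def ring_hom_def Pi_def)

lemma ring_hom_Units:
  assumes "h \<in> ring_hom A B" "monoid A" "monoid B" "x \<in> Units A"
  shows "h x \<in> Units B" "h (inv\<^bsub>A\<^esub> x) = inv\<^bsub>B\<^esub> (h x)"
proof -
  interpret A: monoid A by fact
  interpret B: monoid B by fact
  have x: "x \<in> carrier A" "inv\<^bsub>A\<^esub> x \<in> carrier A" using assms(4) by auto
  have "h x \<in> carrier B" "h (inv\<^bsub>A\<^esub> x) \<in> carrier B"
    using assms(1) x by (auto intro: ring_hom_closed)
  moreover have "h x \<otimes>\<^bsub>B\<^esub> h (inv\<^bsub>A\<^esub> x) = \<one>\<^bsub>B\<^esub>" "h (inv\<^bsub>A\<^esub> x) \<otimes>\<^bsub>B\<^esub> h x = \<one>\<^bsub>B\<^esub>"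
    using assms x by (auto simp: ring_hom_one simp flip: ring_hom_mult[OF assms(1)])
  ultimately show "h x \<in> Units B" "h (inv\<^bsub>A\<^esub> x) = inv\<^bsub>B\<^esub> (h x)"
    by (auto simp: Units_def intro!: B.inv_unique')
qed

lemma ring_hom_ordered_prod:
  assumes "h \<in> ring_hom A B" "monoid A" "set xs \<subseteq> carrier A"
  shows "h (ordered_prod A xs) = ordered_prod B (map h xs)"
  using assms(3)
proof (induction xs)
  case Nil
  then show ?case using assms(1) by (simp add: ordered_prod_def ring_hom_one)
next
  case (Cons x xs)
  interpret A: monoid A by fact
  have "ordered_prod A xs \<in> carrier A" using Cons.prems by simp
  then show ?case using Cons assms(1)
    by (simp add: ordered_prod_def ring_hom_mult)
qed

lemma ring_hom_tri_prod:
  assumes "h \<in> ring_hom A B" "monoid A"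
    and "\<And>i k. \<lbrakk>1 \<le> i; i < k; k \<le> n\<rbrakk> \<Longrightarrow> f k i \<in> carrier A"
  shows "h (tri_prod A f n) = tri_prod B (\<lambda>k i. h (f k i)) n"
  unfolding tri_prod_def
  by (subst ring_hom_ordered_prod[OF assms(1,2)])
     (use assms(3) in \<open>auto simp: map_concat o_def rev_map simp del: upt_Suc\<close>)

section \<open>Coherence of structural maps\<close>

text \<open>The positions that carry the content of position \<open>p\<close> after the
  comultiplication of factor \<open>i\<close>; later positions move up by one.
  \<open>drop_pos\<close> is the analogue for the counit.\<close>

definition split_pos :: "nat \<Rightarrow> nat \<Rightarrow> nat list" where
  "split_pos i p = (if p < i then [p] else if p = i then [i, i + 1] else [p + 1])"

definition drop_pos :: "nat \<Rightarrow> nat \<Rightarrow> nat list" where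
  "drop_pos i p = (if p < i then [p] else if p = i then [] else [p - 1])"

text \<open>\<open>rep S m N f D\<close>: the structural map \<open>f\<close> distributes the iterated coproduct of the \<open>s\<close>-th
  factor over the positions listed in \<open>D s\<close> (the counit is applied if \<open>D s\<close> is empty).\<close>

inductive rep ::
  "('k, 'a) tensor_system \<Rightarrow> nat \<Rightarrow> nat \<Rightarrow> ('a \<Rightarrow> 'a) \<Rightarrow> (nat \<Rightarrow> nat list) \<Rightarrow> bool"
  for S :: "('k, 'a) tensor_system" where
  ident: "rep S m m (\<lambda>x. x) (\<lambda>s. [s])"
| leg: "rep S m N f D \<Longrightarrow> legs_ok P ps \<Longrightarrow> length ps = N \<Longrightarrow>
    rep S m P (\<lambda>x. leg S P ps (f x)) (\<lambda>s. map (\<lambda>p. ps ! (p - 1)) (D s))"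
| delta: "rep S m N f D \<Longrightarrow> 1 \<le> i \<Longrightarrow> i \<le> N \<Longrightarrow> P = N + 1 \<Longrightarrow>
    rep S m P (\<lambda>x. delta S N i (f x)) (\<lambda>s. concat (map (split_pos i) (D s)))"
| eps: "rep S m N f D \<Longrightarrow> 1 \<le> i \<Longrightarrow> i \<le> N \<Longrightarrow> P = N - 1 \<Longrightarrow>
    rep S m P (\<lambda>x. eps S N i (f x)) (\<lambda>s. concat (map (drop_pos i) (D s)))"
| cong: "rep S m N f D \<Longrightarrow> (\<And>s. 1 \<le> s \<Longrightarrow> s \<le> m \<Longrightarrow> D s = D' s) \<Longrightarrow> rep S m N f D'"

lemma legs_ok_map:
  assumes "legs_ok N ps" "legs_ok (length ps) qs"
  shows "legs_ok N (map (\<lambda>p. ps ! (p - 1)) qs)"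
proof -
  have "inj_on (\<lambda>p. ps ! (p - 1)) (set qs)"
  proof (rule inj_onI)
    fix p q assume pq: "p \<in> set qs" "q \<in> set qs" "ps ! (p - 1) = ps ! (q - 1)"
    then have "p \<in> {1..length ps}" "q \<in> {1..length ps}"
      using assms(2) by (auto simp: legs_ok_def)
    moreover from this have "p - 1 = q - 1"
      using pq(3) assms(1) by (subst (asm) nth_eq_iff_index_eq) (auto simp: legs_ok_def)
    ultimately show "p = q" by auto
  qed
  moreover have "ps ! (p - 1) \<in> {1..N}" if "p \<in> set qs" for p
  proof -
    have "p - 1 < length ps" using that assms(2) by (fastforce simp: legs_ok_def)
    then show ?thesis using assms(1) nth_mem by (auto simp only: legs_ok_def)
  qed
  ultimately show ?thesis
    using assms(2) by (auto simp: legs_ok_def distinct_map)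
qed

lemma legs_ok_split: "\<lbrakk>legs_ok M ps; i \<le> M\<rbrakk> \<Longrightarrow> legs_ok (M + 1) (concat (map (split_pos i) ps))"
proof (induction ps)
  case (Cons p ps)
  have "set (split_pos i p) \<inter> set (split_pos i q) = {}" if "q \<in> set ps" for q
    using that Cons.prems by (auto simp: split_pos_def legs_ok_def)
  moreover have "distinct (split_pos i p)" "set (split_pos i p) \<subseteq> {1..M + 1}"
    using Cons.prems by (auto simp: split_pos_def legs_ok_def)
  ultimately show ?case
    using Cons by (auto simp: legs_ok_def)
qed (simp add: legs_ok_def)

lemma legs_ok_drop:
  "\<lbrakk>legs_ok M ps; 1 \<le> i; i \<le> M\<rbrakk> \<Longrightarrow> legs_ok (M - 1) (concat (map (drop_pos i) ps))"
proof (induction ps)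
  case (Cons p ps)
  have "set (drop_pos i p) \<inter> set (drop_pos i q) = {}" if "q \<in> set ps" for q
  proof -
    have "1 \<le> q" "1 \<le> p" "p \<noteq> q" using that Cons.prems by (auto simp: legs_ok_def)
    then show ?thesis by (auto simp: drop_pos_def)
  qed
  moreover have "distinct (drop_pos i p)" "set (drop_pos i p) \<subseteq> {1..M - 1}"
    using Cons.prems by (auto simp: drop_pos_def legs_ok_def)
  ultimately show ?case
    using Cons by (auto simp: legs_ok_def)
qed (simp add: legs_ok_def)

lemma concat_split_pos:
  "i \<notin> set ps \<Longrightarrow> concat (map (split_pos i) ps) = map (\<lambda>p. if p < i then p else p + 1) ps"
  by (induction ps) (auto simp: split_pos_def)

lemma concat_drop_pos:
  "i \<notin> set ps \<Longrightarrow> concat (map (drop_pos i) ps) = map (\<lambda>p. if p < i then p else p - 1) ps"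
  by (induction ps) (auto simp: drop_pos_def)

text \<open>Renaming, splitting and dropping positions preserve distinctness, so each list
  \<open>D s\<close> can itself serve as a list of legs. This is what allows \<open>rep_gen\<close>
  to be stated.\<close>

lemma rep_legs_ok:
  "rep S m N f D \<Longrightarrow> 1 \<le> s \<Longrightarrow> s \<le> m \<Longrightarrow> legs_ok N (D s)"
proof (induction rule: rep.induct)
  case (ident m)
  then show ?case by (simp add: legs_ok_def)
next
  case (leg m N f D P ps)
  then show ?case using legs_ok_map by blast
next
  case (delta m N f D i P)
  then show ?case by (auto intro!: legs_ok_split[simplified])
next
  case (eps m N f D i P)
  then show ?case by (auto intro!: legs_ok_drop[simplified])
next
  case (cong m N f D D')
  then show ?case by auto
qed

lemma rep_structural: "rep S m N f D \<Longrightarrow> structural S m N f"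
proof (induction rule: rep.induct)
  case (leg m N f D P ps)
  then show ?case using structural.comp structural.leg by blast
next
  case (delta m N f D i P)
  then show ?case using structural.comp structural.delta by blast
next
  case (eps m N f D i P)
  then show ?case using structural.comp structural.eps by blast
qed (auto intro: structural.intros)

lemma rep_comp:
  assumes "rep S N P g E" "rep S m N f D"
  shows "rep S m P (\<lambda>x. g (f x)) (\<lambda>s. concat (map E (D s)))"
  using assms
proof (induction rule: rep.induct)
  case (ident N)
  then show ?case by simp
next
  case (leg N N' g E P ps)
  then show ?case
    using rep.leg[of S m N' "\<lambda>x. g (f x)"] by (fastforce simp: map_concat o_def)
next
  case (delta N N' g E i P)
  have "concat (map (split_pos i) (concat (map E ps))) =
    concat (map (\<lambda>p. concat (map (split_pos i) (E p))) ps)" for ps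
    by (induction ps) auto
  then show ?case
    using rep.delta[OF delta.IH[OF delta.prems] delta.hyps(2-)] by simp
next
  case (eps N N' g E i P)
  have "concat (map (drop_pos i) (concat (map E ps))) =
    concat (map (\<lambda>p. concat (map (drop_pos i) (E p))) ps)" for ps
    by (induction ps) auto
  then show ?case
    using rep.eps[OF eps.IH[OF eps.prems] eps.hyps(2-)] by simp
next
  case (cong N P g E E')
  show ?case
  proof (rule rep.cong[OF cong.IH[OF cong.prems]])
    fix s assume "1 \<le> s" "s \<le> m"
    \<comment> \<open>\<open>E\<close> and \<open>E'\<close> agree only on \<open>1, ..., N\<close>,
      and all positions listed in \<open>D s\<close> lie there.\<close>
    then have "set (D s) \<subseteq> {1..N}"
      using rep_legs_ok[OF cong.prems] by (auto simp: legs_ok_def)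
    then show "concat (map E (D s)) = concat (map E' (D s))"
      using cong.hyps by (intro arg_cong[where f = concat] map_cong) auto
  qed
qed

section \<open>Tensors with one nontrivial factor as generators\<close>

context completed_bialgebra
begin

lemma tpow_module [simp]: "module K (tpow S m)"
  and tpow_ring [simp]: "ring (tpow S m)"
  and tpow_monoid [simp]: "monoid (tpow S m)"
  using tpow_algebra k_algebraD by blast+

lemma H_ring [simp]: "ring H"
  using H_algebra k_algebraD by blast

lemma H_one [simp]: "\<one>\<^bsub>H\<^esub> \<in> carrier H"
  using H_ring by (rule ring.ring_simprules)

lemma one_closed [simp]: "\<one>\<^bsub>tpow S m\<^esub> \<in> carrier (tpow S m)"
  using tpow_monoid by (rule monoid.one_closed)

lemma mult_closed [simp]:
  "\<lbrakk>x \<in> carrier (tpow S m); y \<in> carrier (tpow S m)\<rbrakk> \<Longrightarrow> x \<otimes>\<^bsub>tpow S m\<^esub> y \<in> carrier (tpow S m)"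
  using tpow_monoid by (rule monoid.m_closed)

lemma tens_closed [simp]: "xs \<in> tuples H m \<Longrightarrow> tens m xs \<in> carrier (tpow S m)"
  using tens_embeds[of m] by (auto simp: embeds_tensor_power_def multilinear_def)

definition gen :: "nat \<Rightarrow> nat \<Rightarrow> 'h \<Rightarrow> 'a" where
  "gen m s h = tens m (map (\<lambda>p. if p = s then h else \<one>\<^bsub>H\<^esub>) [1..<m + 1])"

lemma gen_tuple:
  "h \<in> carrier H \<Longrightarrow> map (\<lambda>p. if p = s then h else \<one>\<^bsub>H\<^esub>) [1..<m + 1] \<in> tuples H m"
  by (auto simp: tuples_def)

lemma gen_closed [simp]: "h \<in> carrier H \<Longrightarrow> gen m s h \<in> carrier (tpow S m)"
  unfolding gen_def by (intro tens_closed gen_tuple)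

lemma gen_1: "gen 1 1 h = tens 1 [h]"
  by (simp add: gen_def)

lemma tens_ones: "(\<And>x. x \<in> set xs \<Longrightarrow> x = \<one>\<^bsub>H\<^esub>) \<Longrightarrow> length xs = m \<Longrightarrow> tens m xs = \<one>\<^bsub>tpow S m\<^esub>"
  using tens_one[of m] by (metis replicate_length_same)

text \<open>A pure tensor is the product of tensors with one nontrivial factor each. The partial
  products are the \<open>ys k\<close>, in which only the first \<open>k\<close> factors have been
  filled in.\<close>

lemma tens_induct:
  assumes xs: "xs \<in> tuples H m"
    and one: "P \<one>\<^bsub>tpow S m\<^esub>"
    and gen: "\<And>s h. \<lbrakk>1 \<le> s; s \<le> m; h \<in> carrier H\<rbrakk> \<Longrightarrow> P (gen m s h)"
    and mult: "\<And>x y. \<lbrakk>x \<in> carrier (tpow S m); y \<in> carrier (tpow S m); P x; P y\<rbrakk>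
      \<Longrightarrow> P (x \<otimes>\<^bsub>tpow S m\<^esub> y)"
  shows "P (tens m xs)"
proof -
  define ys where "ys k = take k xs @ replicate (m - k) \<one>\<^bsub>H\<^esub>" for k
  have len: "length xs = m" and car: "set xs \<subseteq> carrier H"
    using xs by (auto simp: tuples_def)
  have ys: "ys k \<in> tuples H m" if "k \<le> m" for k
    using that car len set_take_subset[of k xs] by (auto simp: tuples_def ys_def)
  have "P (tens m (ys k))" if "k \<le> m" for k
    using that
  proof (induction k)
    case 0
    then show ?case using one by (simp add: ys_def tens_one)
  next
    case (Suc k)
    let ?g = "map (\<lambda>p. if p = Suc k then xs ! k else \<one>\<^bsub>H\<^esub>) [1..<m + 1]"
    have h: "xs ! k \<in> carrier H" using Suc.prems car len by (auto intro: subsetD[OF _ nth_mem])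
    have "ys (Suc k) = map2 (mult H) (ys k) ?g"
    proof (rule nth_equalityI)
      fix i assume "i < length (ys (Suc k))"
      then have i: "i < m" using Suc.prems len by (simp add: ys_def)
      then have "xs ! i \<in> carrier H" using car len by (auto intro: subsetD[OF _ nth_mem])
      then show "ys (Suc k) ! i = map2 (mult H) (ys k) ?g ! i"
        using i Suc.prems len ring.ring_simprules(6,12)[OF H_ring]
        by (auto simp: ys_def nth_append ring.is_monoid monoid.r_one monoid.l_one simp del: upt_Suc)
    qed (use Suc.prems len in \<open>simp add: ys_def\<close>)
    then have "tens m (ys (Suc k)) = tens m (ys k) \<otimes>\<^bsub>tpow S m\<^esub> gen m (Suc k) (xs ! k)"
      unfolding gen_def using ys[of k] Suc.prems gen_tuple[OF h] by (simp del: upt_Suc add: tens_mult)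
    then show ?case
      using Suc ys[of k] h by (auto intro!: mult gen)
  qed
  from this[of m] show ?thesis using len by (simp add: ys_def)
qed

lemma tensors_closed: "tensors S m \<subseteq> carrier (tpow S m)"
  using module.carrier_is_submodule[OF tpow_module] tensors_eq[of m]
  by (auto simp: lin_span_def)

lemma tens_in_tensors: "xs \<in> tuples H m \<Longrightarrow> tens m xs \<in> tensors S m"
  by (auto simp: tensors_eq lin_span_def)

lemma tensors_induct [consumes 1, case_names one gen mult add smult]:
  assumes x: "x \<in> tensors S m"
    and one: "P \<one>\<^bsub>tpow S m\<^esub>"
    and gen: "\<And>s h. \<lbrakk>1 \<le> s; s \<le> m; h \<in> carrier H\<rbrakk> \<Longrightarrow> P (gen m s h)"
    and mult: "\<And>x y. \<lbrakk>x \<in> carrier (tpow S m); y \<in> carrier (tpow S m); P x; P y\<rbrakk>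
      \<Longrightarrow> P (x \<otimes>\<^bsub>tpow S m\<^esub> y)"
    and add: "\<And>x y. \<lbrakk>x \<in> carrier (tpow S m); y \<in> carrier (tpow S m); P x; P y\<rbrakk>
      \<Longrightarrow> P (x \<oplus>\<^bsub>tpow S m\<^esub> y)"
    and smult: "\<And>a x. \<lbrakk>a \<in> carrier K; x \<in> carrier (tpow S m); P x\<rbrakk> \<Longrightarrow> P (a \<odot>\<^bsub>tpow S m\<^esub> x)"
  shows "P x"
proof -
  interpret module K "tpow S m" by simp
  let ?U = "{x \<in> carrier (tpow S m). P x}"
  \<comment> \<open>Zero is reached as the scalar \<open>0\<close> times the unit, and negatives as
    the scalar \<open>-1\<close> times an element, so the induction rule has no cases for
    them.\<close>
  have "submodule ?U K (tpow S m)"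
  proof (rule submoduleI)
    have "\<zero>\<^bsub>K\<^esub> \<odot>\<^bsub>tpow S m\<^esub> \<one>\<^bsub>tpow S m\<^esub> \<in> ?U" using smult[OF _ _ one, of "\<zero>\<^bsub>K\<^esub>"] by simp
    then show "\<zero>\<^bsub>tpow S m\<^esub> \<in> ?U" by simp
    fix a assume a: "a \<in> ?U"
    then have "(\<ominus>\<^bsub>K\<^esub> \<one>\<^bsub>K\<^esub>) \<odot>\<^bsub>tpow S m\<^esub> a \<in> ?U" using smult by auto
    then show "\<ominus>\<^bsub>tpow S m\<^esub> a \<in> ?U" using a by (simp add: smult_l_minus)
  qed (use add smult in auto)
  moreover have "tens m ` tuples H m \<subseteq> ?U"
    using tens_induct[of _ m P] one gen mult by auto
  ultimately show ?thesis using x by (auto simp: tensors_eq lin_span_def)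
qed

lemma structural_hom: "structural S m n f \<Longrightarrow> alg_hom K (tpow S m) (tpow S n) f"
  by (induction rule: structural.induct)
     (auto intro: alg_hom_ident alg_hom_comp leg_hom delta_hom[simplified] eps_hom[simplified])

text \<open>For products the relation is used twice,
  \<open>u f(x) f(y) = g(x) u f(y) = g(x) g(y) u\<close>. This requires the same \<open>u\<close> on
  both sides, although the extension axiom itself, which performs the passage to the completion,
  allows two different elements.\<close>

lemma intertwine_from_gen:
  assumes f: "structural S m n f" and g: "structural S m n g"
    and u: "u \<in> carrier (tpow S n)"
    and gen: "\<And>s h. \<lbrakk>1 \<le> s; s \<le> m; h \<in> carrier H\<rbrakk> \<Longrightarrow>
      u \<otimes>\<^bsub>tpow S n\<^esub> f (gen m s h) = g (gen m s h) \<otimes>\<^bsub>tpow S n\<^esub> u"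
    and x: "x \<in> carrier (tpow S m)"
  shows "u \<otimes>\<^bsub>tpow S n\<^esub> f x = g x \<otimes>\<^bsub>tpow S n\<^esub> u"
proof (rule extension[OF f g u u _ x])
  interpret A: ring "tpow S n" by simp
  interpret M: module K "tpow S n" by simp
  note F = alg_homD[OF structural_hom[OF f]] and G = alg_homD[OF structural_hom[OF g]]
  fix y assume "y \<in> tensors S m"
  then show "u \<otimes>\<^bsub>tpow S n\<^esub> f y = g y \<otimes>\<^bsub>tpow S n\<^esub> u"
  proof (induction rule: tensors_induct)
    case (mult x y)
    have "u \<otimes>\<^bsub>tpow S n\<^esub> f (x \<otimes>\<^bsub>tpow S m\<^esub> y) = (u \<otimes>\<^bsub>tpow S n\<^esub> f x) \<otimes>\<^bsub>tpow S n\<^esub> f y"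
      using mult(1,2) u F by (simp add: A.m_assoc)
    also have "\<dots> = g x \<otimes>\<^bsub>tpow S n\<^esub> (u \<otimes>\<^bsub>tpow S n\<^esub> f y)"
      unfolding mult(3) using mult(1,2) u F G by (simp add: A.m_assoc)
    also have "\<dots> = g (x \<otimes>\<^bsub>tpow S m\<^esub> y) \<otimes>\<^bsub>tpow S n\<^esub> u"
      unfolding mult(4) using mult(1,2) u F G by (simp add: A.m_assoc)
    finally show ?case .
  next
    case (smult a x)
    then show ?case
      using tpow_algebra[of n] u F G by (simp add: k_algebra_def)
  qed (use u F G gen in \<open>simp_all add: A.l_distr A.r_distr\<close>)
qed

lemma eq_from_gen:
  assumes f: "structural S m n f" and g: "structural S m n g"
    and gen: "\<And>s h. \<lbrakk>1 \<le> s; s \<le> m; h \<in> carrier H\<rbrakk> \<Longrightarrow> f (gen m s h) = g (gen m s h)"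
    and x: "x \<in> carrier (tpow S m)"
  shows "f x = g x"
proof -
  interpret A: ring "tpow S n" by simp
  note F = alg_homD[OF structural_hom[OF f]] and G = alg_homD[OF structural_hom[OF g]]
  have "\<one>\<^bsub>tpow S n\<^esub> \<otimes>\<^bsub>tpow S n\<^esub> f x = g x \<otimes>\<^bsub>tpow S n\<^esub> \<one>\<^bsub>tpow S n\<^esub>"
  proof (rule intertwine_from_gen[OF f g _ _ x])
    fix s h assume s: "1 \<le> s" "s \<le> m" "h \<in> carrier H"
    then have "g (gen m s h) \<in> carrier (tpow S n)" using G(2) by simp
    then show "\<one>\<^bsub>tpow S n\<^esub> \<otimes>\<^bsub>tpow S n\<^esub> f (gen m s h) = g (gen m s h) \<otimes>\<^bsub>tpow S n\<^esub> \<one>\<^bsub>tpow S n\<^esub>"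
      using gen[OF s] by simp
  qed simp
  then show ?thesis using F(2)[OF x] G(2)[OF x] by simp
qed

section \<open>Leg embeddings, comultiplications and counits on generators\<close>

lemma counit_closed [simp]: "h \<in> carrier H \<Longrightarrow> counit h \<in> carrier K"
  and counit_one [simp]: "counit \<one>\<^bsub>H\<^esub> = \<one>\<^bsub>K\<^esub>"
  using alg_homD[OF counit_hom] by (auto simp: self_module_def)

lemma smult_one_tpow [simp]: "x \<in> carrier (tpow S m) \<Longrightarrow> \<one>\<^bsub>K\<^esub> \<odot>\<^bsub>tpow S m\<^esub> x = x"
  using tpow_module by (rule module.smult_one)

lemma smult_closed [simp]:
  "\<lbrakk>a \<in> carrier K; x \<in> carrier (tpow S m)\<rbrakk> \<Longrightarrow> a \<odot>\<^bsub>tpow S m\<^esub> x \<in> carrier (tpow S m)"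
  using tpow_module by (rule module.smult_closed)

lemma leg_closed [simp]:
  "\<lbrakk>legs_ok N ps; x \<in> carrier (tpow S (length ps))\<rbrakk> \<Longrightarrow> leg S N ps x \<in> carrier (tpow S N)"
  using alg_homD[OF leg_hom] by blast

lemma delta_closed [simp]:
  "\<lbrakk>1 \<le> i; i \<le> m; x \<in> carrier (tpow S m)\<rbrakk> \<Longrightarrow> delta S m i x \<in> carrier (tpow S (m + 1))"
  using alg_homD[OF delta_hom] by blast

lemma leg_one [simp]: "legs_ok N ps \<Longrightarrow> leg S N ps \<one>\<^bsub>tpow S (length ps)\<^esub> = \<one>\<^bsub>tpow S N\<^esub>"
  using alg_homD(3)[OF leg_hom] by blast

lemma leg_one' : "legs_ok N ps \<Longrightarrow> length ps = k \<Longrightarrow> leg S N ps \<one>\<^bsub>tpow S k\<^esub> = \<one>\<^bsub>tpow S N\<^esub>"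
  by auto

lemma leg_gen:
  assumes "legs_ok N ps" "length ps = k" "1 \<le> s" "s \<le> k" "h \<in> carrier H"
  shows "leg S N ps (gen k s h) = gen N (ps ! (s - 1)) h"
proof -
  let ?ys = "map (\<lambda>p. if p = s then h else \<one>\<^bsub>H\<^esub>) [1..<length ps + 1]"
  have "place H N ps ?ys = map (\<lambda>p. if p = ps ! (s - 1) then h else \<one>\<^bsub>H\<^esub>) [1..<N + 1]"
    unfolding place_def
  proof (rule map_cong[OF refl])
    fix p
    show "(case map_of (zip ps ?ys) p of None \<Rightarrow> \<one>\<^bsub>H\<^esub> | Some x \<Rightarrow> x) =
      (if p = ps ! (s - 1) then h else \<one>\<^bsub>H\<^esub>)"
    proof (cases "p \<in> set ps")
      case True
      then obtain t where t: "t < length ps" "p = ps ! t" by (auto simp: in_set_conv_nth)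
      have "map_of (zip ps ?ys) p = Some (?ys ! t)"
        using assms(1) t by (simp add: map_of_zip_nth legs_ok_def del: upt_Suc)
      moreover have "?ys ! t = (if t = s - 1 then h else \<one>\<^bsub>H\<^esub>)"
        using t assms(3) by (auto simp del: upt_Suc)
      moreover have "p = ps ! (s - 1) \<longleftrightarrow> t = s - 1"
        using t assms(1-4) by (auto simp: legs_ok_def nth_eq_iff_index_eq)
      ultimately show ?thesis by simp
    next
      case False
      then have none: "map_of (zip ps ?ys) p = None"
        by (subst map_of_zip_is_None) (auto simp del: upt_Suc)
      have "p \<noteq> ps ! (s - 1)" using False assms(2-4) by auto
      then show ?thesis unfolding none by simp
    qed
  qed
  then show ?thesis
    using leg_tens[OF assms(1) gen_tuple[OF assms(5), of s]] assms(2) by (simp add: gen_def)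
qed

lemma leg_leg:
  assumes "legs_ok N ps" "legs_ok (length ps) qs" "x \<in> carrier (tpow S (length qs))"
  shows "leg S N ps (leg S (length ps) qs x) = leg S N (map (\<lambda>p. ps ! (p - 1)) qs) x"
proof (rule eq_from_gen[OF _ _ _ assms(3)])
  show "structural S (length qs) N (\<lambda>x. leg S N ps (leg S (length ps) qs x))"
    using assms by (intro structural.comp[OF structural.leg structural.leg])
  show "structural S (length qs) N (leg S N (map (\<lambda>p. ps ! (p - 1)) qs))"
    using structural.leg[OF legs_ok_map[OF assms(1,2)]] by simp
  fix s h assume s: "1 \<le> s" "s \<le> length qs" "h \<in> carrier H"
  then have "qs ! (s - 1) \<in> {1..length ps}"
    using assms(2) by (intro subsetD[OF _ nth_mem]) (auto simp: legs_ok_def)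
  then show "leg S N ps (leg S (length ps) qs (gen (length qs) s h)) =
    leg S N (map (\<lambda>p. ps ! (p - 1)) qs) (gen (length qs) s h)"
    using s assms legs_ok_map[OF assms(1,2)] by (simp add: leg_gen)
qed

text \<open>The coproduct is kept as one element of the completed square and placed by
  \<open>leg\<close>, because it need not be a finite sum of pure tensors.\<close>

definition cop :: "'h \<Rightarrow> 'a" where
  "cop h = comul S (tens 1 [h])"

lemma tens1_closed: "h \<in> carrier H \<Longrightarrow> tens 1 [h] \<in> carrier (tpow S 1)"
  by (rule tens_closed) (simp add: tuples_def)

lemma tens1_tensors: "h \<in> carrier H \<Longrightarrow> tens 1 [h] \<in> tensors S 1"
  by (rule tens_in_tensors) (simp add: tuples_def)

lemma cop_closed [simp]: "h \<in> carrier H \<Longrightarrow> cop h \<in> carrier (tpow S 2)"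
  using delta_closed[of 1 1] tens1_closed by (simp add: cop_def numeral_2_eq_2)

lemma cop_closed_Suc [simp]: "h \<in> carrier H \<Longrightarrow> cop h \<in> carrier (tpow S (Suc (Suc 0)))"
  using cop_closed by (simp add: numeral_2_eq_2)

lemma cop_one: "cop \<one>\<^bsub>H\<^esub> = \<one>\<^bsub>tpow S 2\<^esub>"
  using alg_homD(3)[OF delta_hom[of 1 1]] tens_one[of 1] by (simp add: cop_def numeral_2_eq_2)

lemma delta_gen:
  assumes "1 \<le> i" "i \<le> m" "1 \<le> s" "s \<le> m" "h \<in> carrier H"
  shows "delta S m i (gen m s h) =
    (if s < i then gen (m + 1) s h
     else if s = i then leg S (m + 1) [i, i + 1] (cop h) else gen (m + 1) (s + 1) h)"
proof -
  let ?ys = "map (\<lambda>p. if p = s then h else \<one>\<^bsub>H\<^esub>) [1..<m + 1]"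
  let ?zs = "take (i - 1) ?ys @ [\<one>\<^bsub>H\<^esub>, \<one>\<^bsub>H\<^esub>] @ drop i ?ys"
  have ok: "legs_ok (m + 1) [i, i + 1]" using assms by (auto simp: legs_ok_def)
  have nth: "?ys ! (i - 1) = (if s = i then h else \<one>\<^bsub>H\<^esub>)"
    using assms(1,2) by (auto simp del: upt_Suc)
  have eq: "delta S m i (gen m s h) =
    leg S (m + 1) [i, i + 1] (cop (if s = i then h else \<one>\<^bsub>H\<^esub>)) \<otimes>\<^bsub>tpow S (m + 1)\<^esub> tens (m + 1) ?zs"
    unfolding gen_def cop_def delta_tens[OF assms(1,2) gen_tuple[OF assms(5), of s]] nth ..
  have len: "length ?zs = m + 1" using assms(1,2) by (simp del: upt_Suc)
  show ?thesis
  proof (cases "s = i")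
    case True
    have "tens (m + 1) ?zs = \<one>\<^bsub>tpow S (m + 1)\<^esub>"
      by (rule tens_ones[OF _ len])
         (use True assms(1,2) in \<open>auto simp: take_map drop_map simp del: upt_Suc\<close>)
    then show ?thesis
      using True assms(5) ok eq by (simp add: monoid.r_one numeral_2_eq_2)
  next
    case False
    let ?t = "if s < i then s else s + 1"
    have "?zs = map (\<lambda>p. if p = ?t then h else \<one>\<^bsub>H\<^esub>) [1..<m + 1 + 1]"
    proof (rule nth_equalityI)
      fix j assume "j < length ?zs"
      then have "j < m + 1" using len by (simp only:)
      then show "?zs ! j = map (\<lambda>p. if p = ?t then h else \<one>\<^bsub>H\<^esub>) [1..<m + 1 + 1] ! j"
        using False assms(1-4) by (auto simp: nth_append nth_Cons' simp del: upt_Suc)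
    qed (use len in \<open>simp del: upt_Suc\<close>)
    then have "tens (m + 1) ?zs = gen (m + 1) ?t h" by (simp only: gen_def)
    moreover have "leg S (m + 1) [i, i + 1] (cop \<one>\<^bsub>H\<^esub>) = \<one>\<^bsub>tpow S (m + 1)\<^esub>"
      using leg_one'[OF ok, of 2] by (simp add: cop_one)
    ultimately show ?thesis
      using False assms(5) eq by (auto simp: monoid.l_one)
  qed
qed

lemma eps_gen:
  assumes "1 \<le> i" "i \<le> m" "1 \<le> s" "s \<le> m" "h \<in> carrier H"
  shows "eps S m i (gen m s h) =
    (if s < i then gen (m - 1) s h
     else if s = i then counit h \<odot>\<^bsub>tpow S (m - 1)\<^esub> \<one>\<^bsub>tpow S (m - 1)\<^esub> else gen (m - 1) (s - 1) h)"
proof -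
  let ?ys = "map (\<lambda>p. if p = s then h else \<one>\<^bsub>H\<^esub>) [1..<m + 1]"
  let ?zs = "take (i - 1) ?ys @ drop i ?ys"
  have nth: "?ys ! (i - 1) = (if s = i then h else \<one>\<^bsub>H\<^esub>)"
    using assms(1,2) by (auto simp del: upt_Suc)
  have eq: "eps S m i (gen m s h) =
    counit (if s = i then h else \<one>\<^bsub>H\<^esub>) \<odot>\<^bsub>tpow S (m - 1)\<^esub> tens (m - 1) ?zs"
    unfolding gen_def eps_tens[OF assms(1,2) gen_tuple[OF assms(5), of s]] nth ..
  have len: "length ?zs = m - 1" using assms(1,2) by (simp del: upt_Suc)
  show ?thesis
  proof (cases "s = i")
    case True
    have "tens (m - 1) ?zs = \<one>\<^bsub>tpow S (m - 1)\<^esub>"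
      by (rule tens_ones[OF _ len])
         (use True assms(1,2) in \<open>auto simp: take_map drop_map simp del: upt_Suc\<close>)
    then show ?thesis
      using True eq by simp
  next
    case False
    let ?t = "if s < i then s else s - 1"
    have "?zs = map (\<lambda>p. if p = ?t then h else \<one>\<^bsub>H\<^esub>) [1..<m - 1 + 1]"
    proof (rule nth_equalityI)
      fix j assume "j < length ?zs"
      then have "j < m - 1" using len by (simp only:)
      then show "?zs ! j = map (\<lambda>p. if p = ?t then h else \<one>\<^bsub>H\<^esub>) [1..<m - 1 + 1] ! j"
        using False assms(1-4) by (auto simp: nth_append nth_Cons' simp del: upt_Suc)
    qed (use len in \<open>simp del: upt_Suc\<close>)
    then have "tens (m - 1) ?zs = gen (m - 1) ?t h" by (simp only: gen_def)
    then show ?thesis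
      using False assms(5) eq by auto
  qed
qed

section \<open>Comultiplication and counit after a leg embedding\<close>

lemma delta_leg_notin:
  assumes "legs_ok M ps" "1 \<le> i" "i \<le> M" "i \<notin> set ps" "x \<in> carrier (tpow S (length ps))"
  shows "delta S M i (leg S M ps x) = leg S (M + 1) (concat (map (split_pos i) ps)) x"
proof (rule eq_from_gen[OF _ _ _ assms(5)])
  let ?qs = "concat (map (split_pos i) ps)"
  have qs: "legs_ok (M + 1) ?qs" "length ?qs = length ps"
    using legs_ok_split[OF assms(1,3)] assms(4) by (simp_all add: concat_split_pos)
  show "structural S (length ps) (M + 1) (\<lambda>x. delta S M i (leg S M ps x))"
    using assms by (intro structural.comp[OF structural.leg structural.delta])
  show "structural S (length ps) (M + 1) (leg S (M + 1) ?qs)"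
    using structural.leg[OF qs(1)] qs(2) by simp
  fix s h assume s: "1 \<le> s" "s \<le> length ps" "h \<in> carrier H"
  then have p: "ps ! (s - 1) \<in> set ps" by (intro nth_mem) auto
  then have "ps ! (s - 1) \<in> {1..M}" "ps ! (s - 1) \<noteq> i"
    using assms(1,4) by (auto simp: legs_ok_def)
  moreover have "?qs ! (s - 1) = (if ps ! (s - 1) < i then ps ! (s - 1) else ps ! (s - 1) + 1)"
    using s assms(4) by (simp add: concat_split_pos)
  ultimately show "delta S M i (leg S M ps (gen (length ps) s h)) = leg S (M + 1) ?qs (gen (length ps) s h)"
    using s assms(1-3) leg_gen[OF qs s] leg_gen[OF assms(1) refl s]
      delta_gen[OF assms(2,3) _ _ s(3), of "ps ! (s - 1)"] by auto
qed

text \<open>Position \<open>i\<close> holds factor number \<open>length as + 1\<close> of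
  \<open>x\<close>, so this factor may be split before it is embedded. If \<open>i\<close> is not
  among the legs, as in the previous lemma, position \<open>i\<close> holds a unit, and splitting it
  merely shifts later positions.\<close>

lemma delta_leg_in:
  assumes "legs_ok M (as @ i # bs)" "x \<in> carrier (tpow S k)" "k = length as + length bs + 1"
  shows "delta S M i (leg S M (as @ i # bs) x) =
    leg S (M + 1) (concat (map (split_pos i) (as @ i # bs))) (delta S k (length as + 1) x)"
proof -
  define ps where "ps = as @ i # bs"
  define qs where "qs = concat (map (split_pos i) ps)"
  have ps: "legs_ok M ps" using assms(1) by (simp add: ps_def)
  let ?sh = "\<lambda>p. if p < i then p else p + 1"
  have i: "1 \<le> i" "i \<le> M" "i \<notin> set as" "i \<notin> set bs" "length ps = k"
    using assms(1,3) by (auto simp: ps_def legs_ok_def)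
  have qs_eq: "qs = map ?sh as @ [i, i + 1] @ map ?sh bs"
    using i by (simp add: qs_def ps_def concat_split_pos) (simp add: split_pos_def)
  have qs: "legs_ok (M + 1) qs" "length qs = k + 1"
    using legs_ok_split[OF ps i(2)] assms(3) by (simp_all add: qs_eq flip: qs_def)
  have "delta S M i (leg S M ps x) = leg S (M + 1) qs (delta S k (length as + 1) x)"
  proof (rule eq_from_gen[OF _ _ _ assms(2)])
    show "structural S k (M + 1) (\<lambda>x. delta S M i (leg S M ps x))"
      using structural.comp[OF structural.leg[OF ps] structural.delta[OF i(1,2)]] i(5) by simp
    show "structural S k (M + 1) (\<lambda>x. leg S (M + 1) qs (delta S k (length as + 1) x))"
      using structural.comp[OF structural.delta[of "length as + 1" k] structural.leg[OF qs(1), unfolded qs(2)]]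
        assms(3) by simp
    fix s h assume s: "1 \<le> s" "s \<le> k" "h \<in> carrier H"
    have p: "ps ! (s - 1) \<in> {1..M}"
      using ps s i(5) by (intro subsetD[OF _ nth_mem]) (auto simp: legs_ok_def)
    have dg: "delta S k (length as + 1) (gen k s h) =
      (if s < length as + 1 then gen (k + 1) s h
       else if s = length as + 1 then leg S (k + 1) [length as + 1, length as + 1 + 1] (cop h)
       else gen (k + 1) (s + 1) h)"
      using s assms(3) by (intro delta_gen) auto
    have lg: "leg S M ps (gen k s h) = gen M (ps ! (s - 1)) h"
      using s i(5) ps by (intro leg_gen) auto
    show "delta S M i (leg S M ps (gen k s h)) = leg S (M + 1) qs (delta S k (length as + 1) (gen k s h))"
    proof (cases "s = length as + 1")
      case True
      have "leg S (M + 1) qs (leg S (length qs) [length as + 1, length as + 1 + 1] (cop h)) =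
        leg S (M + 1) (map (\<lambda>p. qs ! (p - 1)) [length as + 1, length as + 1 + 1]) (cop h)"
        using s qs assms(3) by (intro leg_leg) (auto simp: legs_ok_def numeral_2_eq_2)
      also have "map (\<lambda>p. qs ! (p - 1)) [length as + 1, length as + 1 + 1] = [i, i + 1]"
        by (simp add: qs_eq nth_append)
      finally show ?thesis
        using True s i p dg lg qs(2) delta_gen[OF i(1,2,1,2) s(3)] by (simp add: ps_def nth_append)
    next
      case False
      have ne: "ps ! (s - 1) \<noteq> i"
      proof
        assume "ps ! (s - 1) = i"
        then have "ps ! (s - 1) = ps ! length as" by (simp add: ps_def)
        then have "s - 1 = length as"
          using ps i(5) s assms(3) by (subst (asm) nth_eq_iff_index_eq) (auto simp: legs_ok_def)
        then show False using False s by simp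
      qed
      let ?t = "if s < length as + 1 then s else s + 1"
      have "qs ! (?t - 1) = ?sh (ps ! (s - 1))"
        using False s i assms(3) by (auto simp: qs_eq ps_def nth_append nth_Cons')
      then show ?thesis
        using False s i(1,2) p ne dg lg leg_gen[OF qs(1,2), of ?t h]
          delta_gen[OF i(1,2) _ _ s(3), of "ps ! (s - 1)"] by auto
    qed
  qed
  then show ?thesis by (simp only: qs_def ps_def)
qed

lemma eps_leg_notin:
  assumes "legs_ok M ps" "1 \<le> i" "i \<le> M" "i \<notin> set ps" "x \<in> carrier (tpow S (length ps))"
  shows "eps S M i (leg S M ps x) = leg S (M - 1) (concat (map (drop_pos i) ps)) x"
proof (rule eq_from_gen[OF _ _ _ assms(5)])
  let ?qs = "concat (map (drop_pos i) ps)"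
  have qs: "legs_ok (M - 1) ?qs" "length ?qs = length ps"
    using legs_ok_drop[OF assms(1-3)] assms(4) by (simp_all add: concat_drop_pos)
  show "structural S (length ps) (M - 1) (\<lambda>x. eps S M i (leg S M ps x))"
    using assms by (intro structural.comp[OF structural.leg structural.eps])
  show "structural S (length ps) (M - 1) (leg S (M - 1) ?qs)"
    using structural.leg[OF qs(1)] qs(2) by simp
  fix s h assume s: "1 \<le> s" "s \<le> length ps" "h \<in> carrier H"
  then have p: "ps ! (s - 1) \<in> set ps" by (intro nth_mem) auto
  then have "ps ! (s - 1) \<in> {1..M}" "ps ! (s - 1) \<noteq> i"
    using assms(1,4) by (auto simp: legs_ok_def)
  moreover have "?qs ! (s - 1) = (if ps ! (s - 1) < i then ps ! (s - 1) else ps ! (s - 1) - 1)"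
    using s assms(4) by (simp add: concat_drop_pos)
  ultimately show "eps S M i (leg S M ps (gen (length ps) s h)) = leg S (M - 1) ?qs (gen (length ps) s h)"
    using s assms(1-3) leg_gen[OF qs s] leg_gen[OF assms(1) refl s]
      eps_gen[OF assms(2,3) _ _ s(3), of "ps ! (s - 1)"] by auto
qed

lemma eps_leg_in:
  assumes "legs_ok M (as @ i # bs)" "x \<in> carrier (tpow S k)" "k = length as + length bs + 1"
  shows "eps S M i (leg S M (as @ i # bs) x) =
    leg S (M - 1) (concat (map (drop_pos i) (as @ i # bs))) (eps S k (length as + 1) x)"
proof -
  define ps where "ps = as @ i # bs"
  define qs where "qs = concat (map (drop_pos i) ps)"
  have ps: "legs_ok M ps" using assms(1) by (simp add: ps_def)
  let ?sh = "\<lambda>p. if p < i then p else p - 1"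
  have i: "1 \<le> i" "i \<le> M" "i \<notin> set as" "i \<notin> set bs" "length ps = k"
    using assms(1,3) by (auto simp: ps_def legs_ok_def)
  have qs_eq: "qs = map ?sh as @ map ?sh bs"
    using i by (simp add: qs_def ps_def concat_drop_pos) (simp add: drop_pos_def)
  have qs: "legs_ok (M - 1) qs" "length qs = k - 1"
    using legs_ok_drop[OF ps i(1,2)] assms(3) by (simp_all add: qs_eq flip: qs_def)
  have "eps S M i (leg S M ps x) = leg S (M - 1) qs (eps S k (length as + 1) x)"
  proof (rule eq_from_gen[OF _ _ _ assms(2)])
    show "structural S k (M - 1) (\<lambda>x. eps S M i (leg S M ps x))"
      using structural.comp[OF structural.leg[OF ps] structural.eps[OF i(1,2)]] i(5) by simp
    show "structural S k (M - 1) (\<lambda>x. leg S (M - 1) qs (eps S k (length as + 1) x))"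
      using structural.comp[OF structural.eps[of "length as + 1" k] structural.leg[OF qs(1), unfolded qs(2)]]
        assms(3) by simp
    fix s h assume s: "1 \<le> s" "s \<le> k" "h \<in> carrier H"
    have p: "ps ! (s - 1) \<in> {1..M}"
      using ps s i(5) by (intro subsetD[OF _ nth_mem]) (auto simp: legs_ok_def)
    have dg: "eps S k (length as + 1) (gen k s h) =
      (if s < length as + 1 then gen (k - 1) s h
       else if s = length as + 1 then counit h \<odot>\<^bsub>tpow S (k - 1)\<^esub> \<one>\<^bsub>tpow S (k - 1)\<^esub>
       else gen (k - 1) (s - 1) h)"
      using s assms(3) by (intro eps_gen) auto
    have lg: "leg S M ps (gen k s h) = gen M (ps ! (s - 1)) h"
      using s i(5) ps by (intro leg_gen) auto
    show "eps S M i (leg S M ps (gen k s h)) = leg S (M - 1) qs (eps S k (length as + 1) (gen k s h))"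
    proof (cases "s = length as + 1")
      case True
      have "leg S (M - 1) qs (counit h \<odot>\<^bsub>tpow S (k - 1)\<^esub> \<one>\<^bsub>tpow S (k - 1)\<^esub>) =
        counit h \<odot>\<^bsub>tpow S (M - 1)\<^esub> \<one>\<^bsub>tpow S (M - 1)\<^esub>"
        using s(3) alg_homD(3,6)[OF leg_hom[OF qs(1)]] qs(2) by simp
      then show ?thesis
        using True s i p dg lg qs(2) eps_gen[OF i(1,2,1,2) s(3)] by (simp add: ps_def nth_append)
    next
      case False
      have ne: "ps ! (s - 1) \<noteq> i"
      proof
        assume "ps ! (s - 1) = i"
        then have "ps ! (s - 1) = ps ! length as" by (simp add: ps_def)
        then have "s - 1 = length as"
          using ps i(5) s assms(3) by (subst (asm) nth_eq_iff_index_eq) (auto simp: legs_ok_def)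
        then show False using False s by simp
      qed
      let ?t = "if s < length as + 1 then s else s - 1"
      have "qs ! (?t - 1) = ?sh (ps ! (s - 1))"
        using False s i assms(3) by (auto simp: qs_eq ps_def nth_append nth_Cons')
      moreover have "1 \<le> ?t" "?t \<le> k - 1"
        using False s i assms(3) by auto
      ultimately show ?thesis
        using False s i(1,2) p ne dg lg leg_gen[OF qs(1,2), of ?t h]
          eps_gen[OF i(1,2) _ _ s(3), of "ps ! (s - 1)"] by auto
    qed
  qed
  then show ?thesis by (simp only: qs_def ps_def)
qed

section \<open>Coassociativity and counit axioms inside a tensor power\<close>

lemma structural_delta':
  assumes "structural S m n f" "1 \<le> i" "i \<le> n" "p = n + 1"
  shows "structural S m p (\<lambda>x. delta S n i (f x))"
  unfolding assms(4) using assms(1-3) by (intro structural.comp[OF _ structural.delta])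

lemma structural_eps':
  assumes "structural S m n f" "1 \<le> i" "i \<le> n" "p = n - 1"
  shows "structural S m p (\<lambda>x. eps S n i (f x))"
  unfolding assms(4) using assms(1-3) by (intro structural.comp[OF _ structural.eps])

lemma delta_leg_pair:
  assumes "1 \<le> i" "i < k" "h \<in> carrier H" "1 \<le> t" "t \<le> k" "t \<noteq> i" "t \<noteq> i + 1"
  shows "delta S k t (leg S k [i, i + 1] (cop h)) =
    leg S (k + 1) (if t < i then [i + 1, i + 2] else [i, i + 1]) (cop h)"
  using assms delta_leg_notin[of k "[i, i + 1]" t "cop h"]
  by (auto simp: legs_ok_def split_pos_def numeral_2_eq_2)

lemma eps_leg_pair:
  assumes "1 \<le> i" "i < k" "h \<in> carrier H" "1 \<le> t" "t \<le> k" "t \<noteq> i" "t \<noteq> i + 1"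
  shows "eps S k t (leg S k [i, i + 1] (cop h)) =
    leg S (k - 1) (if t < i then [i - 1, i] else [i, i + 1]) (cop h)"
  using assms eps_leg_notin[of k "[i, i + 1]" t "cop h"]
  by (auto simp: legs_ok_def drop_pos_def numeral_2_eq_2)

text \<open>Iterated coproducts are built below by always splitting the first factor. Hence it is
  enough to know how a second operation passes \<open>delta S k 1\<close>: here at a distance, in
  the next lemma on one of the two factors just produced.\<close>

lemma delta_delta_far:
  assumes "2 \<le> t" "t \<le> k" "x \<in> carrier (tpow S k)"
  shows "delta S (k + 1) (t + 1) (delta S k 1 x) = delta S (k + 1) 1 (delta S k t x)"
proof (rule eq_from_gen[OF _ _ _ assms(3)])
  show "structural S k (k + 2) (\<lambda>x. delta S (k + 1) (t + 1) (delta S k 1 x))"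
    "structural S k (k + 2) (\<lambda>x. delta S (k + 1) 1 (delta S k t x))"
    using assms by (auto intro!: structural_delta' structural.ident)
  fix s h assume s: "1 \<le> s" "s \<le> k" "h \<in> carrier H"
  consider "s = 1" | "1 < s" "s < t" | "s = t" "1 < t" | "t < s" using s by linarith
  then show "delta S (k + 1) (t + 1) (delta S k 1 (gen k s h)) =
    delta S (k + 1) 1 (delta S k t (gen k s h))"
  proof cases
    case 1
    then show ?thesis
      using s assms delta_gen[of 1 k 1 h] delta_gen[of t k 1 h] delta_gen[of 1 "k + 1" 1 h]
        delta_leg_pair[of 1 "k + 1" h "t + 1"] by auto
  next
    case 2
    then show ?thesis
      using s assms delta_gen[of 1 k s h] delta_gen[of t k s h] delta_gen[of 1 "k + 1" s h]
        delta_gen[of "t + 1" "k + 1" "s + 1" h] by auto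
  next
    case 3
    then show ?thesis
      using s assms delta_gen[of 1 k s h] delta_gen[of t k s h]
        delta_gen[of "t + 1" "k + 1" "s + 1" h] delta_leg_pair[of t "k + 1" h 1] by auto
  next
    case 4
    then show ?thesis
      using s assms delta_gen[of 1 k s h] delta_gen[of t k s h] delta_gen[of 1 "k + 1" "s + 1" h]
        delta_gen[of "t + 1" "k + 1" "s + 1" h] by auto
  qed
qed

lemma delta_delta_near:
  assumes "1 \<le> k" "x \<in> carrier (tpow S k)"
  shows "delta S (k + 1) 2 (delta S k 1 x) = delta S (k + 1) 1 (delta S k 1 x)"
proof (rule eq_from_gen[OF _ _ _ assms(2)])
  show "structural S k (k + 2) (\<lambda>x. delta S (k + 1) 2 (delta S k 1 x))"
    "structural S k (k + 2) (\<lambda>x. delta S (k + 1) 1 (delta S k 1 x))"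
    using assms by (auto intro!: structural_delta' structural.ident)
  fix s h assume s: "1 \<le> s" "s \<le> k" "h \<in> carrier H"
  show "delta S (k + 1) 2 (delta S k 1 (gen k s h)) = delta S (k + 1) 1 (delta S k 1 (gen k s h))"
  proof (cases "s = 1")
    case True
    \<comment> \<open>Both expressions are pulled out of legs \<open>1, 2, 3\<close>, which leaves
      the coassociativity of \<open>cop h\<close> itself.\<close>
    have "delta S (k + 1) 2 (leg S (k + 1) [1, 2] (cop h)) = leg S (k + 2) [1, 2, 3] (delta S 2 2 (cop h))"
      "delta S (k + 1) 1 (leg S (k + 1) [1, 2] (cop h)) = leg S (k + 2) [1, 2, 3] (delta S 2 1 (cop h))"
      using assms(1) s delta_leg_in[of "k + 1" "[1]" 2 "[]" "cop h" 2]
        delta_leg_in[of "k + 1" "[]" 1 "[2]" "cop h" 2]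
      by (auto simp: legs_ok_def split_pos_def numeral_eq_Suc)
    moreover have "delta S 2 1 (cop h) = delta S 2 2 (cop h)"
      using comult tens1_tensors[OF s(3)] by (auto simp: comultiplication_def cop_def)
    ultimately show ?thesis
      using True s delta_gen[of 1 k 1 h] by (simp add: numeral_2_eq_2)
  next
    case False
    then show ?thesis
      using s delta_gen[of 1 k s h] delta_gen[of 1 "k + 1" "s + 1" h]
        delta_gen[of 2 "k + 1" "s + 1" h] by auto
  qed
qed

lemma eps_delta_near:
  assumes "t \<in> {1, 2}" "1 \<le> k" "x \<in> carrier (tpow S k)"
  shows "eps S (k + 1) t (delta S k 1 x) = x"
proof (rule eq_from_gen[OF _ _ _ assms(3)])
  show "structural S k k (\<lambda>x. eps S (k + 1) t (delta S k 1 x))" "structural S k k (\<lambda>x. x)"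
    using assms by (auto intro!: structural_delta' structural_eps' structural.ident)
  fix s h assume s: "1 \<le> s" "s \<le> k" "h \<in> carrier H"
  show "eps S (k + 1) t (delta S k 1 (gen k s h)) = gen k s h"
  proof (cases "s = 1")
    case True
    have "eps S (k + 1) 2 (leg S (k + 1) [1, 2] (cop h)) = leg S k [1] (eps S 2 2 (cop h))"
      "eps S (k + 1) 1 (leg S (k + 1) [1, 2] (cop h)) = leg S k [1] (eps S 2 1 (cop h))"
      using assms(2) s eps_leg_in[of "k + 1" "[1]" 2 "[]" "cop h" 2]
        eps_leg_in[of "k + 1" "[]" 1 "[2]" "cop h" 2]
      by (auto simp: legs_ok_def drop_pos_def numeral_eq_Suc)
    moreover have "eps S 2 1 (cop h) = tens 1 [h]" "eps S 2 2 (cop h) = tens 1 [h]"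
      using comult tens1_tensors[OF s(3)] by (auto simp: comultiplication_def cop_def)
    moreover have "leg S k [1] (tens 1 [h]) = gen k 1 h"
      using leg_gen[of k "[1]" 1 1 h] assms s gen_1 by (auto simp: legs_ok_def)
    ultimately show ?thesis
      using True s assms(1) delta_gen[of 1 k 1 h] by (auto simp: numeral_2_eq_2)
  next
    case False
    then show ?thesis
      using s assms(1) delta_gen[of 1 k s h] eps_gen[of t "k + 1" "s + 1" h] by auto
  qed
qed

lemma eps_delta_far:
  assumes "2 \<le> t" "t \<le> k" "x \<in> carrier (tpow S k)"
  shows "eps S (k + 1) (t + 1) (delta S k 1 x) = delta S (k - 1) 1 (eps S k t x)"
proof (rule eq_from_gen[OF _ _ _ assms(3)])
  show "structural S k k (\<lambda>x. eps S (k + 1) (t + 1) (delta S k 1 x))"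
    "structural S k k (\<lambda>x. delta S (k - 1) 1 (eps S k t x))"
    using assms by (auto intro!: structural_delta' structural_eps' structural.ident)
  fix s h assume s: "1 \<le> s" "s \<le> k" "h \<in> carrier H"
  consider "s = 1" | "1 < s" "s < t" | "s = t" "1 < t" | "t < s" using s by linarith
  then show "eps S (k + 1) (t + 1) (delta S k 1 (gen k s h)) =
    delta S (k - 1) 1 (eps S k t (gen k s h))"
  proof cases
    case 1
    then show ?thesis
      using s assms delta_gen[of 1 k 1 h] eps_gen[of t k 1 h] delta_gen[of 1 "k - 1" 1 h]
        eps_leg_pair[of 1 "k + 1" h "t + 1"] by auto
  next
    case 2
    then show ?thesis
      using s assms delta_gen[of 1 k s h] eps_gen[of t k s h] delta_gen[of 1 "k - 1" s h]
        eps_gen[of "t + 1" "k + 1" "s + 1" h] by auto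
  next
    case 3
    then show ?thesis
      using s assms delta_gen[of 1 k s h] eps_gen[of t k s h] eps_gen[of "t + 1" "k + 1" "s + 1" h]
        alg_homD(3,6)[OF delta_hom[of 1 "k - 1"]] by auto
  next
    case 4
    then show ?thesis
      using s assms delta_gen[of 1 k s h] eps_gen[of t k s h] delta_gen[of 1 "k - 1" "s - 1" h]
        eps_gen[of "t + 1" "k + 1" "s + 1" h] by auto
  qed
qed

text \<open>The value at \<open>0\<close> is the counit and the value at \<open>1\<close> is
  \<open>h\<close>. With this convention the empty position list, which arises when a factor is
  killed by the counit, is covered by the same formula as all others.\<close>

primrec iter_cop :: "nat \<Rightarrow> 'h \<Rightarrow> 'a" where
  "iter_cop 0 h = counit h \<odot>\<^bsub>tpow S 0\<^esub> \<one>\<^bsub>tpow S 0\<^esub>"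
| "iter_cop (Suc k) h = (if k = 0 then tens 1 [h] else delta S k 1 (iter_cop k h))"

lemma iter_cop_closed [simp]: "h \<in> carrier H \<Longrightarrow> iter_cop k h \<in> carrier (tpow S k)"
proof (induction k)
  case (Suc k)
  then show ?case
    using tens1_closed[of h] delta_closed[of 1 k "iter_cop k h"] by auto
qed simp

text \<open>Generalized coassociativity: the iterated coproduct does not depend on which factor is
  split. A split at \<open>t > 2\<close> is commuted past the split of the first factor, which
  lowers \<open>t\<close> by one; the case \<open>t = 2\<close> is coassociativity.\<close>

lemma delta_iter_cop:
  "\<lbrakk>h \<in> carrier H; 1 \<le> t; t \<le> k\<rbrakk> \<Longrightarrow> delta S k t (iter_cop k h) = iter_cop (k + 1) h"
proof (induction k arbitrary: t)
  case (Suc k)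
  note h = Suc.prems(1)
  show ?case
  proof (cases "k = 0 \<or> t = 1")
    case True
    then show ?thesis using Suc.prems by auto
  next
    case False
    then have k: "iter_cop (Suc k) h = delta S k 1 (iter_cop k h)" "1 \<le> k" by auto
    show ?thesis
    proof (cases "t = 2")
      case True
      then show ?thesis using delta_delta_near[OF k(2) iter_cop_closed[OF h]] k by simp
    next
      case ne: False
      then have t: "2 \<le> t - 1" "t - 1 \<le> k" using False Suc.prems by auto
      have "delta S (Suc k) t (delta S k 1 (iter_cop k h)) =
        delta S (Suc k) 1 (delta S k (t - 1) (iter_cop k h))"
        using delta_delta_far[OF t iter_cop_closed[OF h]] t by simp
      then show ?thesis using k Suc.IH[OF h _ t(2)] t by simp
    qed
  qed
qed simp

lemma eps_iter_cop:
  "\<lbrakk>h \<in> carrier H; 1 \<le> t; t \<le> k\<rbrakk> \<Longrightarrow> eps S k t (iter_cop k h) = iter_cop (k - 1) h"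
proof (induction k arbitrary: t)
  case (Suc k)
  note h = Suc.prems(1)
  show ?case
  proof (cases "k = 0")
    case True
    then show ?thesis using Suc.prems eps_gen[of 1 1 1 h] gen_1[of h] by simp
  next
    case False
    then have k: "iter_cop (Suc k) h = delta S k 1 (iter_cop k h)" "1 \<le> k" by auto
    show ?thesis
    proof (cases "t \<in> {1, 2}")
      case True
      then show ?thesis using eps_delta_near[OF True k(2) iter_cop_closed[OF h]] k by simp
    next
      case ne: False
      then have t: "2 \<le> t - 1" "t - 1 \<le> k" using False Suc.prems by auto
      have "eps S (Suc k) t (delta S k 1 (iter_cop k h)) =
        delta S (k - 1) 1 (eps S k (t - 1) (iter_cop k h))"
        using eps_delta_far[OF t iter_cop_closed[OF h]] t by simp
      also have "\<dots> = delta S (k - 1) 1 (iter_cop (k - 1) h)"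
        using Suc.IH[OF h _ t(2)] t by simp
      also have "\<dots> = iter_cop k h"
        using delta_iter_cop[OF h, of 1 "k - 1"] t by simp
      finally show ?thesis using k by simp
    qed
  qed
qed simp

declare iter_cop.simps [simp del]

text \<open>Each generator of structural maps only edits the position list: a leg embedding renames
  it, \<open>delta\<close> doubles an entry and \<open>eps\<close> deletes one. By generalized
  coassociativity and the counit axioms the iterated coproduct depends only on the length of the
  list, not on the entry that was edited. Hence \<open>D\<close> determines the map on
  generators.\<close>

lemma rep_gen:
  "rep S m N f D \<Longrightarrow> \<lbrakk>1 \<le> s; s \<le> m; h \<in> carrier H\<rbrakk> \<Longrightarrow>
    f (gen m s h) = leg S N (D s) (iter_cop (length (D s)) h)"
proof (induction rule: rep.induct)
  case (ident m)
  then show ?case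
    using leg_gen[of m "[s]" 1 1 h] gen_1[of h] by (simp add: legs_ok_def iter_cop.simps)
next
  case (leg m N f D P ps)
  then show ?case
    using leg_leg[of P ps "D s"] rep_legs_ok[OF leg.hyps(1) leg.prems(1,2)] by simp
next
  case (delta m N f D i P)
  note ok = rep_legs_ok[OF delta.hyps(1) delta.prems(1,2)]
  show ?case
  proof (cases "i \<in> set (D s)")
    case True
    then obtain as bs where D: "D s = as @ i # bs" by (meson split_list)
    have i: "i \<notin> set as" "i \<notin> set bs" using ok by (auto simp: D legs_ok_def)
    have "length (concat (map (split_pos i) (D s))) = length (D s) + 1"
      using i by (simp add: D concat_split_pos) (simp add: split_pos_def)
    then show ?thesis
      using delta ok delta_leg_in[of N as i bs "iter_cop (length (D s)) h" "length (D s)"]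
        delta_iter_cop[of h "length as + 1" "length (D s)"] D by simp
  next
    case False
    then show ?thesis
      using delta ok delta_leg_notin[of N "D s" i "iter_cop (length (D s)) h"]
      by (simp add: concat_split_pos)
  qed
next
  case (eps m N f D i P)
  note ok = rep_legs_ok[OF eps.hyps(1) eps.prems(1,2)]
  show ?case
  proof (cases "i \<in> set (D s)")
    case True
    then obtain as bs where D: "D s = as @ i # bs" by (meson split_list)
    have i: "i \<notin> set as" "i \<notin> set bs" using ok by (auto simp: D legs_ok_def)
    have "length (concat (map (drop_pos i) (D s))) = length (D s) - 1"
      using i by (simp add: D concat_drop_pos) (simp add: drop_pos_def)
    then show ?thesis
      using eps ok eps_leg_in[of N as i bs "iter_cop (length (D s)) h" "length (D s)"]
        eps_iter_cop[of h "length as + 1" "length (D s)"] D by simp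
  next
    case False
    then show ?thesis
      using eps ok eps_leg_notin[of N "D s" i "iter_cop (length (D s)) h"]
      by (simp add: concat_drop_pos)
  qed
next
  case (cong m N f D D')
  then show ?case by simp
qed

lemma coherence:
  assumes "rep S m N f D" "rep S m N g D" "x \<in> carrier (tpow S m)"
  shows "f x = g x"
  using rep_structural[OF assms(1)] rep_structural[OF assms(2)] _ assms(3)
  by (rule eq_from_gen) (simp add: rep_gen[OF assms(1)] rep_gen[OF assms(2)])

section \<open>Commutation of elements in disjoint legs\<close>

lemma gen_commute:
  assumes "p \<noteq> q" "h \<in> carrier H" "h' \<in> carrier H"
  shows "gen N p h \<otimes>\<^bsub>tpow S N\<^esub> gen N q h' = gen N q h' \<otimes>\<^bsub>tpow S N\<^esub> gen N p h"
proof -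
  let ?xs = "\<lambda>p h. map (\<lambda>r. if r = p then h else \<one>\<^bsub>H\<^esub>) [1..<N + 1]"
  have "map2 (mult H) (?xs p h) (?xs q h') = map2 (mult H) (?xs q h') (?xs p h)"
    using assms by (intro nth_equalityI)
      (auto simp: ring.is_monoid monoid.l_one monoid.r_one simp del: upt_Suc)
  then show ?thesis
    unfolding gen_def using gen_tuple assms by (simp add: tens_mult del: upt_Suc)
qed

text \<open>The extension axiom handles one variable at a time. So \<open>Y\<close> varies first,
  against a single generator in the legs \<open>ps\<close>; then \<open>X\<close> varies, against
  the fixed element \<open>leg S N qs Y\<close>.\<close>

lemma leg_commute:
  assumes ps: "legs_ok N ps" and qs: "legs_ok N qs" and dis: "set ps \<inter> set qs = {}"
    and X: "X \<in> carrier (tpow S (length ps))" and Y: "Y \<in> carrier (tpow S (length qs))"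
  shows "leg S N ps X \<otimes>\<^bsub>tpow S N\<^esub> leg S N qs Y = leg S N qs Y \<otimes>\<^bsub>tpow S N\<^esub> leg S N ps X"
proof -
  have "gen N p h \<otimes>\<^bsub>tpow S N\<^esub> leg S N qs Y = leg S N qs Y \<otimes>\<^bsub>tpow S N\<^esub> gen N p h"
    if "p \<in> set ps" "h \<in> carrier H" for p h
  proof (rule intertwine_from_gen[OF _ _ _ _ Y])
    fix s h' assume s: "1 \<le> s" "s \<le> length qs" "h' \<in> carrier H"
    then have "qs ! (s - 1) \<in> set qs" by (intro nth_mem) auto
    then have "p \<noteq> qs ! (s - 1)" using dis that(1) by blast
    then show "gen N p h \<otimes>\<^bsub>tpow S N\<^esub> leg S N qs (gen (length qs) s h') =
      leg S N qs (gen (length qs) s h') \<otimes>\<^bsub>tpow S N\<^esub> gen N p h"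
      using s qs that by (simp add: leg_gen gen_commute)
  qed (use qs that in \<open>auto intro: structural.leg\<close>)
  note gen_Y = this
  have "leg S N qs Y \<otimes>\<^bsub>tpow S N\<^esub> leg S N ps X = leg S N ps X \<otimes>\<^bsub>tpow S N\<^esub> leg S N qs Y"
  proof (rule intertwine_from_gen[OF _ _ _ _ X])
    fix s h assume s: "1 \<le> s" "s \<le> length ps" "h \<in> carrier H"
    then have "ps ! (s - 1) \<in> set ps" by (intro nth_mem) auto
    from gen_Y[OF this s(3)] show "leg S N qs Y \<otimes>\<^bsub>tpow S N\<^esub> leg S N ps (gen (length ps) s h) =
      leg S N ps (gen (length ps) s h) \<otimes>\<^bsub>tpow S N\<^esub> leg S N qs Y"
      using s ps by (simp add: leg_gen)
  qed (use ps qs Y in \<open>auto intro: structural.leg\<close>)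
  then show ?thesis by simp
qed

end

section \<open>Twisting a coherent system\<close>

text \<open>The view of a bialgebra that twisting relies on: algebras, and structural maps
  determined by their position lists. It is separated from \<open>completed_bialgebra\<close>
  because the tensor power, whose legs are blocks, is to be an instance as well.\<close>

locale coherent_system =
  fixes K :: "'k ring" and S :: "('k, 'a) tensor_system"
  assumes algebra: "k_algebra K (tpow S m)"
    and rep_hom: "rep S m N f D \<Longrightarrow> alg_hom K (tpow S m) (tpow S N) f"
    and coherence: "\<lbrakk>rep S m N f D; rep S m N g D; x \<in> carrier (tpow S m)\<rbrakk> \<Longrightarrow> f x = g x"
    and tensors_carrier: "tensors S m \<subseteq> carrier (tpow S m)"
begin

lemma rep_eq:
  assumes "rep S m N f D" "rep S m N g E" "x \<in> carrier (tpow S m)"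
    and "\<And>s. \<lbrakk>1 \<le> s; s \<le> m\<rbrakk> \<Longrightarrow> D s = E s"
  shows "f x = g x"
  using rep.cong[OF assms(1,4)] assms(2,3) by (rule coherence)

lemmas rep_leg1 = rep.leg[OF rep.ident]
  and rep_delta1 = rep.delta[OF rep.ident]
  and rep_eps1 = rep.eps[OF rep.ident]

lemma tpow_monoid: "monoid (tpow S m)"
  using algebra k_algebraD by blast

lemma hom_leg: "legs_ok N ps \<Longrightarrow> length ps = k \<Longrightarrow> alg_hom K (tpow S k) (tpow S N) (leg S N ps)"
  by (intro rep_hom[OF rep_leg1])

lemma hom_delta: "\<lbrakk>1 \<le> i; i \<le> m; N = m + 1\<rbrakk> \<Longrightarrow> alg_hom K (tpow S m) (tpow S N) (delta S m i)"
  by (intro rep_hom[OF rep_delta1])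

lemma hom_eps: "\<lbrakk>1 \<le> i; i \<le> m; N = m - 1\<rbrakk> \<Longrightarrow> alg_hom K (tpow S m) (tpow S N) (eps S m i)"
  by (intro rep_hom[OF rep_eps1])

lemma leg_leg:
  assumes "legs_ok N ps" "legs_ok M qs" "length ps = M" "length qs = k" "x \<in> carrier (tpow S k)"
  shows "leg S N ps (leg S M qs x) = leg S N (map (\<lambda>p. ps ! (p - 1)) qs) x"
proof (rule rep_eq[OF rep.leg[OF rep_leg1] rep_leg1 assms(5)])
  show "legs_ok N (map (\<lambda>p. ps ! (p - 1)) qs)"
    using assms legs_ok_map[of N ps qs] by simp
qed (use assms in auto)

lemma leg_ident: "x \<in> carrier (tpow S m) \<Longrightarrow> leg S m [1..<m + 1] x = x"
  by (rule rep_eq[OF rep_leg1 rep.ident]) (auto simp: legs_ok_def simp del: upt_Suc)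

end

section \<open>The intertwining property and algebra needed for twisting\<close>

definition swap_pos :: "nat \<Rightarrow> nat \<Rightarrow> nat list" where
  "swap_pos N i = [1..<i] @ [i + 1, i] @ [i + 2..<N + 1]"

text \<open>The relation between the coproduct and its opposite, for a factor of an arbitrary
  element of an arbitrary completed tensor power, whereas \<open>R_matrix\<close> states it for
  coproducts of elements of \<open>tensors S 1\<close>. Writing it without inverses fits the form of
  the extension axiom.\<close>

definition intertwiner :: "('k, 'a) tensor_system \<Rightarrow> 'a \<Rightarrow> bool" where
  "intertwiner S R \<longleftrightarrow> (\<forall>m i X. 1 \<le> i \<and> i \<le> m \<and> X \<in> carrier (tpow S m) \<longrightarrow>
     leg S (m + 1) [i, i + 1] R \<otimes>\<^bsub>tpow S (m + 1)\<^esub> delta S m i X =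
     leg S (m + 1) (swap_pos (m + 1) i) (delta S m i X) \<otimes>\<^bsub>tpow S (m + 1)\<^esub> leg S (m + 1) [i, i + 1] R)"

lemma alg_hom_restrict:
  assumes f: "alg_hom K A B f" and T: "T \<subseteq> carrier A"
  shows "alg_hom K (A\<lparr>carrier := T\<rparr>) B f"
  unfolding alg_hom_def linear_map_def ring_hom_def
  using alg_homD(2-6)[OF f] subsetD[OF T] by auto

lemma alg_hom_conj:
  assumes f: "alg_hom K A B f" and B: "k_algebra K B" and u: "u \<in> Units B"
  shows "alg_hom K A B (\<lambda>x. inv\<^bsub>B\<^esub> u \<otimes>\<^bsub>B\<^esub> f x \<otimes>\<^bsub>B\<^esub> u)"
proof -
  interpret B: ring B using B k_algebraD by blast
  note F = alg_homD[OF f]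
  have c: "u \<in> carrier B" "inv\<^bsub>B\<^esub> u \<in> carrier B" using u by auto
  have cancel: "u \<otimes>\<^bsub>B\<^esub> (inv\<^bsub>B\<^esub> u \<otimes>\<^bsub>B\<^esub> x) = x" if "x \<in> carrier B" for x
    using that c u by (simp flip: B.m_assoc)
  show ?thesis
    unfolding alg_hom_def linear_map_def ring_hom_def
    using F c u B cancel
    by (auto simp: B.l_distr B.r_distr B.m_assoc k_algebra_def)
qed

text \<open>Let \<open>a\<close>, \<open>b\<close> be \<open>(\<Delta> \<otimes> id)(J)\<close> and
  \<open>(id \<otimes> \<Delta>)(J)\<close>, let \<open>a2\<close>, \<open>a3\<close>,
  \<open>b2\<close> be their images under permutations of the legs, and let \<open>a'\<close> be
  \<open>(\<Delta> \<otimes> id)(J\<^sub>2\<^sub>1)\<close>. Then this is the hexagon for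
  \<open>J\<^sub>2\<^sub>1\<^sup>-\<^sup>1 R J\<close>: three equations are the cocycle identity in
  different orders of the legs, two are intertwining relations. The other hexagon is the same
  computation with other legs, hence the abstract monoid.\<close>

lemma (in monoid) twisted_hexagon:
  assumes car: "a \<in> carrier G" "a2 \<in> carrier G" "a3 \<in> carrier G" "b \<in> carrier G" "b2 \<in> carrier G"
    "j13 \<in> carrier G" "j23 \<in> carrier G" "r13 \<in> carrier G" "r23 \<in> carrier G"
    and U: "j12 \<in> Units G" "j31 \<in> Units G" "j32 \<in> Units G" "a' \<in> Units G"
    and eqs: "a \<otimes> j12 = b \<otimes> j23" "r23 \<otimes> b = b2 \<otimes> r23" "a2 \<otimes> j13 = b2 \<otimes> j32"
      "r13 \<otimes> a2 = a3 \<otimes> r13" "a3 \<otimes> j31 = a' \<otimes> j12"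
  shows "inv j12 \<otimes> (inv a' \<otimes> (r13 \<otimes> r23) \<otimes> a) \<otimes> j12 =
    (inv j31 \<otimes> r13 \<otimes> j13) \<otimes> (inv j32 \<otimes> r23 \<otimes> j23)"
proof -
  note c = car U[THEN Units_closed] U[THEN Units_inv_closed]
  have b2: "b2 = a2 \<otimes> j13 \<otimes> inv j32"
    using c U by (simp add: eqs(3) m_assoc)
  have a3: "inv j12 \<otimes> (inv a' \<otimes> a3) = inv j31"
  proof -
    have "inv j12 \<otimes> (inv a' \<otimes> a3) = inv j12 \<otimes> (inv a' \<otimes> (a3 \<otimes> j31)) \<otimes> inv j31"
      using c U by (simp add: m_assoc)
    also have "\<dots> = inv j12 \<otimes> ((inv a' \<otimes> a') \<otimes> j12) \<otimes> inv j31"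
      unfolding eqs(5) using c U by (simp add: m_assoc del: Units_l_inv)
    also have "\<dots> = inv j31"
      using c U by simp
    finally show ?thesis .
  qed
  \<comment> \<open>\<open>r23\<close> turns \<open>b\<close> into \<open>b2\<close>, a permuted
    cocycle identity replaces \<open>b2\<close> by \<open>a2\<close>, and \<open>r13\<close> turns
    \<open>a2\<close> into \<open>a3\<close>.\<close>
  have "r13 \<otimes> r23 \<otimes> (a \<otimes> j12) = r13 \<otimes> (r23 \<otimes> b) \<otimes> j23"
    unfolding eqs(1) using c by (simp add: m_assoc)
  also have "\<dots> = (r13 \<otimes> a2) \<otimes> j13 \<otimes> inv j32 \<otimes> r23 \<otimes> j23"
    unfolding eqs(2) b2 using c by (simp add: m_assoc)
  also have "\<dots> = a3 \<otimes> r13 \<otimes> j13 \<otimes> inv j32 \<otimes> r23 \<otimes> j23"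
    unfolding eqs(4) ..
  finally have main: "r13 \<otimes> r23 \<otimes> (a \<otimes> j12) = a3 \<otimes> r13 \<otimes> j13 \<otimes> inv j32 \<otimes> r23 \<otimes> j23" .
  have "inv j12 \<otimes> (inv a' \<otimes> (r13 \<otimes> r23) \<otimes> a) \<otimes> j12 =
      inv j12 \<otimes> (inv a' \<otimes> (r13 \<otimes> r23 \<otimes> (a \<otimes> j12)))"
    using c by (simp add: m_assoc)
  also have "\<dots> = (inv j12 \<otimes> (inv a' \<otimes> a3)) \<otimes> r13 \<otimes> j13 \<otimes> inv j32 \<otimes> r23 \<otimes> j23"
    unfolding main using c by (simp add: m_assoc)
  finally show ?thesis unfolding a3 using c by (simp add: m_assoc)
qed

text \<open>Counitality of \<open>J\<close> keeps \<open>eps\<close> a counit for the twisted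
  comultiplication, and the cocycle identity keeps it coassociative.\<close>

locale twisting = coherent_system K S
  for K :: "'k ring" and S :: "('k, 'a) tensor_system" +
  fixes J :: 'a
  assumes J_Units: "J \<in> Units (tpow S 2)"
    and J_counital: "eps S 2 1 J = \<one>\<^bsub>tpow S 1\<^esub>" "eps S 2 2 J = \<one>\<^bsub>tpow S 1\<^esub>"
    and J_cocycle: "delta S 2 1 J \<otimes>\<^bsub>tpow S 3\<^esub> leg S 3 [1, 2] J =
      delta S 2 2 J \<otimes>\<^bsub>tpow S 3\<^esub> leg S 3 [2, 3] J"
begin

sublocale A1: monoid "tpow S 1" by (rule tpow_monoid)
sublocale A2: monoid "tpow S 2" by (rule tpow_monoid)
sublocale A3: monoid "tpow S 3" by (rule tpow_monoid)

lemma twisting_homs: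
  "legs_ok 3 [p, q] \<Longrightarrow> alg_hom K (tpow S 2) (tpow S 3) (leg S 3 [p, q])"
  "alg_hom K (tpow S 2) (tpow S 3) (delta S 2 1)"
  "alg_hom K (tpow S 2) (tpow S 3) (delta S 2 2)"
  "alg_hom K (tpow S 2) (tpow S 2) (leg S 2 [2, 1])"
  "legs_ok 3 [p, q, r] \<Longrightarrow> alg_hom K (tpow S 3) (tpow S 3) (leg S 3 [p, q, r])"
  by (auto intro!: hom_leg hom_delta simp: legs_ok_def)

lemma hom_Units:
  assumes "alg_hom K (tpow S m) (tpow S N) f" "x \<in> Units (tpow S m)"
  shows "f x \<in> Units (tpow S N)" "f (inv\<^bsub>tpow S m\<^esub> x) = inv\<^bsub>tpow S N\<^esub> f x"
  using ring_hom_Units[OF alg_homD(1)[OF assms(1)] tpow_monoid tpow_monoid assms(2)] by auto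

lemma leg_J: "leg S 2 [1, 2] J = J"
  using leg_ident[of J 2] J_Units by (simp add: numeral_2_eq_2 A2.Units_closed[simplified numeral_2_eq_2])

lemma twisted_simps [simp]:
  "tpow (twisted S J) = tpow S" "tensors (twisted S J) = tensors S" "leg (twisted S J) = leg S"
  "eps (twisted S J) = eps S"
  "delta (twisted S J) 1 1 X = inv\<^bsub>tpow S 2\<^esub> J \<otimes>\<^bsub>tpow S 2\<^esub> delta S 1 1 X \<otimes>\<^bsub>tpow S 2\<^esub> J"
  "delta (twisted S J) 2 1 X =
    inv\<^bsub>tpow S 3\<^esub> (leg S 3 [1, 2] J) \<otimes>\<^bsub>tpow S 3\<^esub> delta S 2 1 X \<otimes>\<^bsub>tpow S 3\<^esub> leg S 3 [1, 2] J"
  "delta (twisted S J) 2 2 X =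
    inv\<^bsub>tpow S 3\<^esub> (leg S 3 [2, 3] J) \<otimes>\<^bsub>tpow S 3\<^esub> delta S 2 2 X \<otimes>\<^bsub>tpow S 3\<^esub> leg S 3 [2, 3] J"
  using leg_J by (simp_all add: twisted_def numeral_2_eq_2 numeral_3_eq_3)

text \<open>\<open>coherent_system\<close> lists no axioms for the coproduct; they are recovered by
  comparing position lists.\<close>

lemma coassoc: "b \<in> carrier (tpow S 1) \<Longrightarrow> delta S 2 1 (delta S 1 1 b) = delta S 2 2 (delta S 1 1 b)"
  by (rule rep_eq[OF rep.delta[OF rep_delta1] rep.delta[OF rep_delta1]])
     (auto simp: split_pos_def)

lemma counital: "b \<in> carrier (tpow S 1) \<Longrightarrow> i \<in> {1, 2} \<Longrightarrow> eps S 2 i (delta S 1 1 b) = b"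
  by (rule rep_eq[OF rep.eps[OF rep_delta1] rep.ident])
     (auto simp: split_pos_def drop_pos_def)

text \<open>Both iterated twisted coproducts conjugate the same iterated coproduct \<open>x\<close>,
  one by each side of the cocycle identity, that is, by the same element \<open>u\<close>.\<close>

lemma twisted_comultiplication: "comultiplication K (twisted S J)"
proof -
  note J2 = J_Units A2.Units_closed[OF J_Units] A2.Units_inv_closed[OF J_Units]
  have D11: "alg_hom K (tpow S 1) (tpow S 2) (delta S 1 1)"
    by (rule hom_delta) auto
  have E: "alg_hom K (tpow S 2) (tpow S 1) (eps S 2 i)" if "i \<in> {1, 2}" for i
    using that by (intro hom_eps) auto
  have "alg_hom K (tpow S 1\<lparr>carrier := tensors S 1\<rparr>) (tpow S 2) (delta (twisted S J) 1 1)"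
    using alg_hom_restrict[OF alg_hom_conj[OF D11 algebra J_Units] tensors_carrier]
    by (simp only: twisted_simps(5)[abs_def])
  moreover have "delta (twisted S J) 2 1 (delta (twisted S J) 1 1 b) =
    delta (twisted S J) 2 2 (delta (twisted S J) 1 1 b)" if "b \<in> tensors S 1" for b
  proof -
    have b: "b \<in> carrier (tpow S 1)" using that tensors_carrier by blast
    have db: "delta S 1 1 b \<in> carrier (tpow S 2)" using alg_homD(2)[OF D11 b] .
    define x where "x = delta S 2 1 (delta S 1 1 b)"
    define u where "u = delta S 2 1 J \<otimes>\<^bsub>tpow S 3\<^esub> leg S 3 [1, 2] J"
    have x: "x \<in> carrier (tpow S 3)" using alg_homD(2)[OF twisting_homs(2) db] by (simp add: x_def)
    have aux: "inv\<^bsub>tpow S 3\<^esub> w \<otimes>\<^bsub>tpow S 3\<^esub> (inv\<^bsub>tpow S 3\<^esub> v \<otimes>\<^bsub>tpow S 3\<^esub> x \<otimes>\<^bsub>tpow S 3\<^esub> v) \<otimes>\<^bsub>tpow S 3\<^esub> w =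
      inv\<^bsub>tpow S 3\<^esub> (v \<otimes>\<^bsub>tpow S 3\<^esub> w) \<otimes>\<^bsub>tpow S 3\<^esub> x \<otimes>\<^bsub>tpow S 3\<^esub> (v \<otimes>\<^bsub>tpow S 3\<^esub> w)"
      if "v \<in> Units (tpow S 3)" "w \<in> Units (tpow S 3)" for v w
    proof -
      have "inv\<^bsub>tpow S 3\<^esub> (v \<otimes>\<^bsub>tpow S 3\<^esub> w) = inv\<^bsub>tpow S 3\<^esub> w \<otimes>\<^bsub>tpow S 3\<^esub> inv\<^bsub>tpow S 3\<^esub> v"
        using that by (intro A3.inv_unique'[symmetric])
          (simp_all add: A3.m_assoc A3.Units_closed,
           simp_all add: A3.Units_closed flip: A3.m_assoc)
      then show ?thesis using that x by (simp add: A3.m_assoc A3.Units_closed)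
    qed
    have U: "leg S 3 [1, 2] J \<in> Units (tpow S 3)" "leg S 3 [2, 3] J \<in> Units (tpow S 3)"
      "delta S 2 1 J \<in> Units (tpow S 3)" "delta S 2 2 J \<in> Units (tpow S 3)"
      using hom_Units(1)[OF twisting_homs(1)[of 1 2] J_Units] hom_Units(1)[OF twisting_homs(1)[of 2 3] J_Units]
        hom_Units(1)[OF twisting_homs(2) J_Units] hom_Units(1)[OF twisting_homs(3) J_Units]
      by (simp_all add: legs_ok_def)
    have "delta (twisted S J) 2 1 (delta (twisted S J) 1 1 b) =
      inv\<^bsub>tpow S 3\<^esub> u \<otimes>\<^bsub>tpow S 3\<^esub> x \<otimes>\<^bsub>tpow S 3\<^esub> u"
      using aux[OF U(3,1)] J2 db hom_Units(2)[OF twisting_homs(2) J_Units] alg_homD(4)[OF twisting_homs(2)]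
      by (simp only: twisted_simps x_def u_def A2.m_closed)
    moreover have "delta (twisted S J) 2 2 (delta (twisted S J) 1 1 b) =
      inv\<^bsub>tpow S 3\<^esub> u \<otimes>\<^bsub>tpow S 3\<^esub> x \<otimes>\<^bsub>tpow S 3\<^esub> u"
      using aux[OF U(4,2)] J2 db hom_Units(2)[OF twisting_homs(3) J_Units] alg_homD(4)[OF twisting_homs(3)]
      by (simp only: twisted_simps x_def u_def A2.m_closed J_cocycle coassoc[OF b])
    ultimately show ?thesis by simp
  qed
  moreover have "eps S 2 i (delta (twisted S J) 1 1 b) = b"
    if "b \<in> tensors S 1" "i \<in> {1, 2}" for b i
  proof -
    have b: "b \<in> carrier (tpow S 1)" using that tensors_carrier by blast
    have db: "delta S 1 1 b \<in> carrier (tpow S 2)" using alg_homD(2)[OF D11 b] .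
    have "eps S 2 i J = \<one>\<^bsub>tpow S 1\<^esub>" using that(2) J_counital by auto
    then show ?thesis
      using J2 b db that(2) counital[OF b that(2)] hom_Units(2)[OF E[OF that(2)] J_Units]
      by (simp only: twisted_simps A2.m_closed alg_homD(4)[OF E[OF that(2)]] A1.inv_one A1.l_one A1.r_one)
  qed
  ultimately show ?thesis by (auto simp: comultiplication_def simp del: One_nat_def)
qed

theorem twisted_drinfeld_twist: "drinfeld_twist K S J"
  using J_Units twisted_comultiplication J_cocycle by (simp add: drinfeld_twist_def)

definition twist_R :: "'a \<Rightarrow> 'a" where
  "twist_R R = inv\<^bsub>tpow S 2\<^esub> (leg S 2 [2, 1] J) \<otimes>\<^bsub>tpow S 2\<^esub> R \<otimes>\<^bsub>tpow S 2\<^esub> J"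

section \<open>Twisting an R-matrix by a counital cocycle\<close>

context
  fixes R :: 'a
  assumes R_Units: "R \<in> Units (tpow S 2)"
    and R_intertwiner: "intertwiner S R"
    and R_delta: "delta S 2 1 R = leg S 3 [1, 3] R \<otimes>\<^bsub>tpow S 3\<^esub> leg S 3 [2, 3] R"
      "delta S 2 2 R = leg S 3 [1, 3] R \<otimes>\<^bsub>tpow S 3\<^esub> leg S 3 [1, 2] R"
begin

lemma flip_J_Units: "leg S 2 [2, 1] J \<in> Units (tpow S 2)"
  using hom_Units(1)[OF twisting_homs(4) J_Units] .

lemma twist_R_Units: "twist_R R \<in> Units (tpow S 2)"
  using flip_J_Units J_Units R_Units by (simp add: twist_R_def)

lemma hom_twist_R:
  assumes "alg_hom K (tpow S 2) (tpow S 3) f"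
  shows "f (twist_R R) = inv\<^bsub>tpow S 3\<^esub> (f (leg S 2 [2, 1] J)) \<otimes>\<^bsub>tpow S 3\<^esub> f R \<otimes>\<^bsub>tpow S 3\<^esub> f J"
  using J_Units R_Units flip_J_Units
  by (simp add: twist_R_def alg_homD[OF assms] hom_Units[OF assms] A2.Units_closed)

lemma leg_twist_R:
  assumes "legs_ok 3 [p, q]"
  shows "leg S 3 [p, q] (twist_R R) = inv\<^bsub>tpow S 3\<^esub> (leg S 3 [q, p] J) \<otimes>\<^bsub>tpow S 3\<^esub>
    leg S 3 [p, q] R \<otimes>\<^bsub>tpow S 3\<^esub> leg S 3 [p, q] J"
proof -
  have "leg S 3 [p, q] (leg S 2 [2, 1] J) = leg S 3 [q, p] J"
    using assms J_Units leg_leg[of 3 "[p, q]" 2 "[2, 1]" 2 J] by (auto simp: legs_ok_def A2.Units_closed)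
  then show ?thesis using hom_twist_R[OF twisting_homs(1)[OF assms]] by simp
qed

lemma leg_cocycle:
  assumes "legs_ok 3 [p, q, r]"
  shows "leg S 3 [p, q, r] (delta S 2 1 J) \<otimes>\<^bsub>tpow S 3\<^esub> leg S 3 [p, q] J =
    leg S 3 [p, q, r] (delta S 2 2 J) \<otimes>\<^bsub>tpow S 3\<^esub> leg S 3 [q, r] J"
proof -
  have J: "J \<in> carrier (tpow S 2)" using J_Units by (rule A2.Units_closed)
  have "leg S 3 [p, q, r] (leg S 3 [1, 2] J) = leg S 3 [p, q] J"
    "leg S 3 [p, q, r] (leg S 3 [2, 3] J) = leg S 3 [q, r] J"
    using assms J leg_leg[of 3 "[p, q, r]" 3 "[1, 2]" 2 J] leg_leg[of 3 "[p, q, r]" 3 "[2, 3]" 2 J]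
    by (auto simp: legs_ok_def)
  moreover have "leg S 3 [1, 2] J \<in> carrier (tpow S 3)" "leg S 3 [2, 3] J \<in> carrier (tpow S 3)"
    "delta S 2 1 J \<in> carrier (tpow S 3)" "delta S 2 2 J \<in> carrier (tpow S 3)"
    using J by (auto intro!: alg_homD(2)[OF twisting_homs(1)] alg_homD(2)[OF twisting_homs(2)] alg_homD(2)[OF twisting_homs(3)]
        simp: legs_ok_def simp del: One_nat_def)
  ultimately show ?thesis
    using arg_cong[OF J_cocycle, of "leg S 3 [p, q, r]"] by (simp add: alg_homD(4)[OF twisting_homs(5)[OF assms]])
qed

lemma R_intertwines:
  "X \<in> carrier (tpow S 1) \<Longrightarrow> R \<otimes>\<^bsub>tpow S 2\<^esub> delta S 1 1 X = leg S 2 [2, 1] (delta S 1 1 X) \<otimes>\<^bsub>tpow S 2\<^esub> R"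
  "X \<in> carrier (tpow S 2) \<Longrightarrow> leg S 3 [1, 2] R \<otimes>\<^bsub>tpow S 3\<^esub> delta S 2 1 X =
    leg S 3 [2, 1, 3] (delta S 2 1 X) \<otimes>\<^bsub>tpow S 3\<^esub> leg S 3 [1, 2] R"
  "X \<in> carrier (tpow S 2) \<Longrightarrow> leg S 3 [2, 3] R \<otimes>\<^bsub>tpow S 3\<^esub> delta S 2 2 X =
    leg S 3 [1, 3, 2] (delta S 2 2 X) \<otimes>\<^bsub>tpow S 3\<^esub> leg S 3 [2, 3] R"
proof -
  have R: "leg S 2 [1, 2] R = R"
    using leg_ident[of R 2] A2.Units_closed[OF R_Units] by (simp add: numeral_2_eq_2)
  have I: "\<lbrakk>1 \<le> i; i \<le> m; X \<in> carrier (tpow S m)\<rbrakk> \<Longrightarrow>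
     leg S (m + 1) [i, i + 1] R \<otimes>\<^bsub>tpow S (m + 1)\<^esub> delta S m i X =
     leg S (m + 1) (swap_pos (m + 1) i) (delta S m i X) \<otimes>\<^bsub>tpow S (m + 1)\<^esub> leg S (m + 1) [i, i + 1] R"
    for m i X
    using R_intertwiner by (auto simp: intertwiner_def)
  show "X \<in> carrier (tpow S 1) \<Longrightarrow>
      R \<otimes>\<^bsub>tpow S 2\<^esub> delta S 1 1 X = leg S 2 [2, 1] (delta S 1 1 X) \<otimes>\<^bsub>tpow S 2\<^esub> R"
    using I[of 1 1 X] R by (simp add: swap_pos_def numeral_2_eq_2)
  show "X \<in> carrier (tpow S 2) \<Longrightarrow> leg S 3 [1, 2] R \<otimes>\<^bsub>tpow S 3\<^esub> delta S 2 1 X =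
      leg S 3 [2, 1, 3] (delta S 2 1 X) \<otimes>\<^bsub>tpow S 3\<^esub> leg S 3 [1, 2] R"
    using I[of 1 2 X] by (simp add: swap_pos_def numeral_2_eq_2 numeral_3_eq_3)
  show "X \<in> carrier (tpow S 2) \<Longrightarrow> leg S 3 [2, 3] R \<otimes>\<^bsub>tpow S 3\<^esub> delta S 2 2 X =
      leg S 3 [1, 3, 2] (delta S 2 2 X) \<otimes>\<^bsub>tpow S 3\<^esub> leg S 3 [2, 3] R"
    using I[of 2 2 X] by (simp add: swap_pos_def numeral_2_eq_2 numeral_3_eq_3)
qed

text \<open>Both coproduct formulas are instances of \<open>twisted_hexagon\<close>, the second with
  the two coproducts of \<open>J\<close> exchanged and the cocycle identities read backwards. The
  relation with the opposite coproduct is that of \<open>R\<close>, conjugated by \<open>J\<close>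
  and by its flip.\<close>

theorem twist_R_matrix: "R_matrix (twisted S J) (twist_R R)"
proof -
  have J: "J \<in> carrier (tpow S 2)" using J_Units by (rule A2.Units_closed)
  have R: "R \<in> carrier (tpow S 2)" using R_Units by (rule A2.Units_closed)
  have U: "leg S 3 [p, q] J \<in> Units (tpow S 3)" if "legs_ok 3 [p, q]" for p q
    using hom_Units(1)[OF twisting_homs(1)[OF that] J_Units] .
  have C: "leg S 3 [p, q] x \<in> carrier (tpow S 3)" if "legs_ok 3 [p, q]" "x \<in> carrier (tpow S 2)" for p q x
    using alg_homD(2)[OF twisting_homs(1)[OF that(1)] that(2)] .
  have P: "leg S 3 [p, q, r] x \<in> carrier (tpow S 3)"
    if "legs_ok 3 [p, q, r]" "x \<in> carrier (tpow S 3)" for p q r x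
    using alg_homD(2)[OF twisting_homs(5)[OF that(1)] that(2)] .
  have D: "delta S 2 1 x \<in> carrier (tpow S 3)" "delta S 2 2 x \<in> carrier (tpow S 3)"
    if "x \<in> carrier (tpow S 2)" for x
    using alg_homD(2)[OF twisting_homs(2) that] alg_homD(2)[OF twisting_homs(3) that] by blast+
  have DU: "delta S 2 1 (leg S 2 [2, 1] J) \<in> Units (tpow S 3)"
    "delta S 2 2 (leg S 2 [2, 1] J) \<in> Units (tpow S 3)"
    using hom_Units(1)[OF twisting_homs(2) flip_J_Units] hom_Units(1)[OF twisting_homs(3) flip_J_Units] by blast+
  have ok: "legs_ok 3 [1, 2]" "legs_ok 3 [1, 3]" "legs_ok 3 [2, 3]" "legs_ok 3 [2, 1]"
    "legs_ok 3 [3, 1]" "legs_ok 3 [3, 2]" "legs_ok 3 [1, 3, 2]" "legs_ok 3 [2, 1, 3]"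
    "legs_ok 3 [3, 1, 2]" "legs_ok 3 [2, 3, 1]"
    by (auto simp: legs_ok_def)
  \<comment> \<open>Splitting a leg of the flipped \<open>J\<close> is splitting the other leg of
    \<open>J\<close> followed by a cyclic permutation; both sides have the same position
    lists.\<close>
  have flip_delta: "leg S 3 [3, 1, 2] (delta S 2 2 J) = delta S 2 1 (leg S 2 [2, 1] J)"
    "leg S 3 [2, 3, 1] (delta S 2 1 J) = delta S 2 2 (leg S 2 [2, 1] J)"
    by (rule rep_eq[OF rep.leg[OF rep_delta1] rep.delta[OF rep_leg1] J];
        auto simp: legs_ok_def split_pos_def le_Suc_eq numeral_eq_Suc)+
  have perm: "leg S 3 [1, 3, 2] (leg S 3 [2, 1, 3] x) = leg S 3 [3, 1, 2] x"
    "leg S 3 [2, 1, 3] (leg S 3 [1, 3, 2] x) = leg S 3 [2, 3, 1] x"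
    if "x \<in> carrier (tpow S 3)" for x
    using that leg_leg[of 3 "[1, 3, 2]" 3 "[2, 1, 3]" 3 x] leg_leg[of 3 "[2, 1, 3]" 3 "[1, 3, 2]" 3 x]
    by (auto simp: legs_ok_def)
  have perm2: "leg S 3 [1, 3, 2] (leg S 3 [1, 2] R) = leg S 3 [1, 3] R"
    "leg S 3 [2, 1, 3] (leg S 3 [2, 3] R) = leg S 3 [1, 3] R"
    using R leg_leg[of 3 "[1, 3, 2]" 3 "[1, 2]" 2 R] leg_leg[of 3 "[2, 1, 3]" 3 "[2, 3]" 2 R]
    by (auto simp: legs_ok_def)
  \<comment> \<open>\<open>delta\<close> produces adjacent legs only. Permuting the relation for
    legs \<open>1, 2\<close> yields the one needed for legs \<open>1, 3\<close>; \<open>I2\<close>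
    starts from legs \<open>2, 3\<close>.\<close>
  have I1: "leg S 3 [1, 3] R \<otimes>\<^bsub>tpow S 3\<^esub> leg S 3 [1, 3, 2] (delta S 2 1 J) =
    leg S 3 [3, 1, 2] (delta S 2 1 J) \<otimes>\<^bsub>tpow S 3\<^esub> leg S 3 [1, 3] R"
    using arg_cong[OF R_intertwines(2)[OF J], of "leg S 3 [1, 3, 2]"] C[OF ok(1) R] D[OF J] P[OF ok(8)]
    by (simp only: alg_homD(4)[OF twisting_homs(5)[OF ok(7)]] perm perm2)
  have I2: "leg S 3 [1, 3] R \<otimes>\<^bsub>tpow S 3\<^esub> leg S 3 [2, 1, 3] (delta S 2 2 J) =
    leg S 3 [2, 3, 1] (delta S 2 2 J) \<otimes>\<^bsub>tpow S 3\<^esub> leg S 3 [1, 3] R"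
    using arg_cong[OF R_intertwines(3)[OF J], of "leg S 3 [2, 1, 3]"] C[OF ok(3) R] D[OF J] P[OF ok(7)]
    by (simp only: alg_homD(4)[OF twisting_homs(5)[OF ok(8)]] perm perm2)
  have "delta (twisted S J) 2 1 (twist_R R) =
    leg S 3 [1, 3] (twist_R R) \<otimes>\<^bsub>tpow S 3\<^esub> leg S 3 [2, 3] (twist_R R)"
    unfolding twisted_simps leg_twist_R[OF ok(2)] leg_twist_R[OF ok(3)] hom_twist_R[OF twisting_homs(2)] R_delta
    by (rule A3.twisted_hexagon[OF D(1)[OF J] P[OF ok(7) D(1)[OF J]] P[OF ok(9) D(1)[OF J]]
          D(2)[OF J] P[OF ok(7) D(2)[OF J]] C[OF ok(2) J] C[OF ok(3) J] C[OF ok(2) R] C[OF ok(3) R]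
          U[OF ok(1)] U[OF ok(5)] U[OF ok(6)] DU(1) J_cocycle R_intertwines(3)[OF J]
          leg_cocycle[OF ok(7)] I1 leg_cocycle[OF ok(9), unfolded flip_delta]])
  moreover have "delta (twisted S J) 2 2 (twist_R R) =
    leg S 3 [1, 3] (twist_R R) \<otimes>\<^bsub>tpow S 3\<^esub> leg S 3 [1, 2] (twist_R R)"
    unfolding twisted_simps leg_twist_R[OF ok(2)] leg_twist_R[OF ok(1)] hom_twist_R[OF twisting_homs(3)] R_delta
    by (rule A3.twisted_hexagon[OF D(2)[OF J] P[OF ok(8) D(2)[OF J]] P[OF ok(10) D(2)[OF J]]
          D(1)[OF J] P[OF ok(8) D(1)[OF J]] C[OF ok(2) J] C[OF ok(1) J] C[OF ok(2) R] C[OF ok(1) R]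
          U[OF ok(3)] U[OF ok(5)] U[OF ok(4)] DU(2) J_cocycle[symmetric] R_intertwines(2)[OF J]
          leg_cocycle[OF ok(8), symmetric] I2 leg_cocycle[OF ok(10), unfolded flip_delta, symmetric]])
  moreover have "leg S 2 [2, 1] (delta (twisted S J) 1 1 b) =
      twist_R R \<otimes>\<^bsub>tpow S 2\<^esub> delta (twisted S J) 1 1 b \<otimes>\<^bsub>tpow S 2\<^esub> inv\<^bsub>tpow S 2\<^esub> (twist_R R)"
    if "b \<in> tensors S 1" for b
  proof -
    have b: "b \<in> carrier (tpow S 1)" using that tensors_carrier by blast
    define y where "y = delta S 1 1 b"
    define J' where "J' = leg S 2 [2, 1] J"
    define y' where "y' = leg S 2 [2, 1] y"
    have y: "y \<in> carrier (tpow S 2)" "y' \<in> carrier (tpow S 2)"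
      using alg_homD(2)[OF hom_delta[of 1 1 2] b] alg_homD(2)[OF twisting_homs(4)] by (auto simp: y_def y'_def)
    have J': "J' \<in> Units (tpow S 2)" using flip_J_Units by (simp add: J'_def)
    have Ry: "R \<otimes>\<^bsub>tpow S 2\<^esub> y = y' \<otimes>\<^bsub>tpow S 2\<^esub> R"
      unfolding y_def y'_def by (rule R_intertwines(1)[OF b])
    have TC: "twist_R R \<in> carrier (tpow S 2)" using twist_R_Units by (rule A2.Units_closed)
    have L: "leg S 2 [2, 1] (delta (twisted S J) 1 1 b) = inv\<^bsub>tpow S 2\<^esub> J' \<otimes>\<^bsub>tpow S 2\<^esub> y' \<otimes>\<^bsub>tpow S 2\<^esub> J'"
      using J y A2.Units_inv_closed[OF J_Units]
      by (simp only: twisted_simps alg_homD(4)[OF twisting_homs(4)] hom_Units(2)[OF twisting_homs(4) J_Units]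
          A2.m_closed J'_def y'_def y_def)
    have T: "twist_R R = inv\<^bsub>tpow S 2\<^esub> J' \<otimes>\<^bsub>tpow S 2\<^esub> R \<otimes>\<^bsub>tpow S 2\<^esub> J"
      by (simp add: twist_R_def J'_def)
    have c: "J' \<in> carrier (tpow S 2)" "inv\<^bsub>tpow S 2\<^esub> J' \<in> carrier (tpow S 2)"
      "inv\<^bsub>tpow S 2\<^esub> J \<in> carrier (tpow S 2)"
      using J' J_Units by auto
    have cancel: "v \<otimes>\<^bsub>tpow S 2\<^esub> (inv\<^bsub>tpow S 2\<^esub> v \<otimes>\<^bsub>tpow S 2\<^esub> x) = x"
      if "v \<in> Units (tpow S 2)" "x \<in> carrier (tpow S 2)" for v x
      using that by (simp add: A2.Units_closed flip: A2.m_assoc)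
    have "twist_R R \<otimes>\<^bsub>tpow S 2\<^esub> delta (twisted S J) 1 1 b =
      inv\<^bsub>tpow S 2\<^esub> J' \<otimes>\<^bsub>tpow S 2\<^esub> (R \<otimes>\<^bsub>tpow S 2\<^esub> y) \<otimes>\<^bsub>tpow S 2\<^esub> J"
      using c R J y cancel[OF J_Units] by (simp only: twisted_simps T A2.m_assoc A2.m_closed flip: y_def)
    also have "\<dots> = leg S 2 [2, 1] (delta (twisted S J) 1 1 b) \<otimes>\<^bsub>tpow S 2\<^esub> twist_R R"
      unfolding Ry L using c R J y cancel[OF J'] by (simp only: T A2.m_assoc A2.m_closed)
    finally show ?thesis
      using twist_R_Units L c y by (simp add: A2.m_assoc TC)
  qed
  ultimately show ?thesis
    using twist_R_Units by (simp add: R_matrix_def del: One_nat_def)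
qed

text \<open>The usual deduction lets the R-matrix in legs \<open>1, 2\<close> reverse
  \<open>(\<Delta> \<otimes> id)(R)\<close>. The twisted relation in \<open>twist_R_matrix\<close>
  concerns elements of \<open>tensors S 1\<close> only, so the twist is undone first:
  \<open>d\<close> is the untwisted coproduct of the twisted R-matrix, conjugated by
  \<open>j\<close>, and the intertwining property of \<open>R\<close> itself is applied to
  it.\<close>

theorem twist_R_QYBE: "QYBE S (twist_R R)"
proof -
  have J: "J \<in> carrier (tpow S 2)" using J_Units by (rule A2.Units_closed)
  have T: "twist_R R \<in> carrier (tpow S 2)" using twist_R_Units by (rule A2.Units_closed)
  have ok: "legs_ok 3 [1, 2]" "legs_ok 3 [1, 3]" "legs_ok 3 [2, 3]" "legs_ok 3 [2, 1]" "legs_ok 3 [2, 1, 3]"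
    by (auto simp: legs_ok_def)
  define d where "d = delta S 2 1 (twist_R R)"
  define d' where "d' = leg S 3 [2, 1, 3] d"
  define j where "j = leg S 3 [1, 2] J"
  define j' where "j' = leg S 3 [2, 1] J"
  define r where "r = leg S 3 [1, 2] R"
  define t where "t p q = leg S 3 [p, q] (twist_R R)" for p q
  have c: "d \<in> carrier (tpow S 3)" "d' \<in> carrier (tpow S 3)" "r \<in> carrier (tpow S 3)"
    using alg_homD(2)[OF twisting_homs(2) T] alg_homD(2)[OF twisting_homs(5)[OF ok(5)]]
      alg_homD(2)[OF twisting_homs(1)[OF ok(1)] A2.Units_closed[OF R_Units]]
    by (auto simp: d_def d'_def r_def)
  have t: "t p q \<in> carrier (tpow S 3)" if "legs_ok 3 [p, q]" for p q
    unfolding t_def using alg_homD(2)[OF twisting_homs(1)[OF that] T] .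
  have U: "j \<in> Units (tpow S 3)" "j' \<in> Units (tpow S 3)"
    using hom_Units(1)[OF twisting_homs(1)[OF ok(1)] J_Units] hom_Units(1)[OF twisting_homs(1)[OF ok(4)] J_Units]
    by (simp_all add: j_def j'_def)
  note cU = U[THEN A3.Units_closed] U[THEN A3.Units_inv_closed]
  have cancel: "v \<otimes>\<^bsub>tpow S 3\<^esub> (inv\<^bsub>tpow S 3\<^esub> v \<otimes>\<^bsub>tpow S 3\<^esub> x) = x"
    if "v \<in> Units (tpow S 3)" "x \<in> carrier (tpow S 3)" for v x
    using that by (simp add: A3.Units_closed flip: A3.m_assoc)
  have rd: "r \<otimes>\<^bsub>tpow S 3\<^esub> d = d' \<otimes>\<^bsub>tpow S 3\<^esub> r"
    unfolding r_def d_def d'_def by (rule R_intertwines(2)[OF T])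
  have t12: "t 1 2 = inv\<^bsub>tpow S 3\<^esub> j' \<otimes>\<^bsub>tpow S 3\<^esub> r \<otimes>\<^bsub>tpow S 3\<^esub> j"
    unfolding t_def j_def j'_def r_def by (rule leg_twist_R[OF ok(1)])
  have hex: "t 1 3 \<otimes>\<^bsub>tpow S 3\<^esub> t 2 3 = inv\<^bsub>tpow S 3\<^esub> j \<otimes>\<^bsub>tpow S 3\<^esub> d \<otimes>\<^bsub>tpow S 3\<^esub> j"
    using twist_R_matrix unfolding R_matrix_def twisted_simps t_def d_def j_def by simp
  have leg213: "leg S 3 [2, 1, 3] (leg S 3 [p, q] x) = leg S 3 (map (\<lambda>i. [2, 1, 3] ! (i - 1)) [p, q]) x"
    if "legs_ok 3 [p, q]" "x \<in> carrier (tpow S 2)" for p q x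
    by (rule leg_leg[where M = 3 and k = 2]) (use that ok in auto)
  have flips: "leg S 3 [2, 1, 3] (t 1 3) = t 2 3" "leg S 3 [2, 1, 3] (t 2 3) = t 1 3"
    "leg S 3 [2, 1, 3] j = j'"
    unfolding t_def j_def j'_def
    using leg213[OF ok(2) T] leg213[OF ok(3) T] leg213[OF ok(1) J] by simp_all
  \<comment> \<open>Exchanging the first two legs in \<open>hex\<close> gives the product in the
    opposite order, with \<open>d'\<close> and \<open>j'\<close> in place of \<open>d\<close> and
    \<open>j\<close>.\<close>
  have "t 2 3 \<otimes>\<^bsub>tpow S 3\<^esub> t 1 3 = leg S 3 [2, 1, 3] (t 1 3 \<otimes>\<^bsub>tpow S 3\<^esub> t 2 3)"
    by (simp only: alg_homD(4)[OF twisting_homs(5)[OF ok(5)] t[OF ok(2)] t[OF ok(3)]] flips)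
  also have "\<dots> = inv\<^bsub>tpow S 3\<^esub> j' \<otimes>\<^bsub>tpow S 3\<^esub> d' \<otimes>\<^bsub>tpow S 3\<^esub> j'"
    unfolding hex using c cU
    by (simp only: alg_homD(4)[OF twisting_homs(5)[OF ok(5)]] A3.m_closed flips
        hom_Units(2)[OF twisting_homs(5)[OF ok(5)] U(1)] d'_def)
  finally have hex': "t 2 3 \<otimes>\<^bsub>tpow S 3\<^esub> t 1 3 = \<dots>" .
  have "t 1 2 \<otimes>\<^bsub>tpow S 3\<^esub> (t 1 3 \<otimes>\<^bsub>tpow S 3\<^esub> t 2 3) =
    inv\<^bsub>tpow S 3\<^esub> j' \<otimes>\<^bsub>tpow S 3\<^esub> (r \<otimes>\<^bsub>tpow S 3\<^esub> d) \<otimes>\<^bsub>tpow S 3\<^esub> j"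
    unfolding hex t12 using c cU cancel[OF U(1)] by (simp add: A3.m_assoc)
  also have "\<dots> = (t 2 3 \<otimes>\<^bsub>tpow S 3\<^esub> t 1 3) \<otimes>\<^bsub>tpow S 3\<^esub> t 1 2"
    unfolding rd hex' t12 using c cU cancel[OF U(2)] by (simp add: A3.m_assoc)
  finally have "t 1 2 \<otimes>\<^bsub>tpow S 3\<^esub> t 1 3 \<otimes>\<^bsub>tpow S 3\<^esub> t 2 3 =
    t 2 3 \<otimes>\<^bsub>tpow S 3\<^esub> t 1 3 \<otimes>\<^bsub>tpow S 3\<^esub> t 1 2"
    using t ok by (simp add: A3.m_assoc)
  then show ?thesis by (simp add: QYBE_def t_def)
qed

end

end

section \<open>Coherence for the tensor power of a bialgebra\<close>

text \<open>The data of a structural map of the \<open>n\<close>-th tensor power, whose factors are blocks of \<open>n\<close>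
  consecutive factors: each of the \<open>n\<close> positions in a block is treated according to \<open>D\<close>.\<close>

definition blk :: "nat \<Rightarrow> (nat \<Rightarrow> nat list) \<Rightarrow> nat \<Rightarrow> nat list" where
  "blk n D s = map (\<lambda>q. (q - 1) * n + (s - 1) mod n + 1) (D ((s - 1) div n + 1))"

lemma blk_eq: "r < n \<Longrightarrow> blk n D (b * n + r + 1) = map (\<lambda>q. (q - 1) * n + r + 1) (D (b + 1))"
  by (simp add: blk_def)

lemma blk_cases:
  fixes s m n :: nat
  assumes "1 \<le> s" "s \<le> m * n"
  obtains b r where "s = b * n + r + 1" "b < m" "r < n"
proof
  have "n > 0" using assms by (cases n) auto
  then show "s = (s - 1) div n * n + (s - 1) mod n + 1" "(s - 1) mod n < n"
    using assms(1) by (simp_all add: algebra_simps)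
  show "(s - 1) div n < m" using assms by (intro less_mult_imp_div_less) auto
qed

text \<open>No map of this kind changes the offset \<open>r\<close> inside a block, so composition
  acts on block numbers alone. The hypothesis on \<open>D\<close> guarantees
  \<open>q \<ge> 1\<close>, hence \<open>q - 1 + 1 = q\<close>.\<close>

lemma rep_blk_comp:
  assumes "rep S (N * n) P g (blk n E)" "rep S (m * n) (N * n) f (blk n D)"
    and D: "\<And>s. \<lbrakk>1 \<le> s; s \<le> m\<rbrakk> \<Longrightarrow> set (D s) \<subseteq> {1..N}"
  shows "rep S (m * n) P (\<lambda>x. g (f x)) (blk n (\<lambda>s. concat (map E (D s))))"
proof (rule rep.cong[OF rep_comp[OF assms(1,2)]])
  fix s assume "1 \<le> s" "s \<le> m * n"
  then obtain b r where s: "s = b * n + r + 1" "b < m" "r < n" by (rule blk_cases)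
  have "concat (map (blk n E) (map (\<lambda>q. (q - 1) * n + r + 1) qs)) =
    map (\<lambda>q. (q - 1) * n + r + 1) (concat (map E qs))" if "set qs \<subseteq> {1..N}" for qs
    using that
  proof (induction qs)
    case (Cons q qs)
    have "blk n E ((q - 1) * n + r + 1) = map (\<lambda>q. (q - 1) * n + r + 1) (E (q - 1 + 1))"
      using s(3) by (rule blk_eq)
    then show ?case using Cons by simp
  qed simp
  then show "concat (map (blk n E) (blk n D s)) = blk n (\<lambda>s. concat (map E (D s))) s"
    using D[of "b + 1"] s(2) by (simp add: s(1) blk_eq[OF s(3), simplified])
qed

section \<open>Leg embeddings of whole blocks\<close>

lemma length_block: "1 \<le> p \<Longrightarrow> length (block n p) = n"
  by (cases p) (simp_all add: block_def del: upt_Suc)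

lemma set_block: "set (block n p) = {(p - 1) * n + 1..p * n}"
  by (auto simp: block_def simp del: upt_Suc)

lemma legs_ok_blocks: "legs_ok N ps \<Longrightarrow> legs_ok (N * n) (concat (map (block n) ps))"
proof (induction ps)
  case (Cons p ps)
  have p: "1 \<le> p" "p \<le> N" "distinct (block n p)"
    using Cons.prems by (auto simp: legs_ok_def block_def)
  have "p * n \<le> N * n" using p by simp
  then have "set (block n p) \<subseteq> {1..N * n}" unfolding set_block by auto
  moreover have "set (block n p) \<inter> set (block n q) = {}" if "q \<in> set ps" for q
  proof -
    have "q \<noteq> p" "1 \<le> q" using that Cons.prems by (auto simp: legs_ok_def)
    then have "p * n \<le> (q - 1) * n \<or> q * n \<le> (p - 1) * n"
      by (cases "p < q") (auto intro!: mult_le_mono1)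
    then have "\<not> (x \<in> set (block n p) \<and> x \<in> set (block n q))" for x
      unfolding set_block atLeastAtMost_iff by linarith
    then show ?thesis by blast
  qed
  ultimately show ?case using Cons p by (auto simp: legs_ok_def)
qed (simp add: legs_ok_def)

lemma length_blocks: "legs_ok N ps \<Longrightarrow> length (concat (map (block n) ps)) = length ps * n"
  by (induction ps) (auto simp: legs_ok_def length_block)

lemma nth_blocks:
  assumes "\<And>p. p \<in> set ps \<Longrightarrow> 1 \<le> p" "b < length ps" "r < n"
  shows "concat (map (block n) ps) ! (b * n + r) = (ps ! b - 1) * n + r + 1"
  using assms(1,2)
proof (induction ps arbitrary: b)
  case (Cons p ps)
  have len: "length (block n p) = n" using Cons.prems by (intro length_block) auto
  show ?case
  proof (cases b)
    case 0
    have "block n p ! r = (p - 1) * n + 1 + r"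
      using len assms(3) unfolding block_def by (subst nth_upt) (auto simp del: upt_Suc)
    then show ?thesis using 0 len assms(3) by (simp add: nth_append)
  next
    case (Suc b')
    then show ?thesis using len Cons by (simp add: nth_append)
  qed
qed simp

lemma rep_blocks:
  assumes "legs_ok P ps" "length ps = N"
  shows "rep S (N * n) (P * n) (leg S (P * n) (concat (map (block n) ps))) (blk n (\<lambda>s. [ps ! (s - 1)]))"
proof (rule rep.cong[OF rep.leg[OF rep.ident legs_ok_blocks[OF assms(1)]]])
  show "length (concat (map (block n) ps)) = N * n"
    using length_blocks[OF assms(1)] assms(2) by simp
  fix s assume "1 \<le> s" "s \<le> N * n"
  then obtain b r where s: "s = b * n + r + 1" "b < N" "r < n" by (rule blk_cases)
  have "concat (map (block n) ps) ! (b * n + r) = (ps ! b - 1) * n + r + 1"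
    using assms s by (intro nth_blocks) (auto simp: legs_ok_def)
  then show "map (\<lambda>p. concat (map (block n) ps) ! (p - 1)) [s] = blk n (\<lambda>s. [ps ! (s - 1)]) s"
    unfolding s(1) blk_eq[OF s(3)] by simp
qed

text \<open>Here \<open>e\<close> is the last position of the block, and after \<open>r\<close>
  steps its last \<open>r\<close> factors have been split. Working from right to left keeps
  \<open>e - r\<close> the position of the next factor; a split factor \<open>s\<close> occupies two
  adjacent positions, and everything beyond \<open>e\<close> has moved by \<open>r\<close>.\<close>

lemma rep_fold_delta:
  assumes "n \<le> e" "e \<le> M" "r \<le> n"
  shows "rep S M (M + r) (fold (\<lambda>r. delta S (M + r) (e - r)) [0..<r])
    (\<lambda>s. if s \<le> e - r then [s] else if s \<le> e then [2 * s - (e - r) - 1, 2 * s - (e - r)] else [s + r])"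
  using assms(3)
proof (induction r)
  case 0
  have "rep S M M (\<lambda>x. x) (\<lambda>s. if s \<le> e - 0 then [s] else if s \<le> e
      then [2 * s - (e - 0) - 1, 2 * s - (e - 0)] else [s + 0])"
    by (rule rep.cong[OF rep.ident]) auto
  then show ?case by (simp add: id_def)
next
  case (Suc r)
  have f: "fold (\<lambda>r. delta S (M + r) (e - r)) [0..<Suc r] =
    (\<lambda>x. delta S (M + r) (e - r) (fold (\<lambda>r. delta S (M + r) (e - r)) [0..<r] x))"
    by (rule ext) simp
  have IH: "rep S M (M + r) (fold (\<lambda>r. delta S (M + r) (e - r)) [0..<r])
    (\<lambda>s. if s \<le> e - r then [s] else if s \<le> e then [2 * s - (e - r) - 1, 2 * s - (e - r)] else [s + r])"
    using Suc by simp
  show ?case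
    unfolding f
  proof (rule rep.cong[OF rep.delta[OF IH]])
    define a where "a = e - r"
    have e: "e = a + r" "1 \<le> a" "e - r = a" "e - Suc r = a - 1"
      using Suc.prems assms by (auto simp: a_def)
    fix s
    consider "s < a" | "s = a" | "a < s" "s \<le> e" | "e < s" by linarith
    then show "concat (map (split_pos (e - r)) (if s \<le> e - r then [s] else if s \<le> e
        then [2 * s - (e - r) - 1, 2 * s - (e - r)] else [s + r])) =
      (if s \<le> e - Suc r then [s] else if s \<le> e
        then [2 * s - (e - Suc r) - 1, 2 * s - (e - Suc r)] else [s + Suc r])"
      unfolding e(3,4) using e(1,2) by cases (auto simp: split_pos_def)
  qed (use Suc.prems assms in auto)
qed

lemma rep_fold_eps:
  assumes "n \<le> e" "e \<le> M" "r \<le> n"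
  shows "rep S M (M - r) (fold (\<lambda>r. eps S (M - r) (e - r)) [0..<r])
    (\<lambda>s. if s \<le> e - r then [s] else if s \<le> e then [] else [s - r])"
  using assms(3)
proof (induction r)
  case 0
  have "rep S M M (\<lambda>x. x) (\<lambda>s. if s \<le> e - 0 then [s] else if s \<le> e then [] else [s - 0])"
    by (rule rep.cong[OF rep.ident]) auto
  then show ?case by (simp add: id_def)
next
  case (Suc r)
  have f: "fold (\<lambda>r. eps S (M - r) (e - r)) [0..<Suc r] =
    (\<lambda>x. eps S (M - r) (e - r) (fold (\<lambda>r. eps S (M - r) (e - r)) [0..<r] x))"
    by (rule ext) simp
  have IH: "rep S M (M - r) (fold (\<lambda>r. eps S (M - r) (e - r)) [0..<r])
    (\<lambda>s. if s \<le> e - r then [s] else if s \<le> e then [] else [s - r])"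
    using Suc by simp
  show ?case
    unfolding f
    by (rule rep.cong[OF rep.eps[OF IH]]) (use Suc.prems assms in \<open>auto simp: drop_pos_def\<close>)
qed

section \<open>The permutation that follows the factorwise comultiplication\<close>

lemma nth_concat_pairs:
  "k < length xs \<Longrightarrow> concat (map (\<lambda>j. [f j, g j]) xs) ! (2 * k) = f (xs ! k)"
  "k < length xs \<Longrightarrow> concat (map (\<lambda>j. [f j, g j]) xs) ! Suc (2 * k) = g (xs ! k)"
  by (induction xs arbitrary: k) (auto simp: nth_Cons split: nat.splits)

lemma length_concat_pairs: "length (concat (map (\<lambda>j. [f j, g j]) xs)) = 2 * length xs"
  by (induction xs) auto

text \<open>List entries are counted from \<open>0\<close> and positions from \<open>1\<close>. With
  \<open>j\<close> counted from \<open>0\<close> as well, the two components of factor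
  \<open>j\<close> of the block are entries \<open>t + 2 * j\<close> and
  \<open>t + 2 * j + 1\<close>.\<close>

lemma unshuffle_nth:
  fixes i m n :: nat
  assumes i: "1 \<le> i" "i \<le> m"
  defines "t \<equiv> (i - 1) * n" and "U \<equiv> unshuffle n m i"
  shows "length U = (m + 1) * n" "legs_ok ((m + 1) * n) U"
    "q < t \<Longrightarrow> U ! q = q + 1"
    "j < n \<Longrightarrow> U ! (t + 2 * j) = t + j + 1"
    "j < n \<Longrightarrow> U ! (t + 2 * j + 1) = t + n + j + 1"
    "\<lbrakk>t + 2 * n \<le> q; q < (m + 1) * n\<rbrakk> \<Longrightarrow> U ! q = q + 1"
proof -
  let ?c = "concat (map (\<lambda>j. [t + j, t + n + j]) [1..<n + 1])"
  have U: "U = [1..<t + 1] @ ?c @ [t + 2 * n + 1..<(m + 1) * n + 1]"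
    by (simp add: U_def unshuffle_def t_def Let_def del: upt_Suc)
  have "(i - 1 + 2) * n \<le> (m + 1) * n" using i by (intro mult_le_mono1) auto
  then have le: "t + 2 * n \<le> (m + 1) * n" by (simp add: t_def algebra_simps)
  have lc: "length ?c = 2 * n" by (subst length_concat_pairs) simp
  show len: "length U = (m + 1) * n"
    unfolding U length_append lc using le by (simp del: upt_Suc)
  have "set ?c = {t + 1..t + 2 * n}"
  proof
    show "{t + 1..t + 2 * n} \<subseteq> set ?c"
    proof
      fix x assume x: "x \<in> {t + 1..t + 2 * n}"
      show "x \<in> set ?c"
      proof (cases "x \<le> t + n")
        case True
        then have "x - t \<in> set [1..<n + 1]" "x = t + (x - t)" using x by auto
        then show ?thesis unfolding set_concat set_map by (auto simp del: set_upt upt_Suc)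
      next
        case False
        then have "x - t - n \<in> set [1..<n + 1]" "x = t + n + (x - t - n)" using x by auto
        then show ?thesis unfolding set_concat set_map by (auto simp del: set_upt upt_Suc)
      qed
    qed
  qed (auto simp del: upt_Suc)
  then have "set U = {1..(m + 1) * n}"
    unfolding U set_append using le by (auto simp del: upt_Suc)
  \<comment> \<open>The list has as many entries as values, so it has no repetitions.\<close>
  moreover from this have "distinct U"
    using len by (intro card_distinct) simp
  ultimately show "legs_ok ((m + 1) * n) U" by (simp add: legs_ok_def)
  show "q < t \<Longrightarrow> U ! q = q + 1"
    unfolding U by (simp add: nth_append del: upt_Suc)
  show "U ! (t + 2 * j) = t + j + 1" if "j < n"
  proof -
    have "U ! (t + 2 * j) = ?c ! (2 * j)"
      using that lc unfolding U by (simp add: nth_append del: upt_Suc)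
    then show ?thesis using that by (simp add: nth_concat_pairs del: upt_Suc)
  qed
  show "U ! (t + 2 * j + 1) = t + n + j + 1" if "j < n"
  proof -
    have "U ! (t + 2 * j + 1) = ?c ! Suc (2 * j)"
      using that lc unfolding U by (simp add: nth_append del: upt_Suc)
    then show ?thesis using that by (simp add: nth_concat_pairs del: upt_Suc)
  qed
  show "U ! q = q + 1" if "t + 2 * n \<le> q" "q < (m + 1) * n"
  proof -
    have l: "length ([1..<t + 1] @ ?c) = t + 2 * n"
      unfolding length_append lc by (simp del: upt_Suc)
    have "U ! (t + 2 * n + k) = [t + 2 * n + 1..<(m + 1) * n + 1] ! k" for k
      unfolding U append_assoc[symmetric] l[symmetric] by (rule nth_append_length_plus)
    from this[of "q - (t + 2 * n)"] show ?thesis using that by (subst (asm) nth_upt) auto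
  qed
qed

text \<open>The two components of a factor lie next to each other after the fold. The permutation
  sends them to the same offset in blocks \<open>i\<close> and \<open>i + 1\<close>, which is
  precisely the blockwise form of \<open>split_pos i\<close>.\<close>

lemma rep_tensor_power_delta:
  assumes i: "1 \<le> i" "i \<le> m"
  shows "rep S (m * n) ((m + 1) * n) (delta (tensor_power n S) m i) (blk n (split_pos i))"
proof -
  define t where "t = (i - 1) * n"
  define U where "U = unshuffle n m i"
  note U = unshuffle_nth[OF i, where n = n, folded t_def U_def]
  have e: "i * n = t + n" using i by (cases i) (auto simp: t_def)
  have le: "i * n \<le> m * n" using i by simp
  have d: "delta (tensor_power n S) m i =
    (\<lambda>X. leg S ((m + 1) * n) U (fold (\<lambda>r. delta S (m * n + r) (i * n - r)) [0..<n] X))"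
    by (simp add: tensor_power_def U_def)
  have F: "rep S (m * n) (m * n + n) (fold (\<lambda>r. delta S (m * n + r) (i * n - r)) [0..<n])
    (\<lambda>s. if s \<le> i * n - n then [s] else if s \<le> i * n
      then [2 * s - (i * n - n) - 1, 2 * s - (i * n - n)] else [s + n])"
    using le e by (intro rep_fold_delta[of n "i * n" "m * n" n]) auto
  show ?thesis
    unfolding d
  proof (rule rep.cong[OF rep.leg[OF F U(2)]])
    show "length U = m * n + n" using U(1) by simp
    fix s assume "1 \<le> s" "s \<le> m * n"
    then obtain b r where s: "s = b * n + r + 1" "b < m" "r < n" by (rule blk_cases)
    consider "b + 1 < i" | "b + 1 = i" | "i < b + 1" by linarith
    then show "map (\<lambda>p. U ! (p - 1)) (if s \<le> i * n - n then [s] else if s \<le> i * n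
      then [2 * s - (i * n - n) - 1, 2 * s - (i * n - n)] else [s + n]) = blk n (split_pos i) s"
    proof cases
      case 1
      have "(b + 1) * n \<le> t" unfolding t_def using 1 by (intro mult_le_mono1) auto
      then have "s \<le> t" using s by simp
      then show ?thesis
        using 1 e U(3)[of "s - 1"] blk_eq[OF s(3), of "split_pos i" b] s(1)
        by (auto simp: split_pos_def)
    next
      case 2
      then have "b * n = t" by (auto simp: t_def)
      then show ?thesis
        using 2 e s U(4)[OF s(3)] U(5)[OF s(3)] blk_eq[OF s(3), of "split_pos i" b]
        by (auto simp: split_pos_def algebra_simps)
    next
      case 3
      have "i * n \<le> b * n" using 3 by (intro mult_le_mono1) auto
      moreover have "(b + 1) * n \<le> m * n" using s(2) by (intro mult_le_mono1) auto
      ultimately show ?thesis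
        using 3 e s U(6)[of "s + n - 1"] blk_eq[OF s(3), of "split_pos i" b]
        by (auto simp: split_pos_def algebra_simps)
    qed
  qed
qed

lemma rep_tensor_power_eps:
  assumes i: "1 \<le> i" "i \<le> m"
  shows "rep S (m * n) ((m - 1) * n) (eps (tensor_power n S) m i) (blk n (drop_pos i))"
proof -
  have e: "i * n = (i - 1) * n + n" using i by (cases i) auto
  have le: "i * n \<le> m * n" using i by simp
  have d: "eps (tensor_power n S) m i = fold (\<lambda>r. eps S (m * n - r) (i * n - r)) [0..<n]"
    by (simp add: tensor_power_def)
  have "rep S (m * n) (m * n - n) (fold (\<lambda>r. eps S (m * n - r) (i * n - r)) [0..<n])
    (\<lambda>s. if s \<le> i * n - n then [s] else if s \<le> i * n then [] else [s - n])"
    using le e by (intro rep_fold_eps[of n "i * n" "m * n" n]) auto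
  then have F: "rep S (m * n) ((m - 1) * n) (fold (\<lambda>r. eps S (m * n - r) (i * n - r)) [0..<n])
    (\<lambda>s. if s \<le> i * n - n then [s] else if s \<le> i * n then [] else [s - n])"
    by (simp add: diff_mult_distrib)
  show ?thesis
    unfolding d
  proof (rule rep.cong[OF F])
    fix s assume "1 \<le> s" "s \<le> m * n"
    then obtain b r where s: "s = b * n + r + 1" "b < m" "r < n" by (rule blk_cases)
    consider "b + 1 < i" | "b + 1 = i" | "i < b + 1" by linarith
    then show "(if s \<le> i * n - n then [s] else if s \<le> i * n then [] else [s - n]) = blk n (drop_pos i) s"
    proof cases
      case 1
      have "(b + 1) * n \<le> (i - 1) * n" using 1 by (intro mult_le_mono1) auto
      then have "s \<le> i * n - n" using s e by simp
      then show ?thesis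
        using 1 blk_eq[OF s(3), of "drop_pos i" b] s(1) by (auto simp: drop_pos_def)
    next
      case 2
      then have "b * n = i * n - n" "i * n = b * n + n" using e by auto
      then show ?thesis
        using 2 s blk_eq[OF s(3), of "drop_pos i" b] by (auto simp: drop_pos_def)
    next
      case 3
      then obtain b' where b': "b = Suc b'" using i by (cases b) auto
      have "i * n \<le> b * n" using 3 by (intro mult_le_mono1) auto
      then show ?thesis
        using 3 s b' blk_eq[OF s(3), of "drop_pos i" b]
        by (auto simp: drop_pos_def algebra_simps)
    qed
  qed
qed

text \<open>Reduces coherence for the tensor power to coherence for \<open>S\<close>: equal lists of
  blocks give equal lists of positions.\<close>

lemma rep_tensor_power:
  "rep (tensor_power n S) m N f D \<Longrightarrow> rep S (m * n) (N * n) f (blk n D)"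
proof (induction rule: rep.induct)
  case (ident m)
  show ?case
  proof (rule rep.cong[OF rep.ident])
    fix s assume "1 \<le> s" "s \<le> m * n"
    then obtain b r where s: "s = b * n + r + 1" "r < n" by (rule blk_cases)
    then show "[s] = blk n (\<lambda>s. [s]) s" by (simp only: blk_eq) simp
  qed
next
  case (leg m N f D P ps)
  have "leg (tensor_power n S) P ps = leg S (P * n) (concat (map (block n) ps))"
    by (simp add: tensor_power_def)
  moreover have "set (D s) \<subseteq> {1..N}" if "1 \<le> s" "s \<le> m" for s
    using rep_legs_ok[OF leg.hyps(1) that] by (simp add: legs_ok_def)
  ultimately show ?case
    using rep_blk_comp[OF rep_blocks[OF leg.hyps(2,3)] leg.IH] by simp
next
  case (delta m N f D i P)
  have "set (D s) \<subseteq> {1..N}" if "1 \<le> s" "s \<le> m" for s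
    using rep_legs_ok[OF delta.hyps(1) that] by (simp add: legs_ok_def)
  then show ?case
    unfolding delta.hyps(4) by (rule rep_blk_comp[OF rep_tensor_power_delta[OF delta.hyps(2,3)] delta.IH])
next
  case (eps m N f D i P)
  have "set (D s) \<subseteq> {1..N}" if "1 \<le> s" "s \<le> m" for s
    using rep_legs_ok[OF eps.hyps(1) that] by (simp add: legs_ok_def)
  then show ?case
    unfolding eps.hyps(4) by (rule rep_blk_comp[OF rep_tensor_power_eps[OF eps.hyps(2,3)] eps.IH])
next
  case (cong m N f D D')
  show ?case
  proof (rule rep.cong[OF cong.IH])
    fix s assume "1 \<le> s" "s \<le> m * n"
    then obtain b r where s: "s = b * n + r + 1" "b < m" "r < n" by (rule blk_cases)
    then show "blk n D s = blk n D' s" using cong.hyps(2)[of "b + 1"] by (simp add: blk_eq del: One_nat_def add_Suc_right)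
  qed
qed

section \<open>Bialgebras and their tensor powers as coherent systems\<close>

sublocale completed_bialgebra \<subseteq> coherent_system K S
  by unfold_locales
     (use tpow_algebra rep_structural structural_hom coherence tensors_closed in blast)+

lemma (in completed_bialgebra) coherent_tensor_power: "coherent_system K (tensor_power n S)"
proof
  show "k_algebra K (tpow (tensor_power n S) m)" for m
    using tpow_algebra by (simp add: tensor_power_def)
  show "alg_hom K (tpow (tensor_power n S) m) (tpow (tensor_power n S) N) f"
    if "rep (tensor_power n S) m N f D" for m N f D
    using structural_hom[OF rep_structural[OF rep_tensor_power[OF that]]]
    by (simp add: tensor_power_def)
  show "f x = g x" if "rep (tensor_power n S) m N f D" "rep (tensor_power n S) m N g D"
    "x \<in> carrier (tpow (tensor_power n S) m)" for m N f g D x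
    using coherence[OF rep_tensor_power[OF that(1)] rep_tensor_power[OF that(2)]] that(3)
    by (simp add: tensor_power_def)
  show "tensors (tensor_power n S) m \<subseteq> carrier (tpow (tensor_power n S) m)" for m
    using tensors_closed by (simp add: tensor_power_def)
qed

section \<open>The twist of a transitive array\<close>

text \<open>Meant for the diagonal R-matrix acting on the coproduct of one factor of a block: a
  single factor \<open>f j\<close> sees this coproduct and reverses it, while the others commute
  with it before and after the reversal.\<close>

lemma (in monoid) ordered_prod_intertwine_one:
  assumes "j \<in> set xs" "distinct xs"
    and y: "y \<in> carrier G" "y' \<in> carrier G"
    and f: "\<And>i. i \<in> set xs \<Longrightarrow> f i \<in> carrier G"
    and j: "f j \<otimes> y = y' \<otimes> f j"
    and comm: "\<And>i. \<lbrakk>i \<in> set xs; i \<noteq> j\<rbrakk> \<Longrightarrow> f i \<otimes> y = y \<otimes> f i"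
      "\<And>i. \<lbrakk>i \<in> set xs; i \<noteq> j\<rbrakk> \<Longrightarrow> f i \<otimes> y' = y' \<otimes> f i"
  shows "ordered_prod G (map f xs) \<otimes> y = y' \<otimes> ordered_prod G (map f xs)"
  using assms(1,2) f comm
proof (induction xs)
  case (Cons i xs)
  let ?P = "ordered_prod G (map f xs)"
  have P: "?P \<in> carrier G" "f i \<in> carrier G"
    using Cons.prems by (auto intro!: ordered_prod_closed)
  show ?case
  proof (cases "i = j")
    case True
    have "?P \<otimes> y = y \<otimes> ?P"
      using Cons.prems True y by (intro ordered_prod_commute) auto
    then have "f i \<otimes> ?P \<otimes> y = (f i \<otimes> y) \<otimes> ?P" using P y by (simp add: m_assoc)
    also have "\<dots> = (y' \<otimes> f i) \<otimes> ?P" using j True by simp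
    finally show ?thesis using P y by (simp add: m_assoc)
  next
    case False
    have "?P \<otimes> y = y' \<otimes> ?P" using Cons False by simp
    then have "f i \<otimes> ?P \<otimes> y = (f i \<otimes> y') \<otimes> ?P" using P y by (simp add: m_assoc)
    also have "\<dots> = (y' \<otimes> f i) \<otimes> ?P" using Cons.prems(5)[of i] False by simp
    finally show ?thesis using P y by (simp add: m_assoc)
  qed
qed simp

lemma (in monoid) ordered_prod_ones: "set xs \<subseteq> {\<one>} \<Longrightarrow> ordered_prod G xs = \<one>"
  by (induction xs) auto

lemma nth_swap_pos:
  assumes "1 \<le> i" "i < N" "1 \<le> p" "p \<le> N"
  shows "swap_pos N i ! (p - 1) = (if p = i then i + 1 else if p = i + 1 then i else p)"
  using assms by (auto simp: swap_pos_def nth_append nth_Cons' simp del: upt_Suc)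

lemma legs_ok_swap_pos: "\<lbrakk>1 \<le> i; i < N\<rbrakk> \<Longrightarrow> legs_ok N (swap_pos N i)"
  by (auto simp: legs_ok_def swap_pos_def simp del: upt_Suc)

lemma length_swap_pos: "\<lbrakk>1 \<le> i; i < N\<rbrakk> \<Longrightarrow> length (swap_pos N i) = N"
  by (auto simp: swap_pos_def simp del: upt_Suc)

lemma rep_swap_delta:
  assumes "1 \<le> i" "i \<le> m"
  shows "rep S m (m + 1) (\<lambda>X. leg S (m + 1) (swap_pos (m + 1) i) (delta S m i X))
    (\<lambda>s. if s = i then [i + 1, i] else split_pos i s)"
proof (rule rep.cong[OF rep.leg[OF rep.delta[OF rep.ident]]])
  fix s assume "1 \<le> s" "s \<le> m"
  then show "map (\<lambda>p. swap_pos (m + 1) i ! (p - 1)) (concat (map (split_pos i) [s])) =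
    (if s = i then [i + 1, i] else split_pos i s)"
    using assms nth_swap_pos[of i "m + 1" i] nth_swap_pos[of i "m + 1" "i + 1"]
      nth_swap_pos[of i "m + 1" s] nth_swap_pos[of i "m + 1" "s + 1"]
    by (auto simp: split_pos_def)
qed (use assms legs_ok_swap_pos[of i "m + 1"] length_swap_pos[of i "m + 1"] in auto)

section \<open>Consequences of the R-matrix axioms in arbitrary legs\<close>

context completed_bialgebra
begin

lemma gen_leg: "\<lbrakk>1 \<le> p; p \<le> N; h \<in> carrier H\<rbrakk> \<Longrightarrow> gen N p h = leg S N [p] (tens 1 [h])"
  using leg_gen[of N "[p]" 1 1 h] gen_1[of h] by (simp add: legs_ok_def)

lemma leg_gen_commute:
  assumes "legs_ok N [p, q]" "x \<in> carrier (tpow S 2)" "1 \<le> r" "r \<le> N" "r \<noteq> p" "r \<noteq> q" "h \<in> carrier H"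
  shows "leg S N [p, q] x \<otimes>\<^bsub>tpow S N\<^esub> gen N r h = gen N r h \<otimes>\<^bsub>tpow S N\<^esub> leg S N [p, q] x"
  unfolding gen_leg[OF assms(3,4,7)]
  using assms tens1_closed[OF assms(7)] by (intro leg_commute) (auto simp: legs_ok_def numeral_2_eq_2)

lemma leg_pair_commute:
  assumes "legs_ok N [p, q]" "legs_ok N [p', q']" "{p, q} \<inter> {p', q'} = {}"
    and "x \<in> carrier (tpow S 2)" "y \<in> carrier (tpow S 2)"
  shows "leg S N [p, q] x \<otimes>\<^bsub>tpow S N\<^esub> leg S N [p', q'] y = leg S N [p', q'] y \<otimes>\<^bsub>tpow S N\<^esub> leg S N [p, q] x"
  using assms by (intro leg_commute) (auto simp: numeral_2_eq_2)

lemma leg_pair_closed: "\<lbrakk>legs_ok N [p, q]; x \<in> carrier (tpow S 2)\<rbrakk> \<Longrightarrow> leg S N [p, q] x \<in> carrier (tpow S N)"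
  by (rule leg_closed) (auto simp: numeral_2_eq_2)

lemma leg_pair_Units: "\<lbrakk>legs_ok N [p, q]; x \<in> Units (tpow S 2)\<rbrakk> \<Longrightarrow> leg S N [p, q] x \<in> Units (tpow S N)"
  using ring_hom_Units(1)[OF alg_homD(1)[OF hom_leg[of N "[p, q]" 2]]] by simp

lemma R_matrixD:
  assumes "R_matrix S R"
  shows "R \<in> Units (tpow S 2)" "R \<in> carrier (tpow S 2)"
    "delta S 2 1 R = leg S 3 [1, 3] R \<otimes>\<^bsub>tpow S 3\<^esub> leg S 3 [2, 3] R"
    "delta S 2 2 R = leg S 3 [1, 3] R \<otimes>\<^bsub>tpow S 3\<^esub> leg S 3 [1, 2] R"
    "h \<in> carrier H \<Longrightarrow> R \<otimes>\<^bsub>tpow S 2\<^esub> cop h = flip S (cop h) \<otimes>\<^bsub>tpow S 2\<^esub> R"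
proof -
  interpret A: monoid "tpow S 2" by simp
  show U: "R \<in> Units (tpow S 2)" and
    "delta S 2 1 R = leg S 3 [1, 3] R \<otimes>\<^bsub>tpow S 3\<^esub> leg S 3 [2, 3] R"
    "delta S 2 2 R = leg S 3 [1, 3] R \<otimes>\<^bsub>tpow S 3\<^esub> leg S 3 [1, 2] R"
    using assms by (auto simp: R_matrix_def)
  show C: "R \<in> carrier (tpow S 2)" using U by (rule A.Units_closed)
  assume h: "h \<in> carrier H"
  have "flip S (cop h) = R \<otimes>\<^bsub>tpow S 2\<^esub> cop h \<otimes>\<^bsub>tpow S 2\<^esub> inv\<^bsub>tpow S 2\<^esub> R"
    using assms tens1_tensors[OF h] by (simp add: R_matrix_def cop_def)
  then show "R \<otimes>\<^bsub>tpow S 2\<^esub> cop h = flip S (cop h) \<otimes>\<^bsub>tpow S 2\<^esub> R"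
    using U C h by (simp add: A.m_assoc)
qed

lemma leg_R_cop:
  assumes R: "R_matrix S R" and ok: "legs_ok N [p, q]" and h: "h \<in> carrier H"
  shows "leg S N [p, q] R \<otimes>\<^bsub>tpow S N\<^esub> leg S N [p, q] (cop h) =
    leg S N [q, p] (cop h) \<otimes>\<^bsub>tpow S N\<^esub> leg S N [p, q] R"
proof -
  have f: "alg_hom K (tpow S 2) (tpow S N) (leg S N [p, q])"
    using ok by (intro hom_leg) auto
  have "flip S (cop h) \<in> carrier (tpow S 2)"
    using h by (intro leg_pair_closed) (auto simp: legs_ok_def)
  moreover have "leg S N [p, q] (flip S (cop h)) = leg S N [q, p] (cop h)"
    using h ok leg_leg[of N "[p, q]" "[2, 1]" "cop h"] by (auto simp: legs_ok_def numeral_2_eq_2)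
  ultimately show ?thesis
    using arg_cong[OF R_matrixD(5)[OF R h], of "leg S N [p, q]"] R_matrixD(2)[OF R] h
    by (simp add: alg_homD(4)[OF f])
qed

text \<open>On generators only two cases occur: a factor that is not split must commute with
  \<open>u\<close>, and for a factor that is split \<open>u\<close> must reverse the order of the
  pair of legs. This serves both a single R-matrix and a product of R-matrices between two
  blocks.\<close>

lemma intertwine_pairs:
  assumes f: "rep S m N f D" and g: "rep S m N g E" and u: "u \<in> carrier (tpow S N)"
    and X: "X \<in> carrier (tpow S m)"
    and gens: "\<And>s h. \<lbrakk>1 \<le> s; s \<le> m; h \<in> carrier H\<rbrakk> \<Longrightarrow>
      (\<exists>p. D s = [p] \<and> E s = [p] \<and> u \<otimes>\<^bsub>tpow S N\<^esub> gen N p h = gen N p h \<otimes>\<^bsub>tpow S N\<^esub> u) \<or>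
      (\<exists>p q. D s = [p, q] \<and> E s = [q, p] \<and>
        u \<otimes>\<^bsub>tpow S N\<^esub> leg S N [p, q] (cop h) = leg S N [q, p] (cop h) \<otimes>\<^bsub>tpow S N\<^esub> u)"
  shows "u \<otimes>\<^bsub>tpow S N\<^esub> f X = g X \<otimes>\<^bsub>tpow S N\<^esub> u"
proof (rule intertwine_from_gen[OF rep_structural[OF f] rep_structural[OF g] u _ X])
  fix s h assume s: "1 \<le> s" "s \<le> m" and h: "h \<in> carrier H"
  have ok: "legs_ok N (D s)" using rep_legs_ok[OF f s] .
  have F: "f (gen m s h) = leg S N (D s) (iter_cop (length (D s)) h)"
    and G: "g (gen m s h) = leg S N (E s) (iter_cop (length (E s)) h)"
    using rep_gen[OF f s h] rep_gen[OF g s h] by simp_all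
  show "u \<otimes>\<^bsub>tpow S N\<^esub> f (gen m s h) = g (gen m s h) \<otimes>\<^bsub>tpow S N\<^esub> u"
    using gens[OF s h] ok gen_leg[OF _ _ h]
    unfolding F G by (auto simp: iter_cop.simps legs_ok_def cop_def)
qed

text \<open>On a tensor with one nontrivial factor, \<open>delta S m i\<close> yields either a
  coproduct in legs \<open>i, i + 1\<close>, covered by the definition of an R-matrix, or a factor
  outside these legs, which commutes with \<open>R\<close>.\<close>

lemma R_matrix_intertwiner:
  assumes R: "R_matrix S R"
  shows "intertwiner S R"
  unfolding intertwiner_def
proof (intro allI impI, elim conjE)
  fix m i X assume i: "1 \<le> i" "i \<le> m" and X: "X \<in> carrier (tpow S m)"
  have ok: "legs_ok (m + 1) [i, i + 1]" using i by (simp add: legs_ok_def)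
  have "rep S m (m + 1) (delta S m i) (split_pos i)"
    using rep_delta1[OF i refl, of S] by simp
  then show "leg S (m + 1) [i, i + 1] R \<otimes>\<^bsub>tpow S (m + 1)\<^esub> delta S m i X =
    leg S (m + 1) (swap_pos (m + 1) i) (delta S m i X) \<otimes>\<^bsub>tpow S (m + 1)\<^esub> leg S (m + 1) [i, i + 1] R"
  proof (rule intertwine_pairs[OF _ rep_swap_delta[OF i] leg_pair_closed[OF ok R_matrixD(2)[OF R]] X])
    fix s h assume s: "1 \<le> s" "s \<le> m" and h: "h \<in> carrier H"
    have "leg S (m + 1) [i, i + 1] R \<otimes>\<^bsub>tpow S (m + 1)\<^esub> gen (m + 1) p h =
      gen (m + 1) p h \<otimes>\<^bsub>tpow S (m + 1)\<^esub> leg S (m + 1) [i, i + 1] R"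
      if "p \<noteq> i" "p \<noteq> i + 1" "1 \<le> p" "p \<le> m + 1" for p
      using that h ok R_matrixD(2)[OF R] by (intro leg_gen_commute) auto
    from this[of s] this[of "s + 1"] leg_R_cop[OF R ok h] show
      "(\<exists>p. split_pos i s = [p] \<and> (if s = i then [i + 1, i] else split_pos i s) = [p] \<and>
        leg S (m + 1) [i, i + 1] R \<otimes>\<^bsub>tpow S (m + 1)\<^esub> gen (m + 1) p h =
        gen (m + 1) p h \<otimes>\<^bsub>tpow S (m + 1)\<^esub> leg S (m + 1) [i, i + 1] R) \<or>
      (\<exists>p q. split_pos i s = [p, q] \<and> (if s = i then [i + 1, i] else split_pos i s) = [q, p] \<and>
        leg S (m + 1) [i, i + 1] R \<otimes>\<^bsub>tpow S (m + 1)\<^esub> leg S (m + 1) [p, q] (cop h) =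
        leg S (m + 1) [q, p] (cop h) \<otimes>\<^bsub>tpow S (m + 1)\<^esub> leg S (m + 1) [i, i + 1] R)"
      using s by (auto simp: split_pos_def)
  qed
qed

text \<open>Applying the counit to the first leg of \<open>(\<Delta> \<otimes> id)(R) =
  R\<^sub>1\<^sub>3 R\<^sub>2\<^sub>3\<close> gives \<open>R = x R\<close>, where \<open>x\<close>
  is \<open>(\<epsilon> \<otimes> id)(R)\<close> placed in the second leg. Since \<open>R\<close> is
  invertible, \<open>x = 1\<close>; the other counit is symmetric.\<close>

lemma R_matrix_counital:
  assumes R: "R_matrix S R"
  shows "eps S 2 1 R = \<one>\<^bsub>tpow S 1\<^esub>" "eps S 2 2 R = \<one>\<^bsub>tpow S 1\<^esub>"
proof -
  interpret A: monoid "tpow S 2" by simp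
  note RC = R_matrixD(2)[OF R]
  have E: "eps S 2 i R \<in> carrier (tpow S 1)" if "i \<in> {1, 2}" for i
    using that RC alg_homD(2)[OF hom_eps[of i 2 1]] by auto
  have e3: "alg_hom K (tpow S 3) (tpow S 2) (eps S 3 i)" if "i \<in> {1, 3}" for i
    using that by (intro hom_eps) auto
  have L: "leg S 3 [1, 3] R \<in> carrier (tpow S 3)" "leg S 3 [2, 3] R \<in> carrier (tpow S 3)"
    "leg S 3 [1, 2] R \<in> carrier (tpow S 3)"
    using RC by (auto intro!: leg_pair_closed simp: legs_ok_def)
  have ed: "eps S 3 1 (delta S 2 1 R) = R" "eps S 3 3 (delta S 2 2 R) = R"
    by (rule rep_eq[OF rep.eps[OF rep_delta1] rep.ident RC]; auto simp: split_pos_def drop_pos_def)+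
  have el: "eps S 3 1 (leg S 3 [1, 3] R) = leg S 2 [2] (eps S 2 1 R)"
    "eps S 3 3 (leg S 3 [1, 3] R) = leg S 2 [1] (eps S 2 2 R)"
    by (rule rep_eq[OF rep.eps[OF rep_leg1] rep.leg[OF rep_eps1] RC];
        auto simp: drop_pos_def legs_ok_def le_Suc_eq numeral_eq_Suc)+
  have er: "eps S 3 1 (leg S 3 [2, 3] R) = R" "eps S 3 3 (leg S 3 [1, 2] R) = R"
    by (rule rep_eq[OF rep.eps[OF rep_leg1] rep.ident RC];
        auto simp: drop_pos_def legs_ok_def le_Suc_eq numeral_eq_Suc)+
  have cancel: "x = \<one>\<^bsub>tpow S 2\<^esub>" if "x \<in> carrier (tpow S 2)" "R = x \<otimes>\<^bsub>tpow S 2\<^esub> R" for x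
  proof -
    have "x \<otimes>\<^bsub>tpow S 2\<^esub> R \<otimes>\<^bsub>tpow S 2\<^esub> inv\<^bsub>tpow S 2\<^esub> R = \<one>\<^bsub>tpow S 2\<^esub>"
      using R_matrixD(1)[OF R] that(2) by simp
    then show ?thesis using that(1) RC R_matrixD(1)[OF R] by (simp add: A.m_assoc)
  qed
  \<comment> \<open>The counit of the empty leg is a left inverse of the embedding, so an embedded
    element equal to \<open>1\<close> is itself \<open>1\<close>.\<close>
  have le: "eps S 2 1 (leg S 2 [2] x) = x" "eps S 2 2 (leg S 2 [1] x) = x" if "x \<in> carrier (tpow S 1)" for x
    by (rule rep_eq[OF rep.eps[OF rep_leg1] rep.ident that]; auto simp: drop_pos_def legs_ok_def)+
  have l1: "leg S 2 [i] x \<in> carrier (tpow S 2)" if "x \<in> carrier (tpow S 1)" "i \<in> {1, 2}" for x i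
    using that alg_homD(2)[OF hom_leg[of 2 "[i]" 1]] by (auto simp: legs_ok_def)
  have "leg S 2 [2] (eps S 2 1 R) = \<one>\<^bsub>tpow S 2\<^esub>"
  proof (rule cancel)
    show "R = leg S 2 [2] (eps S 2 1 R) \<otimes>\<^bsub>tpow S 2\<^esub> R"
      using ed(1) alg_homD(4)[OF e3 L(1,2), of 1] unfolding R_matrixD(3)[OF R] el er by simp
  qed (use l1 E in auto)
  then show "eps S 2 1 R = \<one>\<^bsub>tpow S 1\<^esub>"
    using le(1)[OF E, of 1] alg_homD(3)[OF hom_eps[of 1 2 1]] by simp
  have "leg S 2 [1] (eps S 2 2 R) = \<one>\<^bsub>tpow S 2\<^esub>"
  proof (rule cancel)
    show "R = leg S 2 [1] (eps S 2 2 R) \<otimes>\<^bsub>tpow S 2\<^esub> R"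
      using ed(2) alg_homD(4)[OF e3 L(1,3), of 3] unfolding R_matrixD(4)[OF R] el er by simp
  qed (use l1 E in auto)
  then show "eps S 2 2 R = \<one>\<^bsub>tpow S 1\<^esub>"
    using le(2)[OF E, of 2] alg_homD(3)[OF hom_eps[of 2 2 1]] by simp
qed

text \<open>If \<open>T = Q\<close>, then \<open>P\<^sub>1\<^sub>2\<close> intertwines
  \<open>(\<Delta> \<otimes> id)(Q) = Q\<^sub>1\<^sub>3 Q\<^sub>2\<^sub>3\<close> with its flip; if
  \<open>T = P\<close>, then \<open>Q\<^sub>2\<^sub>3\<close> intertwines \<open>(id \<otimes>
  \<Delta>)(P) = P\<^sub>1\<^sub>3 P\<^sub>1\<^sub>2\<close> with its flip. The middle factor thus
  has to come from the coproduct of one of the outer two, which is the source of the transitivity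
  condition.\<close>

lemma mixed_YBE:
  assumes P: "R_matrix S P" and Q: "R_matrix S Q" and T: "T = P \<or> T = Q"
  shows "leg S 3 [1, 2] P \<otimes>\<^bsub>tpow S 3\<^esub> leg S 3 [1, 3] T \<otimes>\<^bsub>tpow S 3\<^esub> leg S 3 [2, 3] Q =
    leg S 3 [2, 3] Q \<otimes>\<^bsub>tpow S 3\<^esub> leg S 3 [1, 3] T \<otimes>\<^bsub>tpow S 3\<^esub> leg S 3 [1, 2] P"
proof -
  interpret A: monoid "tpow S 3" by simp
  have ok: "legs_ok 3 [1, 2]" "legs_ok 3 [1, 3]" "legs_ok 3 [2, 3]" "legs_ok 3 [2, 1, 3]" "legs_ok 3 [1, 3, 2]"
    by (auto simp: legs_ok_def)
  have C: "leg S 3 [1, 2] x \<in> carrier (tpow S 3)" "leg S 3 [1, 3] x \<in> carrier (tpow S 3)"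
    "leg S 3 [2, 3] x \<in> carrier (tpow S 3)" if "x \<in> carrier (tpow S 2)" for x
    using that ok by (auto intro!: leg_pair_closed simp del: One_nat_def)
  note car = R_matrixD(2)[OF P] R_matrixD(2)[OF Q]
  have h: "alg_hom K (tpow S 3) (tpow S 3) (leg S 3 [2, 1, 3])" "alg_hom K (tpow S 3) (tpow S 3) (leg S 3 [1, 3, 2])"
    using ok by (auto intro!: hom_leg)
  have perm: "leg S 3 [2, 1, 3] (leg S 3 [1, 3] x) = leg S 3 [2, 3] x"
    "leg S 3 [2, 1, 3] (leg S 3 [2, 3] x) = leg S 3 [1, 3] x"
    "leg S 3 [1, 3, 2] (leg S 3 [1, 3] x) = leg S 3 [1, 2] x"
    "leg S 3 [1, 3, 2] (leg S 3 [1, 2] x) = leg S 3 [1, 3] x" if "x \<in> carrier (tpow S 2)" for x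
    by (rule rep_eq[OF rep.leg[OF rep_leg1] rep_leg1 that]; auto simp: legs_ok_def le_Suc_eq numeral_eq_Suc)+
  from T show ?thesis
  proof
    assume "T = Q"
    have "leg S 3 [1, 2] P \<otimes>\<^bsub>tpow S 3\<^esub> delta S 2 1 Q =
      leg S 3 [2, 1, 3] (delta S 2 1 Q) \<otimes>\<^bsub>tpow S 3\<^esub> leg S 3 [1, 2] P"
      using R_matrix_intertwiner[OF P, unfolded intertwiner_def, rule_format, of 1 2 Q] car
      by (simp add: swap_pos_def numeral_2_eq_2 numeral_3_eq_3)
    then show ?thesis
      unfolding R_matrixD(3)[OF Q] \<open>T = Q\<close>
      by (simp only: alg_homD(4)[OF h(1)] C car perm A.m_assoc A.m_closed)
  next
    assume "T = P"
    have "leg S 3 [2, 3] Q \<otimes>\<^bsub>tpow S 3\<^esub> delta S 2 2 P =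
      leg S 3 [1, 3, 2] (delta S 2 2 P) \<otimes>\<^bsub>tpow S 3\<^esub> leg S 3 [2, 3] Q"
      using R_matrix_intertwiner[OF Q, unfolded intertwiner_def, rule_format, of 2 2 P] car
      by (simp add: swap_pos_def numeral_2_eq_2 numeral_3_eq_3)
    then show ?thesis
      unfolding R_matrixD(4)[OF P] \<open>T = P\<close>
      by (simp only: alg_homD(4)[OF h(2)] C car perm A.m_assoc A.m_closed)
  qed
qed

lemma mixed_YBE_legs:
  assumes P: "R_matrix S P" and Q: "R_matrix S Q" and T: "T = P \<or> T = Q" and ok: "legs_ok N [x, y, z]"
  shows "leg S N [x, y] P \<otimes>\<^bsub>tpow S N\<^esub> leg S N [x, z] T \<otimes>\<^bsub>tpow S N\<^esub> leg S N [y, z] Q =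
    leg S N [y, z] Q \<otimes>\<^bsub>tpow S N\<^esub> leg S N [x, z] T \<otimes>\<^bsub>tpow S N\<^esub> leg S N [x, y] P"
proof -
  interpret A: monoid "tpow S 3" by simp
  have TC: "T \<in> carrier (tpow S 2)" using T R_matrixD(2)[OF P] R_matrixD(2)[OF Q] by auto
  have ok3: "legs_ok 3 [1, 2]" "legs_ok 3 [1, 3]" "legs_ok 3 [2, 3]" by (auto simp: legs_ok_def)
  have C: "leg S 3 [1, 2] P \<in> carrier (tpow S 3)" "leg S 3 [1, 3] T \<in> carrier (tpow S 3)"
    "leg S 3 [2, 3] Q \<in> carrier (tpow S 3)"
    using TC R_matrixD(2)[OF P] R_matrixD(2)[OF Q] ok3 by (auto intro!: leg_pair_closed simp del: One_nat_def)
  have f: "alg_hom K (tpow S 3) (tpow S N) (leg S N [x, y, z])" using ok by (intro hom_leg) auto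
  have perm: "leg S N [x, y, z] (leg S 3 [1, 2] w) = leg S N [x, y] w"
    "leg S N [x, y, z] (leg S 3 [1, 3] w) = leg S N [x, z] w"
    "leg S N [x, y, z] (leg S 3 [2, 3] w) = leg S N [y, z] w" if "w \<in> carrier (tpow S 2)" for w
    by (rule rep_eq[OF rep.leg[OF rep_leg1] rep_leg1 that];
        use ok in \<open>auto simp: legs_ok_def le_Suc_eq numeral_eq_Suc\<close>)+
  show ?thesis
    using arg_cong[OF mixed_YBE[OF P Q T], of "leg S N [x, y, z]"] C
    by (simp only: alg_homD(4)[OF f] A.m_closed perm TC R_matrixD(2)[OF P] R_matrixD(2)[OF Q])
qed

end

section \<open>Elements placed in two legs of the square of a tensor power\<close>

lemma blk_first: "\<lbrakk>1 \<le> j; j \<le> n\<rbrakk> \<Longrightarrow> blk n D j = map (\<lambda>q. (q - 1) * n + j) (D 1)"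
  using blk_eq[of "j - 1" n D 0] by simp

lemma blk_second: "\<lbrakk>1 \<le> j; j \<le> n\<rbrakk> \<Longrightarrow> blk n D (n + j) = map (\<lambda>q. (q - 1) * n + j) (D 2)"
  using blk_eq[of "j - 1" n D 1] by (simp add: numeral_2_eq_2)

lemma legs_ok_block_pair:
  assumes "legs_ok N [p, q]" "j \<in> {1..n}" "k \<in> {1..n}"
  shows "legs_ok (N * n) [(p - 1) * n + j, (q - 1) * n + k]"
proof -
  have ok: "legs_ok (N * n) (block n p @ block n q)"
    using legs_ok_blocks[OF assms(1)] by simp
  have "1 \<le> p" "1 \<le> q" using assms(1) by (auto simp: legs_ok_def)
  then have "p * n = (p - 1) * n + n" "q * n = (q - 1) * n + n"
    by (cases p; simp; fail) (use \<open>1 \<le> q\<close> in \<open>cases q; simp\<close>)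
  then have "(p - 1) * n + j \<in> set (block n p)" "(q - 1) * n + k \<in> set (block n q)"
    unfolding set_block using assms(2,3) by auto
  then show ?thesis using ok unfolding legs_ok_def by auto
qed

context completed_bialgebra
begin

lemma leg_tensor_power_pair:
  assumes ok: "legs_ok N [p, q]" and jk: "j \<in> {1..n}" "k \<in> {1..n}" and x: "x \<in> carrier (tpow S 2)"
  shows "leg (tensor_power n S) N [p, q] (leg S (2 * n) [j, n + k] x) =
    leg S (N * n) [(p - 1) * n + j, (q - 1) * n + k] x"
proof (rule rep_eq[OF rep_comp[OF rep_tensor_power[OF rep.leg[OF rep.ident ok]] rep.leg[OF rep.ident]]
    rep.leg[OF rep.ident legs_ok_block_pair[OF ok jk]] x])
  show "legs_ok (2 * n) [j, n + k]" using jk by (auto simp: legs_ok_def)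
  fix s :: nat assume "1 \<le> s" "s \<le> 2"
  then have "s = 1 \<or> s = 2" by auto
  then show "concat (map (blk n (\<lambda>s. map (\<lambda>i. [p, q] ! (i - 1)) [s])) (map (\<lambda>i. [j, n + k] ! (i - 1)) [s])) =
    map (\<lambda>i. [(p - 1) * n + j, (q - 1) * n + k] ! (i - 1)) [s]"
    using jk by (auto simp: blk_first blk_second)
qed auto

text \<open>The legs \<open>j\<close> and \<open>n + k\<close> lie in different blocks, so splitting
  a block splits exactly one leg of \<open>x\<close>, and the other one moves along with its
  block.\<close>

lemma delta_tensor_power_pair:
  assumes jk: "j \<in> {1..n}" "k \<in> {1..n}" and x: "x \<in> carrier (tpow S 2)"
  shows "delta (tensor_power n S) 2 1 (leg S (2 * n) [j, n + k] x) =
      leg S (3 * n) [j, n + j, 2 * n + k] (delta S 2 1 x)" (is ?A)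
    and "delta (tensor_power n S) 2 2 (leg S (2 * n) [j, n + k] x) =
      leg S (3 * n) [j, n + k, 2 * n + k] (delta S 2 2 x)" (is ?B)
proof -
  have d: "rep S (2 * n) (3 * n) (delta (tensor_power n S) 2 i) (blk n (split_pos i))" if "i \<in> {1, 2}" for i
    using rep_tensor_power_delta[of i 2 S n] that by (auto simp: numeral_3_eq_3)
  have ok: "legs_ok (2 * n) [j, n + k]" "legs_ok (3 * n) [j, n + j, 2 * n + k]"
    "legs_ok (3 * n) [j, n + k, 2 * n + k]"
    using jk by (auto simp: legs_ok_def)
  have s: "s = 1 \<or> s = 2" if "1 \<le> s" "s \<le> 2" for s :: nat
    using that by auto
  show ?A
  proof (rule rep_eq[OF rep_comp[OF d[of 1] rep.leg[OF rep.ident ok(1)]]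
      rep.leg[OF rep.delta[OF rep.ident] ok(2)] x])
    fix t :: nat assume "1 \<le> t" "t \<le> 2"
    from s[OF this] show "concat (map (blk n (split_pos 1)) (map (\<lambda>p. [j, n + k] ! (p - 1)) [t])) =
      map (\<lambda>p. [j, n + j, 2 * n + k] ! (p - 1)) (concat (map (split_pos 1) [t]))"
      using jk by (auto simp: blk_first blk_second split_pos_def)
  qed auto
  show ?B
  proof (rule rep_eq[OF rep_comp[OF d[of 2] rep.leg[OF rep.ident ok(1)]]
      rep.leg[OF rep.delta[OF rep.ident] ok(3)] x])
    fix t :: nat assume "1 \<le> t" "t \<le> 2"
    from s[OF this] show "concat (map (blk n (split_pos 2)) (map (\<lambda>p. [j, n + k] ! (p - 1)) [t])) =
      map (\<lambda>p. [j, n + k, 2 * n + k] ! (p - 1)) (concat (map (split_pos 2) [t]))"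
      using jk by (auto simp: blk_first blk_second split_pos_def)
  qed auto
qed

lemma eps_tensor_power_pair:
  assumes jk: "j \<in> {1..n}" "k \<in> {1..n}" and x: "x \<in> carrier (tpow S 2)"
  shows "eps (tensor_power n S) 2 1 (leg S (2 * n) [j, n + k] x) = leg S n [k] (eps S 2 1 x)" (is ?A)
    and "eps (tensor_power n S) 2 2 (leg S (2 * n) [j, n + k] x) = leg S n [j] (eps S 2 2 x)" (is ?B)
proof -
  have d: "rep S (2 * n) n (eps (tensor_power n S) 2 i) (blk n (drop_pos i))" if "i \<in> {1, 2}" for i
    using rep_tensor_power_eps[of i 2 S n] that by auto
  have ok: "legs_ok (2 * n) [j, n + k]" "legs_ok n [k]" "legs_ok n [j]"
    using jk by (auto simp: legs_ok_def)
  have s: "s = 1 \<or> s = 2" if "1 \<le> s" "s \<le> 2" for s :: nat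
    using that by auto
  show ?A
  proof (rule rep_eq[OF rep_comp[OF d[of 1] rep.leg[OF rep.ident ok(1)]]
      rep.leg[OF rep.eps[OF rep.ident] ok(2)] x])
    fix t :: nat assume "1 \<le> t" "t \<le> 2"
    from s[OF this] show "concat (map (blk n (drop_pos 1)) (map (\<lambda>p. [j, n + k] ! (p - 1)) [t])) =
      map (\<lambda>p. [k] ! (p - 1)) (concat (map (drop_pos 1) [t]))"
      using jk by (auto simp: blk_first blk_second drop_pos_def)
  qed auto
  show ?B
  proof (rule rep_eq[OF rep_comp[OF d[of 2] rep.leg[OF rep.ident ok(1)]]
      rep.leg[OF rep.eps[OF rep.ident] ok(3)] x])
    fix t :: nat assume "1 \<le> t" "t \<le> 2"
    from s[OF this] show "concat (map (blk n (drop_pos 2)) (map (\<lambda>p. [j, n + k] ! (p - 1)) [t])) =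
      map (\<lambda>p. [j] ! (p - 1)) (concat (map (drop_pos 2) [t]))"
      using jk by (auto simp: blk_first blk_second drop_pos_def)
  qed auto
qed

lemma delta_tensor_power_R:
  assumes R: "R_matrix S R" and jk: "j \<in> {1..n}" "k \<in> {1..n}"
  shows "delta (tensor_power n S) 2 1 (leg S (2 * n) [j, n + k] R) =
      leg S (3 * n) [j, 2 * n + k] R \<otimes>\<^bsub>tpow S (3 * n)\<^esub> leg S (3 * n) [n + j, 2 * n + k] R" (is ?A)
    and "delta (tensor_power n S) 2 2 (leg S (2 * n) [j, n + k] R) =
      leg S (3 * n) [j, 2 * n + k] R \<otimes>\<^bsub>tpow S (3 * n)\<^esub> leg S (3 * n) [j, n + k] R" (is ?B)
proof -
  note RC = R_matrixD(2)[OF R]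
  have ok3: "legs_ok 3 [1, 2]" "legs_ok 3 [1, 3]" "legs_ok 3 [2, 3]" by (auto simp: legs_ok_def)
  note C = ok3[THEN leg_pair_closed, OF RC]
  have main: "leg S (3 * n) [x, y, z] (leg S 3 [1, 2] R) = leg S (3 * n) [x, y] R"
    "leg S (3 * n) [x, y, z] (leg S 3 [1, 3] R) = leg S (3 * n) [x, z] R"
    "leg S (3 * n) [x, y, z] (leg S 3 [2, 3] R) = leg S (3 * n) [y, z] R"
    if "legs_ok (3 * n) [x, y, z]" for x y z
    by (rule rep_eq[OF rep.leg[OF rep_leg1] rep_leg1 RC];
        use that in \<open>auto simp: legs_ok_def le_Suc_eq numeral_eq_Suc\<close>)+
  have ok: "legs_ok (3 * n) [j, n + j, 2 * n + k]" "legs_ok (3 * n) [j, n + k, 2 * n + k]"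
    using jk by (auto simp: legs_ok_def)
  have f: "alg_hom K (tpow S 3) (tpow S (3 * n)) (leg S (3 * n) [x, y, z])"
    if "legs_ok (3 * n) [x, y, z]" for x y z
    using that by (intro hom_leg) auto
  show ?A
    unfolding delta_tensor_power_pair(1)[OF jk RC] R_matrixD(3)[OF R]
      alg_homD(4)[OF f[OF ok(1)] C(2,3)] main[OF ok(1)] ..
  show ?B
    unfolding delta_tensor_power_pair(2)[OF jk RC] R_matrixD(4)[OF R]
      alg_homD(4)[OF f[OF ok(2)] C(2,1)] main[OF ok(2)] ..
qed

lemma eps_tensor_power_R:
  assumes R: "R_matrix S R" and jk: "j \<in> {1..n}" "k \<in> {1..n}" and i: "i \<in> {1, 2}"
  shows "eps (tensor_power n S) 2 i (leg S (2 * n) [j, n + k] R) = \<one>\<^bsub>tpow S n\<^esub>"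
proof -
  have "legs_ok n [j]" "legs_ok n [k]" using jk by (auto simp: legs_ok_def)
  then show ?thesis
    using i eps_tensor_power_pair[OF jk R_matrixD(2)[OF R]] R_matrix_counital[OF R]
      leg_one'[of n "[j]" 1] leg_one'[of n "[k]" 1] by auto
qed

section \<open>The twist is a counital cocycle\<close>

lemma J_twist_tri_prod:
  "n \<ge> 1 \<Longrightarrow> J_twist S R n c = tri_prod (tpow S (2 * n)) (\<lambda>k j. leg S (2 * n) [k, n + j] (R (c j k))) n"
  unfolding J_twist_def tri_prod_def
  by (subst upt_conv_Cons[of 1]) (simp_all add: numeral_2_eq_2 del: upt_Suc)

lemma tensor_power_simps [simp]:
  "tpow (tensor_power n S) m = tpow S (m * n)" "tensors (tensor_power n S) m = tensors S (m * n)"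
  by (simp_all add: tensor_power_def)

lemma twisting_J_twist:
  fixes R :: "'c \<Rightarrow> 'a" and c :: "nat \<Rightarrow> nat \<Rightarrow> 'c"
  assumes R: "\<And>a. a \<in> C \<Longrightarrow> R_matrix S (R a)" and n: "n \<ge> 1"
    and c: "\<And>i j. 1 \<le> i \<Longrightarrow> i < j \<Longrightarrow> j \<le> n \<Longrightarrow> c i j \<in> C"
    and trans: "transitive_array n c"
  shows "twisting K (tensor_power n S) (J_twist S R n c)"
proof -
  interpret T: coherent_system K "tensor_power n S" by (rule coherent_tensor_power)
  interpret A1: monoid "tpow S n" by simp
  interpret A2: monoid "tpow S (2 * n)" by simp
  interpret A3: monoid "tpow S (3 * n)" by simp
  \<comment> \<open>Triangular products index rows by the larger index first, the array
    \<open>c\<close> by the smaller one.\<close>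
  define r where "r k i = R (c i k)" for k i
  have r: "R_matrix S (r k i)" if "1 \<le> i" "i < k" "k \<le> n" for i k
    using R c that by (simp add: r_def)
  have rC: "r k i \<in> carrier (tpow S 2)" if "1 \<le> i" "i < k" "k \<le> n" for i k
    using R_matrixD(2)[OF r[OF that]] .
  define V where "V k i = leg S (2 * n) [k, n + i] (r k i)" for k i
  \<comment> \<open>In the notation of \<open>tri_prod_cocycle\<close>, the legs are
    \<open>x k = k\<close>, \<open>y k = n + k\<close> and \<open>z i = 2 * n + i\<close>: one block
    for each of the three tensor factors of the cocycle identity.\<close>
  define X where "X k i = leg S (3 * n) [k, 2 * n + i] (r k i)" for k i
  define Y where "Y k i = leg S (3 * n) [n + k, 2 * n + i] (r k i)" for k i
  define W where "W k i = leg S (3 * n) [k, n + i] (r k i)" for k i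
  have J: "J_twist S R n c = tri_prod (tpow S (2 * n)) V n"
    unfolding J_twist_tri_prod[OF n] V_def r_def ..
  have ok2: "legs_ok (2 * n) [k, n + i]" if "1 \<le> i" "i < k" "k \<le> n" for i k
    using that by (simp add: legs_ok_def)
  have ok3: "legs_ok (3 * n) [k, 2 * n + i]" "legs_ok (3 * n) [n + k, 2 * n + i]" "legs_ok (3 * n) [k, n + i]"
    if "1 \<le> i" "i < k" "k \<le> n" for i k
    using that by (simp_all add: legs_ok_def)
  have VU: "V k i \<in> Units (tpow S (2 * n))" if "1 \<le> i" "i < k" "k \<le> n" for i k
    unfolding V_def using leg_pair_Units[OF ok2[OF that] R_matrixD(1)[OF r[OF that]]] .
  have V: "V k i \<in> carrier (tpow S (2 * n))" if "1 \<le> i" "i < k" "k \<le> n" for i k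
    using VU[OF that] by (rule A2.Units_closed)
  have XYW: "X k i \<in> carrier (tpow S (3 * n))" "Y k i \<in> carrier (tpow S (3 * n))"
    "W k i \<in> carrier (tpow S (3 * n))" if "1 \<le> i" "i < k" "k \<le> n" for i k
    unfolding X_def Y_def W_def using that by (intro leg_pair_closed ok3 rC; simp)+
  have homJ: "f (J_twist S R n c) = tri_prod (tpow S N) g n"
    if f: "alg_hom K (tpow S (2 * n)) (tpow S N) f"
      and g: "\<And>i k. \<lbrakk>1 \<le> i; i < k; k \<le> n\<rbrakk> \<Longrightarrow> f (V k i) = g k i" for f g N
  proof -
    have "f (J_twist S R n c) = tri_prod (tpow S N) (\<lambda>k i. f (V k i)) n"
      unfolding J using V by (intro ring_hom_tri_prod[OF alg_homD(1)[OF f]]) auto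
    also have "\<dots> = tri_prod (tpow S N) g n" using g by (rule tri_prod_cong)
    finally show ?thesis .
  qed
  have d: "alg_hom K (tpow S (2 * n)) (tpow S (3 * n)) (delta (tensor_power n S) 2 i)" if "i \<in> {1, 2}" for i
    using T.hom_delta[of i 2 3] that by auto
  have l: "alg_hom K (tpow S (2 * n)) (tpow S (3 * n)) (leg (tensor_power n S) 3 [p, q])"
    if "legs_ok 3 [p, q]" for p q
    using T.hom_leg[of 3 "[p, q]" 2] that by auto
  have e: "alg_hom K (tpow S (2 * n)) (tpow S n) (eps (tensor_power n S) 2 i)" if "i \<in> {1, 2}" for i
    using T.hom_eps[of i 2 1] that by auto
  have ok12: "legs_ok 3 [1, 2]" "legs_ok 3 [2, 3]" by (auto simp: legs_ok_def)
  have "tri_prod (tpow S n) (\<lambda>_ _. \<one>\<^bsub>tpow S n\<^esub>) n = \<one>\<^bsub>tpow S n\<^esub>"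
    unfolding tri_prod_def by (rule A1.ordered_prod_ones) auto
  \<comment> \<open>Each factor of \<open>J\<close> has one leg in the block on which the counit
    acts, so counitality of the R-matrices turns every factor into \<open>1\<close>.\<close>
  moreover have "eps (tensor_power n S) 2 i (J_twist S R n c) = tri_prod (tpow S n) (\<lambda>_ _. \<one>\<^bsub>tpow S n\<^esub>) n"
    if "i \<in> {1, 2}" for i
    using eps_tensor_power_R[OF r _ _ that] by (intro homJ[OF e[OF that]]) (auto simp: V_def)
  ultimately have eps_J: "eps (tensor_power n S) 2 i (J_twist S R n c) = \<one>\<^bsub>tpow S n\<^esub>" if "i \<in> {1, 2}" for i
    using that by simp
  have d1: "delta (tensor_power n S) 2 1 (J_twist S R n c) =
    tri_prod (tpow S (3 * n)) (\<lambda>k i. X k i \<otimes>\<^bsub>tpow S (3 * n)\<^esub> Y k i) n"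
    using delta_tensor_power_R(1)[OF r] by (intro homJ[OF d]) (auto simp: V_def X_def Y_def)
  have d2: "delta (tensor_power n S) 2 2 (J_twist S R n c) =
    tri_prod (tpow S (3 * n)) (\<lambda>k i. X k i \<otimes>\<^bsub>tpow S (3 * n)\<^esub> W k i) n"
    using delta_tensor_power_R(2)[OF r] by (intro homJ[OF d]) (auto simp: V_def X_def W_def)
  have l1: "leg (tensor_power n S) 3 [1, 2] (J_twist S R n c) = tri_prod (tpow S (3 * n)) W n"
    using leg_tensor_power_pair[OF ok12(1) _ _ rC] by (intro homJ[OF l[OF ok12(1)]]) (auto simp: V_def W_def)
  have l2: "leg (tensor_power n S) 3 [2, 3] (J_twist S R n c) = tri_prod (tpow S (3 * n)) Y n"
    using leg_tensor_power_pair[OF ok12(2) _ _ rC] by (intro homJ[OF l[OF ok12(2)]]) (auto simp: V_def Y_def)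
  have "tri_prod (tpow S (3 * n)) (\<lambda>k i. X k i \<otimes>\<^bsub>tpow S (3 * n)\<^esub> Y k i) n
      \<otimes>\<^bsub>tpow S (3 * n)\<^esub> tri_prod (tpow S (3 * n)) W n =
    tri_prod (tpow S (3 * n)) (\<lambda>k i. X k i \<otimes>\<^bsub>tpow S (3 * n)\<^esub> W k i) n
      \<otimes>\<^bsub>tpow S (3 * n)\<^esub> tri_prod (tpow S (3 * n)) Y n"
  proof (rule A3.tri_prod_cocycle[OF XYW(1) XYW(2) XYW(3)])
    fix i j k assume ijk: "1 \<le> i" "i < j" "j < k" "k \<le> n"
    \<comment> \<open>The middle factor \<open>X k i\<close> carries color \<open>c i k\<close>, the
      outer factors \<open>W k j\<close> and \<open>Y j i\<close> carry \<open>c j k\<close> and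
      \<open>c i j\<close>. Transitivity is exactly the condition of \<open>mixed_YBE\<close> on the
      middle R-matrix.\<close>
    then have "c i k = c i j \<or> c i k = c j k" using trans by (auto simp: transitive_array_def)
    then have "r k i = r k j \<or> r k i = r j i" by (auto simp: r_def)
    then show "W k j \<otimes>\<^bsub>tpow S (3 * n)\<^esub> X k i \<otimes>\<^bsub>tpow S (3 * n)\<^esub> Y j i =
      Y j i \<otimes>\<^bsub>tpow S (3 * n)\<^esub> X k i \<otimes>\<^bsub>tpow S (3 * n)\<^esub> W k j"
      unfolding W_def X_def Y_def using ijk
      by (intro mixed_YBE_legs r) (auto simp: legs_ok_def)
  next
    fix i j k l assume "1 \<le> i" "i < j" "j \<le> n" "1 \<le> k" "k < l" "l \<le> n" "k \<noteq> i"
    then show "Y j i \<otimes>\<^bsub>tpow S (3 * n)\<^esub> X l k = X l k \<otimes>\<^bsub>tpow S (3 * n)\<^esub> Y j i"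
      unfolding Y_def X_def by (intro leg_pair_commute ok3 rC) auto
  next
    fix i j k l assume "1 \<le> i" "i < j" "j \<le> n" "1 \<le> k" "k < l" "l \<le> n" "k \<noteq> j"
    then show "Y j i \<otimes>\<^bsub>tpow S (3 * n)\<^esub> W l k = W l k \<otimes>\<^bsub>tpow S (3 * n)\<^esub> Y j i"
      unfolding Y_def W_def by (intro leg_pair_commute ok3 rC) auto
  next
    fix i j k l assume "1 \<le> i" "i < j" "j \<le> n" "1 \<le> k" "k < l" "l \<le> n" "j \<noteq> l"
    then show "X j i \<otimes>\<^bsub>tpow S (3 * n)\<^esub> W l k = W l k \<otimes>\<^bsub>tpow S (3 * n)\<^esub> X j i"
      unfolding X_def W_def by (intro leg_pair_commute ok3 rC) auto
  qed
  note cocycle = this[folded d1 d2 l1 l2]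
  have "J_twist S R n c \<in> Units (tpow S (2 * n))"
    unfolding J by (rule A2.tri_prod_Units[OF VU])
  then show ?thesis
    using eps_J[of 1] eps_J[of 2] cocycle by unfold_locales simp_all
qed

section \<open>The diagonal R-matrix of the tensor power\<close>

definition diag_R :: "('c \<Rightarrow> 'a) \<Rightarrow> nat \<Rightarrow> (nat \<Rightarrow> 'c) \<Rightarrow> 'a" where
  "diag_R R n d =
    ordered_prod (tpow S (2 * n)) (map (\<lambda>i. leg S (2 * n) [i, n + i] (R (d i))) [1..<n + 1])"

text \<open>This is the natural R-matrix of a tensor product of bialgebras, with
  \<open>R (d i)\<close> on the \<open>i\<close>-th factor. Different factors of the product occupy
  disjoint offsets in the blocks, so each axiom is the product of those for the single
  \<open>R (d i)\<close> once factors with different indices have been commuted.\<close>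

lemma diag_R_universal:
  assumes R: "\<And>i. \<lbrakk>1 \<le> i; i \<le> n\<rbrakk> \<Longrightarrow> R_matrix S (R (d i))"
  shows "diag_R R n d \<in> Units (tpow S (2 * n))"
    and "intertwiner (tensor_power n S) (diag_R R n d)"
    and "delta (tensor_power n S) 2 1 (diag_R R n d) =
      leg (tensor_power n S) 3 [1, 3] (diag_R R n d) \<otimes>\<^bsub>tpow S (3 * n)\<^esub>
      leg (tensor_power n S) 3 [2, 3] (diag_R R n d)"
    and "delta (tensor_power n S) 2 2 (diag_R R n d) =
      leg (tensor_power n S) 3 [1, 3] (diag_R R n d) \<otimes>\<^bsub>tpow S (3 * n)\<^esub>
      leg (tensor_power n S) 3 [1, 2] (diag_R R n d)"
proof -
  interpret T: coherent_system K "tensor_power n S" by (rule coherent_tensor_power)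
  interpret A2: monoid "tpow S (2 * n)" by simp
  interpret A3: monoid "tpow S (3 * n)" by simp
  let ?xs = "[1..<n + 1]"
  define r where "r i = R (d i)" for i
  have r: "R_matrix S (r i)" if "i \<in> set ?xs" for i
    using R that by (auto simp: r_def simp del: upt_Suc)
  have rC: "r i \<in> carrier (tpow S 2)" if "i \<in> set ?xs" for i
    using R_matrixD(2)[OF r[OF that]] .
  define V where "V i = leg S (2 * n) [i, n + i] (r i)" for i
  have D: "diag_R R n d = ordered_prod (tpow S (2 * n)) (map V ?xs)"
    by (simp add: diag_R_def V_def[abs_def] r_def del: upt_Suc)
  have VU: "V i \<in> Units (tpow S (2 * n))" if "i \<in> set ?xs" for i
    unfolding V_def using that R_matrixD(1)[OF r[OF that]]
    by (intro leg_pair_Units) (auto simp: legs_ok_def)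
  have V: "V i \<in> carrier (tpow S (2 * n))" if "i \<in> set ?xs" for i
    using VU[OF that] by (rule A2.Units_closed)
  have xs: "i \<in> {1..n}" if "i \<in> set ?xs" for i using that by auto
  show "diag_R R n d \<in> Units (tpow S (2 * n))"
    unfolding D using VU by (intro A2.ordered_prod_Units) (auto simp del: upt_Suc)
  have homD: "f (diag_R R n d) = ordered_prod (tpow S N) (map g ?xs)"
    if f: "alg_hom K (tpow S (2 * n)) (tpow S N) f" and g: "\<And>i. i \<in> set ?xs \<Longrightarrow> f (V i) = g i" for f g N
  proof -
    have "f (diag_R R n d) = ordered_prod (tpow S N) (map f (map V ?xs))"
      unfolding D using V by (intro ring_hom_ordered_prod[OF alg_homD(1)[OF f]]) (auto simp del: upt_Suc)
    also have "map f (map V ?xs) = map g ?xs" using g by (simp del: upt_Suc)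
    finally show ?thesis .
  qed
  have legD: "leg (tensor_power n S) N [p, q] (diag_R R n d) =
    ordered_prod (tpow S (N * n)) (map (\<lambda>i. leg S (N * n) [(p - 1) * n + i, (q - 1) * n + i] (r i)) ?xs)"
    if ok: "legs_ok N [p, q]" for N p q
  proof (rule homD)
    show "alg_hom K (tpow S (2 * n)) (tpow S (N * n)) (leg (tensor_power n S) N [p, q])"
      using T.hom_leg[OF ok, of 2] by simp
  qed (use leg_tensor_power_pair[OF ok xs xs rC] in \<open>simp add: V_def\<close>)
  have dh: "alg_hom K (tpow S (2 * n)) (tpow S (3 * n)) (delta (tensor_power n S) 2 i)" if "i \<in> {1, 2}" for i
    using T.hom_delta[of i 2 3] that by auto
  have ok3: "legs_ok 3 [1, 2]" "legs_ok 3 [1, 3]" "legs_ok 3 [2, 3]" by (auto simp: legs_ok_def)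
  define X where "X i = leg S (3 * n) [i, 2 * n + i] (r i)" for i
  define Y where "Y i = leg S (3 * n) [n + i, 2 * n + i] (r i)" for i
  define W where "W i = leg S (3 * n) [i, n + i] (r i)" for i
  have legs: "leg (tensor_power n S) 3 [1, 2] (diag_R R n d) = ordered_prod (tpow S (3 * n)) (map W ?xs)"
    "leg (tensor_power n S) 3 [1, 3] (diag_R R n d) = ordered_prod (tpow S (3 * n)) (map X ?xs)"
    "leg (tensor_power n S) 3 [2, 3] (diag_R R n d) = ordered_prod (tpow S (3 * n)) (map Y ?xs)"
    using legD[OF ok3(1)] legD[OF ok3(2)] legD[OF ok3(3)]
    by (simp_all add: X_def[abs_def] Y_def[abs_def] W_def[abs_def] del: upt_Suc)
  have okn: "legs_ok (3 * n) [i, 2 * n + i]" "legs_ok (3 * n) [n + i, 2 * n + i]" "legs_ok (3 * n) [i, n + i]"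
    if "i \<in> set ?xs" for i
    using xs[OF that] by (auto simp: legs_ok_def)
  have XYW: "X i \<in> carrier (tpow S (3 * n))" "Y i \<in> carrier (tpow S (3 * n))"
    "W i \<in> carrier (tpow S (3 * n))" if "i \<in> set ?xs" for i
    unfolding X_def Y_def W_def using that by (intro leg_pair_closed okn rC; assumption)+
  have YX: "Y i \<otimes>\<^bsub>tpow S (3 * n)\<^esub> X j = X j \<otimes>\<^bsub>tpow S (3 * n)\<^esub> Y i"
    and WX: "W i \<otimes>\<^bsub>tpow S (3 * n)\<^esub> X j = X j \<otimes>\<^bsub>tpow S (3 * n)\<^esub> W i"
    if "i \<in> set ?xs" "j \<in> set ?xs" "i \<noteq> j" for i j
    unfolding X_def Y_def W_def
    using that xs[OF that(1)] xs[OF that(2)] by (intro leg_pair_commute okn rC; auto simp del: upt_Suc)+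
  have sorted: "sorted_wrt (\<lambda>i j. f i \<otimes>\<^bsub>tpow S (3 * n)\<^esub> X j = X j \<otimes>\<^bsub>tpow S (3 * n)\<^esub> f i) ?xs"
    if "\<And>i j. \<lbrakk>i \<in> set ?xs; j \<in> set ?xs; i \<noteq> j\<rbrakk> \<Longrightarrow>
      f i \<otimes>\<^bsub>tpow S (3 * n)\<^esub> X j = X j \<otimes>\<^bsub>tpow S (3 * n)\<^esub> f i" for f
    by (rule sorted_wrt_mono_rel[OF _ sorted_wrt_upt]) (use that in \<open>auto simp del: upt_Suc\<close>)
  have "delta (tensor_power n S) 2 1 (diag_R R n d) =
    ordered_prod (tpow S (3 * n)) (map (\<lambda>i. X i \<otimes>\<^bsub>tpow S (3 * n)\<^esub> Y i) ?xs)"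
    by (rule homD[OF dh]) (use delta_tensor_power_R(1)[OF r xs xs] in \<open>auto simp: V_def X_def Y_def simp del: upt_Suc\<close>)
  then show "delta (tensor_power n S) 2 1 (diag_R R n d) =
      leg (tensor_power n S) 3 [1, 3] (diag_R R n d) \<otimes>\<^bsub>tpow S (3 * n)\<^esub>
      leg (tensor_power n S) 3 [2, 3] (diag_R R n d)"
    unfolding legs using A3.ordered_prod_mult[OF XYW(1) XYW(2) sorted[OF YX]] by simp
  have "delta (tensor_power n S) 2 2 (diag_R R n d) =
    ordered_prod (tpow S (3 * n)) (map (\<lambda>i. X i \<otimes>\<^bsub>tpow S (3 * n)\<^esub> W i) ?xs)"
    by (rule homD[OF dh]) (use delta_tensor_power_R(2)[OF r xs xs] in \<open>auto simp: V_def X_def W_def simp del: upt_Suc\<close>)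
  then show "delta (tensor_power n S) 2 2 (diag_R R n d) =
      leg (tensor_power n S) 3 [1, 3] (diag_R R n d) \<otimes>\<^bsub>tpow S (3 * n)\<^esub>
      leg (tensor_power n S) 3 [1, 2] (diag_R R n d)"
    unfolding legs using A3.ordered_prod_mult[OF XYW(1) XYW(3) sorted[OF WX]] by simp
  show "intertwiner (tensor_power n S) (diag_R R n d)"
    unfolding intertwiner_def
  proof (intro allI impI, elim conjE)
    fix m i Z assume i: "1 \<le> i" "i \<le> m" and "Z \<in> carrier (tpow (tensor_power n S) m)"
    then have Z: "Z \<in> carrier (tpow S (m * n))" by simp
    let ?N = "(m + 1) * n"
    interpret A: monoid "tpow S ?N" by simp
    let ?u = "leg (tensor_power n S) (m + 1) [i, i + 1] (diag_R R n d)"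
    define P where "P j = leg S ?N [(i - 1) * n + j, (i + 1 - 1) * n + j] (r j)" for j
    have ok: "legs_ok (m + 1) [i, i + 1]" using i by (simp add: legs_ok_def)
    have u: "?u = ordered_prod (tpow S ?N) (map P ?xs)"
      unfolding P_def by (rule legD[OF ok])
    have okP: "legs_ok ?N [(i - 1) * n + j, (i + 1 - 1) * n + j]" if "j \<in> set ?xs" for j
      using legs_ok_block_pair[OF ok xs xs] that by blast
    have P: "P j \<in> carrier (tpow S ?N)" if "j \<in> set ?xs" for j
      unfolding P_def using that by (intro leg_pair_closed okP rC)
    have uC: "?u \<in> carrier (tpow S ?N)"
      unfolding u using P by (intro A.ordered_prod_closed) (auto simp del: upt_Suc)
    have "?u \<otimes>\<^bsub>tpow S ?N\<^esub> delta (tensor_power n S) m i Z =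
      leg (tensor_power n S) (m + 1) (swap_pos (m + 1) i) (delta (tensor_power n S) m i Z) \<otimes>\<^bsub>tpow S ?N\<^esub> ?u"
    proof (rule intertwine_pairs[OF rep_tensor_power_delta[OF i] rep_tensor_power[OF rep_swap_delta[OF i]] uC Z])
      fix s h assume "1 \<le> s" "s \<le> m * n" and h: "h \<in> carrier H"
      then obtain b t where s: "s = b * n + t + 1" "b < m" "t < n" by (metis blk_cases)
      show "(\<exists>p. blk n (split_pos i) s = [p] \<and> blk n (\<lambda>s. if s = i then [i + 1, i] else split_pos i s) s = [p] \<and>
          ?u \<otimes>\<^bsub>tpow S ?N\<^esub> gen ?N p h = gen ?N p h \<otimes>\<^bsub>tpow S ?N\<^esub> ?u) \<or>
        (\<exists>p q. blk n (split_pos i) s = [p, q] \<and>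
          blk n (\<lambda>s. if s = i then [i + 1, i] else split_pos i s) s = [q, p] \<and>
          ?u \<otimes>\<^bsub>tpow S ?N\<^esub> leg S ?N [p, q] (cop h) = leg S ?N [q, p] (cop h) \<otimes>\<^bsub>tpow S ?N\<^esub> ?u)"
      proof (cases "b + 1 = i")
        case False
        \<comment> \<open>Splitting block \<open>i\<close> moves later blocks up by one. In either
          case block \<open>q\<close> differs from the blocks \<open>i\<close> and
          \<open>i + 1\<close> that contain the legs of \<open>?u\<close>.\<close>
        define q where "q = (if b + 1 < i then b + 1 else b + 2)"
        have q: "1 \<le> q" "q \<le> m + 1" "q \<noteq> i" "q \<noteq> i + 1" "split_pos i (b + 1) = [q]"
          using False s(2) i by (auto simp: q_def split_pos_def)
        have blks: "blk n (split_pos i) s = [(q - 1) * n + t + 1]"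
          "blk n (\<lambda>s. if s = i then [i + 1, i] else split_pos i s) s = [(q - 1) * n + t + 1]"
          unfolding s(1) blk_eq[OF s(3)] using False q(5) by simp_all
        have t1: "t + 1 \<in> set ?xs" using s(3) by (simp del: upt_Suc)
        have comm: "P j \<otimes>\<^bsub>tpow S ?N\<^esub> gen ?N ((q - 1) * n + t + 1) h =
          gen ?N ((q - 1) * n + t + 1) h \<otimes>\<^bsub>tpow S ?N\<^esub> P j" if j: "j \<in> set ?xs" for j
        proof -
          have "legs_ok ?N [(i - 1) * n + j, (q - 1) * n + (t + 1)]"
            "legs_ok ?N [(i + 1 - 1) * n + j, (q - 1) * n + (t + 1)]"
            using q i by (intro legs_ok_block_pair xs j t1; auto simp: legs_ok_def)+
          then show ?thesis
            unfolding P_def using h rC[OF j] okP[OF j]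
            by (intro leg_gen_commute) (auto simp: legs_ok_def algebra_simps)
        qed
        have "?u \<otimes>\<^bsub>tpow S ?N\<^esub> gen ?N ((q - 1) * n + t + 1) h =
          gen ?N ((q - 1) * n + t + 1) h \<otimes>\<^bsub>tpow S ?N\<^esub> ?u"
          unfolding u using h by (intro A.ordered_prod_commute gen_closed P comm)
        then show ?thesis using blks by blast
      next
        case True
        have t1: "t + 1 \<in> set ?xs" using s(3) by (simp del: upt_Suc)
        let ?p = "(i - 1) * n + t + 1" and ?q = "(i + 1 - 1) * n + t + 1"
        have blks: "blk n (split_pos i) s = [?p, ?q]"
          "blk n (\<lambda>s. if s = i then [i + 1, i] else split_pos i s) s = [?q, ?p]"
          unfolding s(1) blk_eq[OF s(3)] using True by (simp_all add: split_pos_def)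
        have okt: "legs_ok ?N [?p, ?q]" "legs_ok ?N [?q, ?p]"
          using okP[OF t1] by (auto simp: legs_ok_def algebra_simps)
        \<comment> \<open>Among the factors of \<open>?u\<close> only \<open>P (t + 1)\<close> has
          the legs \<open>?p\<close> and \<open>?q\<close>. It reverses the coproduct placed there,
          and all the others commute with both orders of it.\<close>
        have jt: "P (t + 1) \<otimes>\<^bsub>tpow S ?N\<^esub> leg S ?N [?p, ?q] (cop h) =
          leg S ?N [?q, ?p] (cop h) \<otimes>\<^bsub>tpow S ?N\<^esub> P (t + 1)"
          using leg_R_cop[OF r[OF t1] okt(1) h] by (simp add: P_def add.assoc)
        have comm: "P j \<otimes>\<^bsub>tpow S ?N\<^esub> leg S ?N [x, y] (cop h) = leg S ?N [x, y] (cop h) \<otimes>\<^bsub>tpow S ?N\<^esub> P j"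
          if j: "j \<in> set ?xs" "j \<noteq> t + 1" and xy: "{x, y} = {?p, ?q}" "legs_ok ?N [x, y]" for j x y
        proof -
          have "legs_ok ?N [(i - 1) * n + j, (i + 1 - 1) * n + (t + 1)]"
            "legs_ok ?N [(i + 1 - 1) * n + j, (i - 1) * n + (t + 1)]"
            using i by (intro legs_ok_block_pair xs j t1; auto simp: legs_ok_def)+
          then have "{(i - 1) * n + j, (i + 1 - 1) * n + j} \<inter> {?p, ?q} = {}"
            using j(2) by (auto simp: legs_ok_def algebra_simps)
          then show ?thesis
            unfolding P_def using h rC[OF j(1)] okP[OF j(1)] xy
            by (intro leg_pair_commute) auto
        qed
        have "?u \<otimes>\<^bsub>tpow S ?N\<^esub> leg S ?N [?p, ?q] (cop h) = leg S ?N [?q, ?p] (cop h) \<otimes>\<^bsub>tpow S ?N\<^esub> ?u"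
          unfolding u
        proof (rule A.ordered_prod_intertwine_one[OF t1 distinct_upt])
          show "leg S ?N [?p, ?q] (cop h) \<in> carrier (tpow S ?N)" "leg S ?N [?q, ?p] (cop h) \<in> carrier (tpow S ?N)"
            using okt h by (auto intro: leg_pair_closed simp del: One_nat_def)
        qed (rule P jt comm; use okt in blast)+
        then show ?thesis using blks by blast
      qed
    qed
    then show "?u \<otimes>\<^bsub>tpow (tensor_power n S) (m + 1)\<^esub> delta (tensor_power n S) m i Z =
      leg (tensor_power n S) (m + 1) (swap_pos (m + 1) i) (delta (tensor_power n S) m i Z)
        \<otimes>\<^bsub>tpow (tensor_power n S) (m + 1)\<^esub> ?u"
      by simp
  qed
qed

end

theorem theorem1p9:
  fixes K :: "'k ring"
    and H :: "('k, 'h) module"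
    and counit :: "'h \<Rightarrow> 'k"
    and tens :: "nat \<Rightarrow> 'h list \<Rightarrow> 'a"
    and S :: "('k, 'a) tensor_system"
    and C :: "'c set"
    and R :: "'c \<Rightarrow> 'a"
    and n :: nat
    and c :: "nat \<Rightarrow> nat \<Rightarrow> 'c"
  assumes "completed_bialgebra K H counit tens S"
    and "\<And>a. a \<in> C \<Longrightarrow> R_matrix S (R a)"
    and "n \<ge> 1"
    and "\<And>i j. 1 \<le> i \<Longrightarrow> i < j \<Longrightarrow> j \<le> n \<Longrightarrow> c i j \<in> C"
    and "transitive_array n c"
  shows "drinfeld_twist K (tensor_power n S) (J_twist S R n c) \<and>
    (\<forall>d. (\<forall>i\<in>{1..n}. d i \<in> C) \<longrightarrow>
       R_matrix (twisted (tensor_power n S) (J_twist S R n c)) (R_cd S R n c d) \<and>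
       QYBE (tensor_power n S) (R_cd S R n c d))"
proof -
  interpret completed_bialgebra K H counit tens S by fact
  interpret T: twisting K "tensor_power n S" "J_twist S R n c"
    using assms(2-) by (rule twisting_J_twist)
  have "R_matrix (twisted (tensor_power n S) (J_twist S R n c)) (R_cd S R n c d) \<and>
      QYBE (tensor_power n S) (R_cd S R n c d)" if d: "\<forall>i\<in>{1..n}. d i \<in> C" for d
  proof -
    have R: "R_matrix S (R (d i))" if "1 \<le> i" "i \<le> n" for i
      using assms(2) d that by auto
    note D = diag_R_universal[where R = R and d = d and n = n, OF R]
    \<comment> \<open>The flip of two blocks of \<open>n\<close> factors is \<open>op\<close>, so
      \<open>R_cd\<close> is the diagonal R-matrix twisted by \<open>J\<close>.\<close>
    have "leg (tensor_power n S) 2 [2, 1] = op S n"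
      by (simp add: tensor_power_def op_def block_def numeral_2_eq_2 del: upt_Suc)
    then have "R_cd S R n c d = T.twist_R (diag_R R n d)"
      by (simp add: R_cd_def T.twist_R_def diag_R_def del: upt_Suc)
    then show ?thesis
      using T.twist_R_matrix[of "diag_R R n d"] T.twist_R_QYBE[of "diag_R R n d"] D by simp
  qed
  then show ?thesis using T.twisted_drinfeld_twist by blast
qed

end
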